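(* Let $s\ge2$ be an integer. There is a short exact sequence of $C^*$-algebras $$0\to\mathcal{K}\to A_W\to\mathcal{T}\otimes C(\mathbb{Z}_s)\to0 .$$
   Context: $\mathbb{Z}_s=\varprojlim\mathbb{Z}/s^m\mathbb{Z}$ is the compact ring of $s$-adic integers, with $\mathbb{Z}\subseteq\mathbb{Z}_s$. Let $\mathcal{V}=\{(n,x)\mid n\in\mathbb{Z}_{\ge0},\ x\in\mathbb{Z},\ 0\le x<s^n\}$ and $H=\ell^2(\mathcal{V})$ with canonical orthonormal basis $\{E_{(n,x)}\}$. For $f\in C(\mathbb{Z}_s)$ let $M_fE_{(n,x)}=f(x)E_{(n,x)}$. The Serre shift is the isometry $W$ on $H$ given by $WE_{(n,x)}=\frac{1}{\sqrt{s}}\sum_{j=0}^{s-1}E_{(n+1,x+js^n)}$. $A_W=C^*(W,M_f\mid f\in C(\mathbb{Z}_s))$ is the $C^*$-subalgebra of $B(H)$ generated by $W$ and all $M_f$. $\mathcal{K}$ is the algebra of compact operators on a separable infinite-dimensional Hilbert space and $\mathcal{T}$ is the Toeplitz algebra (the $C^*$-algebra generated by the unilateral shift on $\ell^2(\mathbb{Z}_{\ge0})$). *)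

theory Defs
  imports "HOL-Analysis.Analysis"
begin

section \<open>The Hilbert space of square-summable functions\<close>

typedef 'a ell2 = "{f :: 'a \<Rightarrow> complex. (\<lambda>i. (cmod (f i))\<^sup>2) summable_on UNIV}"
  morphisms coef Abs_ell2
  by (rule exI[of _ "\<lambda>_. 0"]) simp

setup_lifting type_definition_ell2

lemma square_summable_add:
  assumes "(\<lambda>i. (cmod (f i))\<^sup>2) summable_on A" "(\<lambda>i. (cmod (g i))\<^sup>2) summable_on A"
  shows "(\<lambda>i. (cmod (f i + g i))\<^sup>2) summable_on A"
proof (rule summable_on_comparison_test)
  show "(\<lambda>i. 2 * (cmod (f i))\<^sup>2 + 2 * (cmod (g i))\<^sup>2) summable_on A"
    by (intro summable_on_add summable_on_cmult_right assms)
  fix i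
  have "(cmod (f i + g i))\<^sup>2 \<le> (cmod (f i) + cmod (g i))\<^sup>2"
    by (simp add: power_mono norm_triangle_ineq)
  also have "\<dots> \<le> 2 * (cmod (f i))\<^sup>2 + 2 * (cmod (g i))\<^sup>2"
    using sum_squares_bound[of "cmod (f i)" "cmod (g i)"] by (simp add: power2_sum)
  finally show "(cmod (f i + g i))\<^sup>2 \<le> 2 * (cmod (f i))\<^sup>2 + 2 * (cmod (g i))\<^sup>2" .
qed simp

lemma square_summable_cmult:
  "(\<lambda>i. (cmod (f i))\<^sup>2) summable_on A \<Longrightarrow> (\<lambda>i. (cmod (c * f i))\<^sup>2) summable_on A"
  by (simp add: norm_mult power_mult_distrib summable_on_cmult_right)

lemma square_summable_prod:
  assumes "(\<lambda>i. (cmod (f i))\<^sup>2) summable_on A" "(\<lambda>i. (cmod (g i))\<^sup>2) summable_on A"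
  shows "(\<lambda>i. cnj (f i) * g i) summable_on A"
proof (rule abs_summable_summable, rule summable_on_comparison_test)
  show "(\<lambda>i. (cmod (f i))\<^sup>2 + (cmod (g i))\<^sup>2) summable_on A"
    by (intro summable_on_add assms)
  show "norm (cnj (f i) * g i) \<le> (cmod (f i))\<^sup>2 + (cmod (g i))\<^sup>2" for i
  proof -
    have "0 \<le> cmod (f i) * cmod (g i)" by simp
    then show ?thesis
      using sum_squares_bound[of "cmod (f i)" "cmod (g i)"] unfolding norm_mult complex_mod_cnj by linarith
  qed
qed simp

lift_definition scale_ell2 :: "complex \<Rightarrow> 'a ell2 \<Rightarrow> 'a ell2"  (infixr \<open>*\<^sub>C\<close> 75)
  is "\<lambda>c f i. c * f i"
  by (rule square_summable_cmult)

text \<open>Conjugate-linear in the first argument.\<close>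

lift_definition cinner :: "'a ell2 \<Rightarrow> 'a ell2 \<Rightarrow> complex"
  is "\<lambda>f g. \<Sum>\<^sub>\<infinity>i. cnj (f i) * g i" .

instantiation ell2 :: (type) real_inner
begin

lift_definition zero_ell2 :: "'a ell2" is "\<lambda>_. 0" by simp

lift_definition plus_ell2 :: "'a ell2 \<Rightarrow> 'a ell2 \<Rightarrow> 'a ell2" is "\<lambda>f g i. f i + g i"
  by (rule square_summable_add)

lift_definition uminus_ell2 :: "'a ell2 \<Rightarrow> 'a ell2" is "\<lambda>f i. - f i" by simp

lift_definition minus_ell2 :: "'a ell2 \<Rightarrow> 'a ell2 \<Rightarrow> 'a ell2" is "\<lambda>f g i. f i - g i"
proof -
  fix f g :: "'a \<Rightarrow> complex"
  assume "(\<lambda>i. (cmod (f i))\<^sup>2) summable_on UNIV" "(\<lambda>i. (cmod (g i))\<^sup>2) summable_on UNIV"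
  then show "(\<lambda>i. (cmod (f i - g i))\<^sup>2) summable_on UNIV"
    using square_summable_add[of f UNIV "\<lambda>i. - g i"] by simp
qed

lift_definition scaleR_ell2 :: "real \<Rightarrow> 'a ell2 \<Rightarrow> 'a ell2" is "\<lambda>r f i. of_real r * f i"
  by (rule square_summable_cmult)

definition inner_ell2 :: "'a ell2 \<Rightarrow> 'a ell2 \<Rightarrow> real"
  where "inner_ell2 v w = Re (cinner v w)"

definition norm_ell2 :: "'a ell2 \<Rightarrow> real"
  where "norm_ell2 v = sqrt (inner v v)"

definition sgn_ell2 :: "'a ell2 \<Rightarrow> 'a ell2"
  where "sgn_ell2 v = inverse (norm v) *\<^sub>R v"

definition dist_ell2 :: "'a ell2 \<Rightarrow> 'a ell2 \<Rightarrow> real"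
  where "dist_ell2 v w = norm (v - w)"

definition uniformity_ell2 :: "('a ell2 \<times> 'a ell2) filter"
  where "uniformity_ell2 = (INF e\<in>{0<..}. principal {(v, w). dist v w < e})"

definition open_ell2 :: "'a ell2 set \<Rightarrow> bool"
  where "open_ell2 U \<longleftrightarrow> (\<forall>v\<in>U. eventually (\<lambda>(v', w). v' = v \<longrightarrow> w \<in> U) uniformity)"

instance
proof
  fix u v w :: "'a ell2" and r q :: real
  show "u + v + w = u + (v + w)" "u + v = v + u" "0 + u = u" "- u + u = 0" "u - v = u + - v"
    by (transfer, simp add: algebra_simps)+
  show "r *\<^sub>R (u + v) = r *\<^sub>R u + r *\<^sub>R v" "(r + q) *\<^sub>R u = r *\<^sub>R u + q *\<^sub>R u"
    "r *\<^sub>R q *\<^sub>R u = (r * q) *\<^sub>R u" "1 *\<^sub>R u = u"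
    by (transfer, simp add: algebra_simps)+
  show "sgn u = inverse (norm u) *\<^sub>R u" by (rule sgn_ell2_def)
  show "dist u v = norm (u - v)" by (rule dist_ell2_def)
  show "(uniformity :: ('a ell2 \<times> 'a ell2) filter) = (INF e\<in>{0<..}. principal {(v, w). dist v w < e})"
    by (rule uniformity_ell2_def)
  show "open U = (\<forall>v\<in>U. \<forall>\<^sub>F (v', w) in uniformity. v' = v \<longrightarrow> w \<in> U)" for U :: "'a ell2 set"
    by (rule open_ell2_def)
  show "inner u v = inner v u" unfolding inner_ell2_def
  proof transfer
    fix u v :: "'a \<Rightarrow> complex"
    have "(\<Sum>\<^sub>\<infinity>i. cnj (v i) * u i) = cnj (\<Sum>\<^sub>\<infinity>i. cnj (u i) * v i)"
      by (subst infsum_cnj[symmetric]) (simp add: mult.commute)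
    then show "Re (\<Sum>\<^sub>\<infinity>i. cnj (u i) * v i) = Re (\<Sum>\<^sub>\<infinity>i. cnj (v i) * u i)" by simp
  qed
  show "inner (u + v) w = inner u w + inner v w" unfolding inner_ell2_def
    by transfer (simp add: distrib_right infsum_add square_summable_prod)
  show "inner (r *\<^sub>R u) v = r * inner u v" unfolding inner_ell2_def
  proof transfer
    fix r and u v :: "'a \<Rightarrow> complex"
    assume "(\<lambda>i. (cmod (u i))\<^sup>2) summable_on UNIV" "(\<lambda>i. (cmod (v i))\<^sup>2) summable_on UNIV"
    then have "(\<lambda>i. cnj (u i) * v i) summable_on UNIV" by (rule square_summable_prod)
    then have "(\<Sum>\<^sub>\<infinity>i. of_real r * (cnj (u i) * v i)) = of_real r * (\<Sum>\<^sub>\<infinity>i. cnj (u i) * v i)"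
      by (rule infsum_cmult_right)
    then show "Re (\<Sum>\<^sub>\<infinity>i. cnj (of_real r * u i) * v i) = r * Re (\<Sum>\<^sub>\<infinity>i. cnj (u i) * v i)"
      by (simp add: mult.assoc)
  qed
  have inner_self: "inner u u = (\<Sum>\<^sub>\<infinity>i. (cmod (coef u i))\<^sup>2)"
  proof -
    have "(\<lambda>i. cnj (coef u i) * coef u i) summable_on UNIV"
      using coef[of u] by (intro square_summable_prod) auto
    then have "inner u u = (\<Sum>\<^sub>\<infinity>i. Re (cnj (coef u i) * coef u i))"
      unfolding inner_ell2_def cinner.rep_eq by (rule infsum_Re[symmetric])
    also have "(\<lambda>i. Re (cnj (coef u i) * coef u i)) = (\<lambda>i. (cmod (coef u i))\<^sup>2)"
      unfolding cmod_power2 by (simp add: power2_eq_square)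
    finally show ?thesis .
  qed
  show "0 \<le> inner u u" unfolding inner_self by (rule infsum_nonneg) simp
  show "inner u u = 0 \<longleftrightarrow> u = 0"
  proof
    assume "inner u u = 0"
    then have "(cmod (coef u i))\<^sup>2 = 0" for i
      using nonneg_infsum_le_0D[of "\<lambda>i. (cmod (coef u i))\<^sup>2" UNIV i] coef[of u] inner_self by simp
    then show "u = 0" by (simp add: coef_inject[symmetric] zero_ell2.rep_eq fun_eq_iff)
  next
    assume "u = 0"
    then have "coef u = (\<lambda>_. 0)" by (simp add: zero_ell2.rep_eq)
    then show "inner u u = 0" unfolding inner_self by simp
  qed
  show "norm u = sqrt (inner u u)" by (rule norm_ell2_def)
qed

end

lift_definition ket :: "'a \<Rightarrow> 'a ell2" is "\<lambda>i j. if i = j then 1 else 0"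
proof -
  fix i :: 'a
  show "(\<lambda>j. (cmod (if i = j then 1 else 0))\<^sup>2) summable_on UNIV"
    by (rule finite_nonzero_values_imp_summable_on) (rule finite_subset[of _ "{i}"], auto)
qed

lift_definition tensor_ell2 :: "'a ell2 \<Rightarrow> 'b ell2 \<Rightarrow> ('a \<times> 'b) ell2"
  is "\<lambda>f g (i, j). f i * g j"
proof -
  fix f :: "'a \<Rightarrow> complex" and g :: "'b \<Rightarrow> complex"
  assume f: "(\<lambda>i. (cmod (f i))\<^sup>2) summable_on UNIV" and g: "(\<lambda>i. (cmod (g i))\<^sup>2) summable_on UNIV"
  have "(\<lambda>(i, j). (cmod (f i))\<^sup>2 * (cmod (g j))\<^sup>2) summable_on UNIV \<times> UNIV"
  proof (rule summable_on_SigmaI)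
    show "((\<lambda>j. (\<lambda>(i, j). (cmod (f i))\<^sup>2 * (cmod (g j))\<^sup>2) (i, j))
        has_sum (cmod (f i))\<^sup>2 * (\<Sum>\<^sub>\<infinity>j. (cmod (g j))\<^sup>2)) UNIV" for i
      using g by (auto intro: has_sum_cmult_right)
    show "(\<lambda>i. (cmod (f i))\<^sup>2 * (\<Sum>\<^sub>\<infinity>j. (cmod (g j))\<^sup>2)) summable_on UNIV"
      using f by (rule summable_on_cmult_left)
  qed auto
  then show "(\<lambda>ij. (cmod (case ij of (i, j) \<Rightarrow> f i * g j))\<^sup>2) summable_on UNIV"
    by (simp add: case_prod_unfold norm_mult power_mult_distrib)
qed


section \<open>Bounded operators\<close>

text \<open>The library type \<open>'a ell2 \<Rightarrow>\<^sub>L 'b ell2\<close> consists of the bounded \<^emph>\<open>real\<close>-linear maps, with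
  the operator norm; the complex-linear ones are singled out by \<open>clinear_op\<close>.\<close>

definition clinear_op :: "('a ell2 \<Rightarrow>\<^sub>L 'b ell2) \<Rightarrow> bool"
  where "clinear_op T \<longleftrightarrow> (\<forall>c v. T (c *\<^sub>C v) = c *\<^sub>C T v)"

lemma norm_scale_ell2: "norm (c *\<^sub>C v) = cmod c * norm v"
proof -
  have "cinner (c *\<^sub>C v) (c *\<^sub>C v) = of_real ((cmod c)\<^sup>2) * cinner v v"
  proof transfer
    fix c and v :: "'a \<Rightarrow> complex"
    assume "(\<lambda>i. (cmod (v i))\<^sup>2) summable_on UNIV"
    then have *: "(\<lambda>i. cnj (v i) * v i) summable_on UNIV" by (intro square_summable_prod)
    have "(\<Sum>\<^sub>\<infinity>i. cnj (c * v i) * (c * v i)) = (\<Sum>\<^sub>\<infinity>i. of_real ((cmod c)\<^sup>2) * (cnj (v i) * v i))"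
      unfolding complex_norm_square by (simp add: ac_simps)
    then show "(\<Sum>\<^sub>\<infinity>i. cnj (c * v i) * (c * v i)) = of_real ((cmod c)\<^sup>2) * (\<Sum>\<^sub>\<infinity>i. cnj (v i) * v i)"
      using infsum_cmult_right[OF *, of "of_real ((cmod c)\<^sup>2)"] by simp
  qed
  then show ?thesis by (simp add: norm_ell2_def inner_ell2_def real_sqrt_mult)
qed

lemma bounded_linear_scale_ell2: "bounded_linear ((*\<^sub>C) c)"
proof (rule bounded_linear_intro[where K = "cmod c"])
  show "c *\<^sub>C (v + w) = c *\<^sub>C v + c *\<^sub>C w" "c *\<^sub>C (r *\<^sub>R v) = r *\<^sub>R (c *\<^sub>C v)" for v w :: "'a ell2" and r
    by (transfer, simp add: algebra_simps)+
  show "norm (c *\<^sub>C v) \<le> norm v * cmod c" for v :: "'a ell2" by (simp add: norm_scale_ell2)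
qed

definition scale_op :: "complex \<Rightarrow> ('a ell2 \<Rightarrow>\<^sub>L 'b ell2) \<Rightarrow> ('a ell2 \<Rightarrow>\<^sub>L 'b ell2)"
  where "scale_op c T = Blinfun (\<lambda>v. c *\<^sub>C T v)"

lemma scale_op_apply: "scale_op c T v = c *\<^sub>C T v"
  unfolding scale_op_def
  by (simp add: bounded_linear_Blinfun_apply bounded_linear_compose[OF bounded_linear_scale_ell2]
      blinfun.bounded_linear_right)

definition adj :: "('a ell2 \<Rightarrow>\<^sub>L 'b ell2) \<Rightarrow> ('b ell2 \<Rightarrow>\<^sub>L 'a ell2)"
  where "adj T = (THE S :: 'b ell2 \<Rightarrow>\<^sub>L 'a ell2. \<forall>v w. cinner (S v) w = cinner v (T w))"

definition op_of_basis :: "('a \<Rightarrow> 'b ell2) \<Rightarrow> ('a ell2 \<Rightarrow>\<^sub>L 'b ell2)"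
  where "op_of_basis F = (THE T :: 'a ell2 \<Rightarrow>\<^sub>L 'b ell2. clinear_op T \<and> (\<forall>i. T (ket i) = F i))"

definition tensor_op ::
  "('a ell2 \<Rightarrow>\<^sub>L 'a ell2) \<Rightarrow> ('b ell2 \<Rightarrow>\<^sub>L 'b ell2) \<Rightarrow> (('a \<times> 'b) ell2 \<Rightarrow>\<^sub>L ('a \<times> 'b) ell2)"
  where "tensor_op S T =
    (THE R :: ('a \<times> 'b) ell2 \<Rightarrow>\<^sub>L ('a \<times> 'b) ell2. clinear_op R \<and>
      (\<forall>v w. R (tensor_ell2 v w) = tensor_ell2 (S v) (T w)))"

text \<open>For a set \<open>I\<close> of indices, the Hilbert space of square-summable functions on \<open>I\<close> is the subspace
  of the vectors supported in \<open>I\<close>, and an operator on it is extended by zero to the orthogonal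
  complement. This identifies the operators on the subspace, as a C*-algebra, with a corner of those
  on the ambient space. In particular \<open>diag_op I (\<lambda>_. 1)\<close> is the unit of the operators on that
  subspace.\<close>

definition diag_op :: "'a set \<Rightarrow> ('a \<Rightarrow> complex) \<Rightarrow> ('a ell2 \<Rightarrow>\<^sub>L 'a ell2)"
  where "diag_op I g = op_of_basis (\<lambda>i. if i \<in> I then g i *\<^sub>C ket i else 0)"


section \<open>C*-algebras of operators\<close>

text \<open>Algebras are not required to contain the identity operator.\<close>

definition cstar_algebra :: "('a ell2 \<Rightarrow>\<^sub>L 'a ell2) set \<Rightarrow> bool"
  where "cstar_algebra A \<longleftrightarrow>
    (\<forall>a\<in>A. clinear_op a) \<and> 0 \<in> A \<and>
    (\<forall>a\<in>A. \<forall>b\<in>A. a + b \<in> A \<and> a o\<^sub>L b \<in> A) \<and>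
    (\<forall>a\<in>A. (\<forall>c. scale_op c a \<in> A) \<and> adj a \<in> A) \<and>
    closed A"

definition cstar_generated :: "('a ell2 \<Rightarrow>\<^sub>L 'a ell2) set \<Rightarrow> ('a ell2 \<Rightarrow>\<^sub>L 'a ell2) set"
  where "cstar_generated G = \<Inter>{A. cstar_algebra A \<and> G \<subseteq> A}"

definition star_hom ::
  "('a ell2 \<Rightarrow>\<^sub>L 'a ell2) set \<Rightarrow> ('b ell2 \<Rightarrow>\<^sub>L 'b ell2) set \<Rightarrow>
    (('a ell2 \<Rightarrow>\<^sub>L 'a ell2) \<Rightarrow> ('b ell2 \<Rightarrow>\<^sub>L 'b ell2)) \<Rightarrow> bool"
  where "star_hom A B \<phi> \<longleftrightarrow>
    (\<forall>a\<in>A. \<phi> a \<in> B) \<and>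
    (\<forall>a\<in>A. \<forall>b\<in>A. \<phi> (a + b) = \<phi> a + \<phi> b \<and> \<phi> (a o\<^sub>L b) = \<phi> a o\<^sub>L \<phi> b) \<and>
    (\<forall>a\<in>A. (\<forall>c. \<phi> (scale_op c a) = scale_op c (\<phi> a)) \<and> \<phi> (adj a) = adj (\<phi> a))"

definition short_exact ::
  "('a ell2 \<Rightarrow>\<^sub>L 'a ell2) set \<Rightarrow> (('a ell2 \<Rightarrow>\<^sub>L 'a ell2) \<Rightarrow> ('b ell2 \<Rightarrow>\<^sub>L 'b ell2)) \<Rightarrow>
    ('b ell2 \<Rightarrow>\<^sub>L 'b ell2) set \<Rightarrow> (('b ell2 \<Rightarrow>\<^sub>L 'b ell2) \<Rightarrow> ('c ell2 \<Rightarrow>\<^sub>L 'c ell2)) \<Rightarrow>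
    ('c ell2 \<Rightarrow>\<^sub>L 'c ell2) set \<Rightarrow> bool"
  where "short_exact A \<iota> B \<pi> C \<longleftrightarrow>
    cstar_algebra A \<and> cstar_algebra B \<and> cstar_algebra C \<and>
    star_hom A B \<iota> \<and> star_hom B C \<pi> \<and>
    inj_on \<iota> A \<and> \<iota> ` A = {b \<in> B. \<pi> b = 0} \<and> \<pi> ` B = C"

definition compact_ops :: "('a ell2 \<Rightarrow>\<^sub>L 'a ell2) set"
  where "compact_ops = {T. clinear_op T \<and> compact (closure (blinfun_apply T ` cball 0 1))}"

definition toeplitz_algebra :: "(nat ell2 \<Rightarrow>\<^sub>L nat ell2) set"
  where "toeplitz_algebra = cstar_generated {op_of_basis (\<lambda>n. ket (Suc n))}"

text \<open>The continuous functions on \<open>X\<close>, acting faithfully by multiplication on the square-summable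
  functions on \<open>X\<close>; for compact \<open>X\<close> this representation is isometric, see \<open>norm_diag_op\<close> below.\<close>

definition function_algebra :: "'a::topological_space set \<Rightarrow> ('a ell2 \<Rightarrow>\<^sub>L 'a ell2) set"
  where "function_algebra X = {diag_op X f | f. continuous_on X f}"

text \<open>The spatial (minimal) tensor product. The real span is a complex subspace, as
  \<open>tensor_op a b\<close> multiplied by \<open>c\<close> is \<open>tensor_op (scale_op c a) b\<close>.\<close>

definition cstar_tensor ::
  "('a ell2 \<Rightarrow>\<^sub>L 'a ell2) set \<Rightarrow> ('b ell2 \<Rightarrow>\<^sub>L 'b ell2) set \<Rightarrow> (('a \<times> 'b) ell2 \<Rightarrow>\<^sub>L ('a \<times> 'b) ell2) set"
  where "cstar_tensor A B = closure (span {tensor_op a b | a b. a \<in> A \<and> b \<in> B})"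


section \<open>The algebra of the Serre shift\<close>

text \<open>The topology on \<open>sadic_ints s\<close> is that of the product of discrete spaces, which is the one of the
  library on \<open>nat \<Rightarrow> int\<close>.\<close>

definition sadic_ints :: "int \<Rightarrow> (nat \<Rightarrow> int) set"
  where "sadic_ints s =
    {a. (\<forall>m. a m \<in> {0..<s ^ m}) \<and> (\<forall>m n. m \<le> n \<longrightarrow> a n mod s ^ m = a m)}"

definition sadic_of_int :: "int \<Rightarrow> int \<Rightarrow> (nat \<Rightarrow> int)"
  where "sadic_of_int s x = (\<lambda>m. x mod s ^ m)"

definition vertices :: "int \<Rightarrow> (nat \<times> int) set"
  where "vertices s = {(n, x). 0 \<le> x \<and> x < s ^ n}"

definition serre_mult ::
  "int \<Rightarrow> ((nat \<Rightarrow> int) \<Rightarrow> complex) \<Rightarrow> ((nat \<times> int) ell2 \<Rightarrow>\<^sub>L (nat \<times> int) ell2)"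
  where "serre_mult s f = diag_op (vertices s) (\<lambda>(n, x). f (sadic_of_int s x))"

definition serre_shift :: "int \<Rightarrow> ((nat \<times> int) ell2 \<Rightarrow>\<^sub>L (nat \<times> int) ell2)"
  where "serre_shift s = op_of_basis (\<lambda>(n, x).
    if (n, x) \<in> vertices s
    then complex_of_real (1 / sqrt (of_int s)) *\<^sub>C (\<Sum>j\<in>{0..<s}. ket (n + 1, x + j * s ^ n))
    else 0)"

definition serre_algebra :: "int \<Rightarrow> ((nat \<times> int) ell2 \<Rightarrow>\<^sub>L (nat \<times> int) ell2) set"
  where "serre_algebra s =
    cstar_generated ({serre_shift s} \<union> {serre_mult s f | f. continuous_on (sadic_ints s) f})"

section \<open>Well-definedness\<close>

text \<open>The operators introduced above by definite descriptions exist and have the stated values.\<close>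

lemma coef_simps [simp]:
  "coef 0 i = 0" "coef (v + w) i = coef v i + coef w i" "coef (v - w) i = coef v i - coef w i"
  "coef (c *\<^sub>C v) i = c * coef v i" "coef (r *\<^sub>R v) i = of_real r * coef v i"
  "coef (ket j) i = (if j = i then 1 else 0)"
  by (transfer, simp)+

lemma coef_tensor_ell2 [simp]: "coef (tensor_ell2 v w) (i, j) = coef v i * coef w j"
  by transfer simp

lemma coef_sum [simp]: "coef (\<Sum>k\<in>K. f k) i = (\<Sum>k\<in>K. coef (f k) i)"
  by (induction K rule: infinite_finite_induct) auto

lemma ell2_eqI: "(\<And>i. coef v i = coef w i) \<Longrightarrow> v = w"
  by (simp add: coef_inject[symmetric] fun_eq_iff)

lemma scale_ell2_simps [simp]:
  "c *\<^sub>C 0 = 0" "0 *\<^sub>C v = 0" "1 *\<^sub>C v = v" "c *\<^sub>C d *\<^sub>C v = (c * d) *\<^sub>C v"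
  by (auto intro: ell2_eqI)

lemma scale_ell2_distrib:
  "c *\<^sub>C (v + w) = c *\<^sub>C v + c *\<^sub>C w" "(c + d) *\<^sub>C v = c *\<^sub>C v + d *\<^sub>C v"
  by (auto intro!: ell2_eqI simp: algebra_simps)

lemma scale_ell2_sum: "c *\<^sub>C (\<Sum>k\<in>K. f k) = (\<Sum>k\<in>K. c *\<^sub>C f k)"
  by (induction K rule: infinite_finite_induct) (auto simp: scale_ell2_distrib)

lemma square_summable_coef: "(\<lambda>i. (cmod (coef v i))\<^sup>2) summable_on A"
  using coef[of v] by (auto intro: summable_on_subset_banach)

lemma cinner_summable: "(\<lambda>i. cnj (coef v i) * coef w i) summable_on UNIV"
  by (intro square_summable_prod square_summable_coef)

lemma cinner_self: "cinner v v = of_real ((norm v)\<^sup>2)"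
proof -
  have "Im (cinner v v) = 0"
    unfolding cinner.rep_eq using infsum_Im[OF cinner_summable[of v v]] by (simp add: mult.commute)
  moreover have "Re (cinner v v) = (norm v)\<^sup>2"
    by (metis inner_ell2_def power2_norm_eq_inner)
  ultimately show ?thesis by (simp add: complex_eq_iff)
qed

lemma norm_ell2_sq: "(norm v)\<^sup>2 = (\<Sum>\<^sub>\<infinity>i. (cmod (coef v i))\<^sup>2)"
proof -
  have "(norm v)\<^sup>2 = (\<Sum>\<^sub>\<infinity>i. Re (cnj (coef v i) * coef v i))"
    unfolding infsum_Re[OF cinner_summable] cinner.rep_eq[symmetric] cinner_self by simp
  also have "(\<lambda>i. Re (cnj (coef v i) * coef v i)) = (\<lambda>i. (cmod (coef v i))\<^sup>2)"
    unfolding cmod_power2 by (simp add: power2_eq_square)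
  finally show ?thesis .
qed

lemma cinner_ket [simp]: "cinner (ket i) v = coef v i"
proof -
  have "(\<Sum>\<^sub>\<infinity>j. cnj (coef (ket i) j) * coef v j) = (\<Sum>\<^sub>\<infinity>j\<in>{i}. coef v j)"
    by (rule infsum_cong_neutral) auto
  then show ?thesis by (simp add: cinner.rep_eq)
qed

lemma cinner_commute: "cinner v w = cnj (cinner w v)"
  unfolding cinner.rep_eq by (subst infsum_cnj[symmetric]) (simp add: mult.commute)

lemma cinner_ket_right: "cinner v (ket i) = cnj (coef v i)"
  by (subst cinner_commute) simp

lemma cinner_add_right: "cinner u (v + w) = cinner u v + cinner u w"
  unfolding cinner.rep_eq by (simp add: distrib_left infsum_add cinner_summable)

lemma cinner_scale_right: "cinner u (c *\<^sub>C v) = c * cinner u v"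
  unfolding cinner.rep_eq using infsum_cmult_right[OF cinner_summable[of u v], of c]
  by (simp add: mult.left_commute)

lemma cmod_cinner_le: "cmod (cinner v w) \<le> norm v * norm w"
proof (cases "cinner v w = 0")
  case False
  define c where "c = cnj (cinner v w) / cmod (cinner v w)"
  have c: "cmod c = 1" using False by (simp add: c_def norm_divide)
  have "cinner v (c *\<^sub>C w) = of_real (cmod (cinner v w))"
    using False unfolding cinner_scale_right c_def
    by (simp add: field_simps complex_norm_square[symmetric] power2_eq_square flip: of_real_mult)
  then have "cmod (cinner v w) = inner v (c *\<^sub>C w)" by (simp add: inner_ell2_def)
  also have "\<dots> \<le> norm v * norm (c *\<^sub>C w)" by (rule norm_cauchy_schwarz)
  finally show ?thesis by (simp add: norm_scale_ell2 c)
qed simp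

lemma bounded_linear_cinner_right: "bounded_linear (cinner u)"
proof (rule bounded_linear_intro[where K = "norm u"])
  show "cinner u (v + w) = cinner u v + cinner u w" for v w by (rule cinner_add_right)
  have "r *\<^sub>R v = of_real r *\<^sub>C v" for r and v :: "'a ell2" by (auto intro: ell2_eqI)
  then show "cinner u (r *\<^sub>R v) = r *\<^sub>R cinner u v" for r v
    by (simp add: cinner_scale_right scaleR_conv_of_real)
  show "norm (cinner u v) \<le> norm v * norm u" for v
    using cmod_cinner_le[of u v] by (simp add: mult.commute)
qed

lemma has_sum_ket: "((\<lambda>i. coef v i *\<^sub>C ket i) has_sum v) UNIV"
proof -
  have *: "(norm (v - (\<Sum>i\<in>I. coef v i *\<^sub>C ket i)))\<^sup>2
      = (norm v)\<^sup>2 - (\<Sum>i\<in>I. (cmod (coef v i))\<^sup>2)" if I: "finite I" for I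
  proof -
    have "(norm (v - (\<Sum>i\<in>I. coef v i *\<^sub>C ket i)))\<^sup>2
        = (\<Sum>\<^sub>\<infinity>i\<in>- I. (cmod (coef v i))\<^sup>2)"
      unfolding norm_ell2_sq by (rule infsum_cong_neutral) (use I in \<open>auto simp: if_distrib cong: if_cong\<close>)
    moreover have "(\<Sum>\<^sub>\<infinity>i\<in>I \<union> - I. (cmod (coef v i))\<^sup>2)
        = (\<Sum>i\<in>I. (cmod (coef v i))\<^sup>2) + (\<Sum>\<^sub>\<infinity>i\<in>- I. (cmod (coef v i))\<^sup>2)"
      by (subst infsum_Un_disjoint) (use I in \<open>auto intro: square_summable_coef\<close>)
    ultimately show ?thesis by (simp add: norm_ell2_sq)
  qed
  have "((\<lambda>i. (cmod (coef v i))\<^sup>2) has_sum (norm v)\<^sup>2) UNIV"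
    unfolding norm_ell2_sq by (simp add: square_summable_coef)
  then have "((\<lambda>I. (norm v)\<^sup>2 - (\<Sum>i\<in>I. (cmod (coef v i))\<^sup>2)) \<longlongrightarrow> (norm v)\<^sup>2 - (norm v)\<^sup>2)
      (finite_subsets_at_top UNIV)"
    unfolding has_sum_def by (intro tendsto_diff tendsto_const)
  then have "((\<lambda>I. (norm (v - (\<Sum>i\<in>I. coef v i *\<^sub>C ket i)))\<^sup>2) \<longlongrightarrow> 0)
      (finite_subsets_at_top UNIV)"
    by (subst tendsto_cong[where g = "\<lambda>I. (norm v)\<^sup>2 - (\<Sum>i\<in>I. (cmod (coef v i))\<^sup>2)"])
      (auto intro!: eventually_finite_subsets_at_top_weakI simp: *)
  then have "((\<lambda>I. sqrt ((norm (v - (\<Sum>i\<in>I. coef v i *\<^sub>C ket i)))\<^sup>2)) \<longlongrightarrow> sqrt 0)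
      (finite_subsets_at_top UNIV)"
    by (rule tendsto_real_sqrt)
  then have "((\<lambda>I. norm ((\<Sum>i\<in>I. coef v i *\<^sub>C ket i) - v)) \<longlongrightarrow> 0)
      (finite_subsets_at_top UNIV)"
    by (simp add: norm_minus_commute)
  then show ?thesis
    unfolding has_sum_def by (simp add: tendsto_norm_zero_iff LIM_zero_iff)
qed

lemma bounded_linear_ell2_eqI:
  assumes "bounded_linear f" "bounded_linear g" "\<And>c i. f (c *\<^sub>C ket i) = g (c *\<^sub>C ket i)"
  shows "f v = g v"
proof (rule has_sum_unique)
  show "((\<lambda>i. f (coef v i *\<^sub>C ket i)) has_sum f v) UNIV"
    using has_sum_bounded_linear[OF assms(1) has_sum_ket[of v]] by (simp add: o_def)
  show "((\<lambda>i. f (coef v i *\<^sub>C ket i)) has_sum g v) UNIV"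
    using has_sum_bounded_linear[OF assms(2) has_sum_ket[of v]] by (simp add: o_def assms(3))
qed

lemma clinear_op_eqI:
  assumes "clinear_op S" "clinear_op T" "\<And>i. S (ket i) = T (ket i)"
  shows "S = T"
proof (rule blinfun_eqI)
  fix v
  have "((\<lambda>i. R (coef v i *\<^sub>C ket i)) has_sum R v) UNIV" for R :: "'a ell2 \<Rightarrow>\<^sub>L 'b ell2"
    using has_sum_bounded_linear[OF blinfun.bounded_linear_right has_sum_ket[of v], of R] by (simp add: o_def)
  from this[of S] this[of T] show "S v = T v"
    using assms by (auto simp: clinear_op_def intro: has_sum_unique)
qed

lemma sum_coef_le_norm: "finite I \<Longrightarrow> sqrt (\<Sum>i\<in>I. (cmod (coef v i))\<^sup>2) \<le> norm v"
  using finite_sum_le_infsum[OF square_summable_coef[of v UNIV], of I]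
  by (simp add: norm_ell2_sq[symmetric] real_le_lsqrt)

lemma ell2_boundedI:
  assumes "\<And>I. finite I \<Longrightarrow> (\<Sum>i\<in>I. (cmod (f i))\<^sup>2) \<le> B\<^sup>2" and "0 \<le> B"
  shows "coef (Abs_ell2 f) = f \<and> norm (Abs_ell2 f) \<le> B"
proof -
  have *: "(\<lambda>i. (cmod (f i))\<^sup>2) summable_on UNIV"
    by (rule nonneg_bounded_partial_sums_imp_summable_on[where C = "B\<^sup>2"])
      (auto intro!: eventually_finite_subsets_at_top_weakI assms)
  then have "coef (Abs_ell2 f) = f" by (simp add: Abs_ell2_inverse)
  moreover from this have "(norm (Abs_ell2 f))\<^sup>2 \<le> B\<^sup>2"
    unfolding norm_ell2_sq using * assms by (auto intro: infsum_le_finite_sums)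
  ultimately show ?thesis using assms(2) power2_le_imp_le by blast
qed

lemma op_of_basis_unique:
  assumes "clinear_op T" "\<And>i. T (ket i) = F i"
  shows "op_of_basis F = T"
  unfolding op_of_basis_def using assms by (auto intro!: the_equality clinear_op_eqI)

lemma op_of_basis:
  assumes bound: "\<And>I c. finite I \<Longrightarrow>
      norm (\<Sum>i\<in>I. c i *\<^sub>C F i) \<le> B * sqrt (\<Sum>i\<in>I. (cmod (c i))\<^sup>2)"
    and B: "0 \<le> B"
  shows "clinear_op (op_of_basis F)" "op_of_basis F (ket i) = F i" "norm (op_of_basis F) \<le> B"
proof -
  have bound': "norm (\<Sum>i\<in>I. c i *\<^sub>C F i) \<le> B * norm v"
    if "finite I" "\<And>i. cmod (c i) = cmod (coef v i)" for I c v
    using bound[OF that(1), of c] sum_coef_le_norm[OF that(1), of v] B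
    by (simp add: that(2)) (meson mult_left_mono order_trans)
  have summ: "(\<lambda>i. coef v i * coef (F i) k) summable_on UNIV" for v k
  proof (rule abs_summable_summable, rule nonneg_bounded_partial_sums_imp_summable_on[where C = "B * norm v"])
    have "(\<Sum>i\<in>I. norm (coef v i * coef (F i) k)) \<le> B * norm v" if I: "finite I" for I
    proof -
      define c where "c i = of_real (cmod (coef v i)) *
        (if coef (F i) k = 0 then 1 else cnj (sgn (coef (F i) k)))" for i
      have "coef (\<Sum>i\<in>I. c i *\<^sub>C F i) k = of_real (\<Sum>i\<in>I. norm (coef v i * coef (F i) k))"
        unfolding coef_sum of_real_sum
      proof (rule sum.cong[OF refl])
        fix i
        have "cnj (sgn z) * z = of_real (cmod z)" if "z \<noteq> 0" for z
          using that complex_norm_square[of z]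
          by (simp add: sgn_div_norm scaleR_conv_of_real field_simps power2_eq_square)
        then show "coef (c i *\<^sub>C F i) k = of_real (norm (coef v i * coef (F i) k))"
          by (simp add: c_def norm_mult mult.assoc)
      qed
      then have "(\<Sum>i\<in>I. norm (coef v i * coef (F i) k)) = cmod (coef (\<Sum>i\<in>I. c i *\<^sub>C F i) k)"
        by (simp add: sum_nonneg del: coef_sum of_real_sum)
      also have "\<dots> \<le> norm (\<Sum>i\<in>I. c i *\<^sub>C F i)"
        using sum_coef_le_norm[of "{k}" "\<Sum>i\<in>I. c i *\<^sub>C F i"] by (simp del: coef_sum)
      also have "\<dots> \<le> B * norm v"
        by (rule bound'[OF I]) (simp add: c_def norm_mult norm_sgn)
      finally show ?thesis .
    qed
    then show "\<forall>\<^sub>F I in finite_subsets_at_top UNIV. (\<Sum>i\<in>I. norm (coef v i * coef (F i) k)) \<le> B * norm v"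
      by (auto intro: eventually_finite_subsets_at_top_weakI)
  qed simp
  define G where "G v k = (\<Sum>\<^sub>\<infinity>i. coef v i * coef (F i) k)" for v k
  have G: "coef (Abs_ell2 (G v)) = G v \<and> norm (Abs_ell2 (G v)) \<le> B * norm v" for v
  proof (rule ell2_boundedI)
    fix K :: "'b set" assume K: "finite K"
    have "((\<lambda>I. \<Sum>k\<in>K. (cmod (\<Sum>i\<in>I. coef v i * coef (F i) k))\<^sup>2) \<longlongrightarrow> (\<Sum>k\<in>K. (cmod (G v k))\<^sup>2))
        (finite_subsets_at_top UNIV)"
      unfolding G_def by (intro tendsto_intros infsum_tendsto summ)
    then show "(\<Sum>k\<in>K. (cmod (G v k))\<^sup>2) \<le> (B * norm v)\<^sup>2"
    proof (rule tendsto_upperbound)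
      have "(\<Sum>k\<in>K. (cmod (\<Sum>i\<in>I. coef v i * coef (F i) k))\<^sup>2) \<le> (B * norm v)\<^sup>2" if "finite I" for I
      proof -
        have "sqrt (\<Sum>k\<in>K. (cmod (\<Sum>i\<in>I. coef v i * coef (F i) k))\<^sup>2) \<le> B * norm v"
          using order_trans[OF sum_coef_le_norm[OF K, of "\<Sum>i\<in>I. coef v i *\<^sub>C F i"] bound'[OF that, of "coef v" v]]
          by simp
        then show ?thesis by (simp add: sqrt_le_D)
      qed
      then show "\<forall>\<^sub>F I in finite_subsets_at_top UNIV.
          (\<Sum>k\<in>K. (cmod (\<Sum>i\<in>I. coef v i * coef (F i) k))\<^sup>2) \<le> (B * norm v)\<^sup>2"
        by (auto intro: eventually_finite_subsets_at_top_weakI)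
    qed simp
  qed (use B in simp)
  define T where "T = Blinfun (\<lambda>v. Abs_ell2 (G v))"
  have "bounded_linear (\<lambda>v. Abs_ell2 (G v))"
  proof (rule bounded_linear_intro[where K = B])
    show "Abs_ell2 (G (v + w)) = Abs_ell2 (G v) + Abs_ell2 (G w)" for v w
      by (rule ell2_eqI) (simp add: G, simp add: G_def distrib_right infsum_add summ)
    show "Abs_ell2 (G (r *\<^sub>R v)) = r *\<^sub>R Abs_ell2 (G v)" for r v
      using infsum_cmult_right[OF summ[of v], of "of_real r"]
      by (intro ell2_eqI) (simp add: G, simp add: G_def mult.assoc)
    show "norm (Abs_ell2 (G v)) \<le> norm v * B" for v using G[of v] by (simp add: mult.commute)
  qed
  then have T: "T v = Abs_ell2 (G v)" for v by (simp add: T_def bounded_linear_Blinfun_apply)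
  have "clinear_op T"
    unfolding clinear_op_def
  proof (intro allI)
    fix c v
    show "T (c *\<^sub>C v) = c *\<^sub>C T v"
      using infsum_cmult_right[OF summ[of v], of c]
      by (intro ell2_eqI) (simp add: T G, simp add: G_def mult.assoc)
  qed
  moreover have Tket: "T (ket i) = F i" for i
  proof (rule ell2_eqI)
    fix k
    have "(\<Sum>\<^sub>\<infinity>j. coef (ket i) j * coef (F j) k) = (\<Sum>\<^sub>\<infinity>j\<in>{i}. coef (F j) k)"
      by (rule infsum_cong_neutral) auto
    then show "coef (T (ket i)) k = coef (F i) k" unfolding T using G[of "ket i"] by (simp add: G_def)
  qed
  moreover have "norm T \<le> B" using G B by (intro norm_blinfun_bound) (auto simp: T)
  ultimately show "clinear_op (op_of_basis F)" "op_of_basis F (ket i) = F i" "norm (op_of_basis F) \<le> B"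
    using op_of_basis_unique[of T F] by auto
qed

lemma op_of_basis_orthogonal:
  assumes orth: "\<And>i j. i \<noteq> j \<Longrightarrow> cinner (F i) (F j) = 0"
    and bound: "\<And>i. norm (F i) \<le> B" and B: "0 \<le> B"
  shows "clinear_op (op_of_basis F)" "op_of_basis F (ket i) = F i" "norm (op_of_basis F) \<le> B"
proof -
  have "norm (\<Sum>i\<in>I. c i *\<^sub>C F i) \<le> B * sqrt (\<Sum>i\<in>I. (cmod (c i))\<^sup>2)" if "finite I" for I c
  proof -
    have "cinner (c *\<^sub>C v) (d *\<^sub>C w) = cnj c * d * cinner v w" for c d and v w :: "'b ell2"
      using cinner_commute[of "c *\<^sub>C v" w] cinner_commute[of v w] by (simp add: cinner_scale_right)
    then have "(norm (\<Sum>i\<in>I. c i *\<^sub>C F i))\<^sup>2 = (\<Sum>i\<in>I. (norm (c i *\<^sub>C F i))\<^sup>2)"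
      using that by (intro norm_sum_Pythagorean)
        (auto simp: pairwise_def orthogonal_def inner_ell2_def orth)
    also have "\<dots> \<le> (\<Sum>i\<in>I. B\<^sup>2 * (cmod (c i))\<^sup>2)"
      unfolding norm_scale_ell2 power_mult_distrib mult.commute[of "B\<^sup>2"]
      using bound by (intro sum_mono mult_left_mono power_mono) auto
    finally have "norm (\<Sum>i\<in>I. c i *\<^sub>C F i) \<le> sqrt (B\<^sup>2 * (\<Sum>i\<in>I. (cmod (c i))\<^sup>2))"
      by (simp add: sum_distrib_left real_le_rsqrt)
    then show ?thesis using B by (simp add: real_sqrt_mult)
  qed
  then show "clinear_op (op_of_basis F)" "op_of_basis F (ket i) = F i" "norm (op_of_basis F) \<le> B"
    using op_of_basis[of F B] B by auto
qed

lemma norm_ket [simp]: "norm (ket i) = 1"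
proof -
  have "of_real ((norm (ket i))\<^sup>2) = (1 :: complex)" unfolding cinner_self[symmetric] by simp
  then have "(norm (ket i))\<^sup>2 = 1" using of_real_eq_1_iff by blast
  then show ?thesis by (simp add: power2_eq_1_iff) (use norm_ge_zero[of "ket i"] in linarith)
qed

lemma toeplitz_shift:
  "clinear_op (op_of_basis (\<lambda>n. ket (Suc n)))" "op_of_basis (\<lambda>n. ket (Suc n)) (ket n) = ket (Suc n)"
  by (rule op_of_basis_orthogonal[where B = 1]; simp)+

lemma diag_op:
  assumes "\<And>i. i \<in> I \<Longrightarrow> cmod (g i) \<le> B" "0 \<le> B"
  shows "clinear_op (diag_op I g)" "diag_op I g (ket i) = (if i \<in> I then g i *\<^sub>C ket i else 0)"
    "norm (diag_op I g) \<le> B"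
proof -
  let ?F = "\<lambda>i. if i \<in> I then g i *\<^sub>C ket i else 0"
  have "cnj (coef (?F i) k) * coef (?F j) k = 0" if "i \<noteq> j" for i j k
    using that by auto
  then have "cinner (?F i) (?F j) = 0" if "i \<noteq> j" for i j
    unfolding cinner.rep_eq using that by (metis (no_types, lifting) infsum_0)
  moreover have "norm (?F i) \<le> B" for i
    using assms by (simp add: norm_scale_ell2)
  ultimately show "clinear_op (diag_op I g)" "norm (diag_op I g) \<le> B"
    "diag_op I g (ket i) = (if i \<in> I then g i *\<^sub>C ket i else 0)"
    unfolding diag_op_def using op_of_basis_orthogonal[of ?F B] assms(2) by blast+
qed

lemma norm_diag_op:
  assumes "bdd_above ((\<lambda>i. cmod (g i)) ` I)" "I \<noteq> {}"
  shows "norm (diag_op I g) = (SUP i\<in>I. cmod (g i))"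
proof (rule antisym)
  let ?S = "SUP i\<in>I. cmod (g i)"
  have le: "cmod (g i) \<le> ?S" if "i \<in> I" for i using assms that by (intro cSUP_upper)
  then have S: "0 \<le> ?S" using assms(2) norm_ge_zero order_trans by (metis ex_in_conv)
  show "norm (diag_op I g) \<le> ?S" using diag_op(3)[of I g "?S", OF le S] by simp
  show "?S \<le> norm (diag_op I g)"
  proof (rule cSUP_least[OF assms(2)])
    fix i assume "i \<in> I"
    then show "cmod (g i) \<le> norm (diag_op I g)"
      using norm_blinfun[of "diag_op I g" "ket i"] diag_op(2)[of I g "?S" i, OF le S] by (simp add: norm_scale_ell2)
  qed
qed

lemma serre_shift:
  assumes "s \<ge> 2"
  shows "clinear_op (serre_shift s)"
    "(n, x) \<in> vertices s \<Longrightarrow> serre_shift s (ket (n, x)) =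
      complex_of_real (1 / sqrt (of_int s)) *\<^sub>C (\<Sum>j\<in>{0..<s}. ket (n + 1, x + j * s ^ n))"
    "(n, x) \<notin> vertices s \<Longrightarrow> serre_shift s (ket (n, x)) = 0"
proof -
  define F where "F = (\<lambda>(n, x). if (n, x) \<in> vertices s
    then complex_of_real (1 / sqrt (of_int s)) *\<^sub>C (\<Sum>j\<in>{0..<s}. ket (n + 1, x + j * s ^ n)) else 0)"
  have pos: "0 < s ^ n" for n using assms by simp
  have dig: "x + j * s ^ n \<noteq> y"
    if "(n, x) \<in> vertices s" "x \<noteq> y mod s ^ n" for n x y j
    using that by (auto simp: vertices_def)
  have coefF: "coef (F (n, x)) (m, y) = 0" if "m \<noteq> n + 1 \<or> x \<noteq> y mod s ^ n" for n x m y
    using that dig[of n x y] by (auto simp: F_def intro!: sum.neutral)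
  have "cinner (F p) (F q) = 0" if "p \<noteq> q" for p q
  proof -
    have "coef (F p) r = 0 \<or> coef (F q) r = 0" for r
    proof (cases p; cases q; cases r)
      fix n x n' x' m y
      assume pq: "p = (n, x)" "q = (n', x')" "r = (m, y)"
      show ?thesis
      proof (cases "m = n + 1 \<and> x = y mod s ^ n")
        case True
        with that have "m \<noteq> n' + 1 \<or> x' \<noteq> y mod s ^ n'" unfolding pq by auto
        then show ?thesis unfolding pq using coefF by blast
      qed (use coefF in \<open>simp add: pq\<close>)
    qed
    then have "(\<lambda>r. cnj (coef (F p) r) * coef (F q) r) = (\<lambda>_. 0)"
      by (metis complex_cnj_zero mult_eq_0_iff)
    then show ?thesis unfolding cinner.rep_eq by (simp only: infsum_0_simp)
  qed
  moreover have "norm (F p) \<le> norm (complex_of_real (1 / sqrt (of_int s))) * of_int s" for p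
  proof (cases p)
    case (Pair n x)
    have "norm (\<Sum>j\<in>{0..<s}. ket (n + 1, x + j * s ^ n)) \<le> (\<Sum>j\<in>{0..<s}. 1)"
      by (rule sum_norm_le) simp
    then have "norm (\<Sum>j\<in>{0..<s}. ket (n + 1, x + j * s ^ n)) \<le> of_int s" using assms by simp
    then show ?thesis using assms
      unfolding Pair F_def by (auto simp: norm_scale_ell2 intro!: mult_left_mono divide_right_mono simp del: norm_of_real)
  qed
  ultimately have *: "clinear_op (op_of_basis F) \<and> op_of_basis F (ket p) = F p" for p
    using op_of_basis_orthogonal[of F "norm (complex_of_real (1 / sqrt (of_int s))) * of_int s"] assms
    by auto
  have "serre_shift s = op_of_basis F" unfolding serre_shift_def F_def ..
  with *[of "(n, x)"] show "clinear_op (serre_shift s)"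
    "(n, x) \<in> vertices s \<Longrightarrow> serre_shift s (ket (n, x)) =
      complex_of_real (1 / sqrt (of_int s)) *\<^sub>C (\<Sum>j\<in>{0..<s}. ket (n + 1, x + j * s ^ n))"
    "(n, x) \<notin> vertices s \<Longrightarrow> serre_shift s (ket (n, x)) = 0"
    by (auto simp: F_def)
qed

lemma sadic_of_int_in: "s \<ge> 2 \<Longrightarrow> sadic_of_int s x \<in> sadic_ints s"
  by (auto simp: sadic_of_int_def sadic_ints_def mod_mod_cancel le_imp_power_dvd)

lemma compact_sadic_ints: "compact (sadic_ints s)"
proof -
  have "compactin (product_topology (\<lambda>_. euclidean) UNIV) (PiE UNIV (\<lambda>m. {0..<s ^ m}))"
    by (subst compactin_PiE) (auto intro: finite_imp_compact)
  then have "compact (PiE UNIV (\<lambda>m. {0..<s ^ m}) :: (nat \<Rightarrow> int) set)"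
    by (simp add: euclidean_product_topology)
  moreover have "closed {a :: nat \<Rightarrow> int. a n mod s ^ m = a m}" for m n
  proof -
    have "open {a :: nat \<Rightarrow> int. a n = k}" for n k
      using open_vimage[OF open_discrete[of "{k}"] continuous_on_product_coordinates[of n]]
      by (simp add: vimage_def)
    then have *: "open {a :: nat \<Rightarrow> int. a n = k \<and> a m = l}" for n k m l
      by (simp add: open_Collect_conj)
    have "open (\<Union>(k, l)\<in>{(k, l). k mod s ^ m \<noteq> l}. {a :: nat \<Rightarrow> int. a n = k \<and> a m = l})"
      using * by (intro open_UN) auto
    moreover have "(\<Union>(k, l)\<in>{(k, l). k mod s ^ m \<noteq> l}. {a :: nat \<Rightarrow> int. a n = k \<and> a m = l})
        = - {a. a n mod s ^ m = a m}" by auto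
    ultimately show ?thesis by (simp add: closed_def)
  qed
  then have "closed (\<Inter>m. \<Inter>n\<in>{m..}. {a :: nat \<Rightarrow> int. a n mod s ^ m = a m})" by blast
  ultimately have "compact ((PiE UNIV (\<lambda>m. {0..<s ^ m})) \<inter>
      (\<Inter>m. \<Inter>n\<in>{m..}. {a :: nat \<Rightarrow> int. a n mod s ^ m = a m}))" by (rule compact_Int_closed)
  also have "\<dots> = sadic_ints s" by (auto simp: sadic_ints_def PiE_def Pi_def)
  finally show ?thesis .
qed

lemma serre_mult:
  assumes "s \<ge> 2" "continuous_on (sadic_ints s) f"
  shows "clinear_op (serre_mult s f)"
    "(n, x) \<in> vertices s \<Longrightarrow> serre_mult s f (ket (n, x)) = f (sadic_of_int s x) *\<^sub>C ket (n, x)"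
    "(n, x) \<notin> vertices s \<Longrightarrow> serre_mult s f (ket (n, x)) = 0"
proof -
  have "bounded (f ` sadic_ints s)"
    by (intro compact_imp_bounded compact_continuous_image assms compact_sadic_ints)
  then obtain B where B: "B > 0" "\<And>a. a \<in> sadic_ints s \<Longrightarrow> cmod (f a) \<le> B"
    by (auto simp: bounded_pos)
  have *: "cmod (case i of (n, x) \<Rightarrow> f (sadic_of_int s x)) \<le> B" for i
    using B(2)[OF sadic_of_int_in[OF assms(1)]] by (cases i) auto
  show "clinear_op (serre_mult s f)"
    "(n, x) \<in> vertices s \<Longrightarrow> serre_mult s f (ket (n, x)) = f (sadic_of_int s x) *\<^sub>C ket (n, x)"
    "(n, x) \<notin> vertices s \<Longrightarrow> serre_mult s f (ket (n, x)) = 0"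
    unfolding serre_mult_def
    using diag_op[of "vertices s" "\<lambda>(n, x). f (sadic_of_int s x)" B, OF *] B(1) by auto
qed

lemma cinner_adj:
  assumes T: "clinear_op T"
  shows "cinner (adj T v) w = cinner v (T w)"
proof -
  define F where "F v i = cinner (T (ket i)) v" for v i
  have F: "coef (Abs_ell2 (F v)) = F v \<and> norm (Abs_ell2 (F v)) \<le> norm T * norm v" for v
  proof (rule ell2_boundedI)
    fix I :: "'a set" assume I: "finite I"
    define w where "w = (\<Sum>i\<in>I. F v i *\<^sub>C ket i)"
    let ?q = "\<Sum>i\<in>I. (cmod (F v i))\<^sup>2"
    have "cinner v (T w) = (\<Sum>i\<in>I. F v i * cinner v (T (ket i)))"
      unfolding w_def blinfun.sum_right
      using T by (simp add: clinear_op_def linear_sum[OF bounded_linear.linear[OF bounded_linear_cinner_right]]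
          cinner_scale_right)
    also have "\<dots> = of_real ?q"
      unfolding of_real_sum by (intro sum.cong refl) (simp add: F_def complex_norm_square cinner_commute[of v] del: of_real_power)
    finally have "?q \<le> norm v * norm (T w)"
      using cmod_cinner_le[of v "T w"] by (simp add: sum_nonneg del: of_real_sum)
    also have "\<dots> \<le> norm v * (norm T * norm w)" by (intro mult_left_mono norm_blinfun) simp
    finally have le: "?q \<le> norm T * norm v * norm w" by (simp add: ac_simps)
    have "(norm w)\<^sup>2 = (\<Sum>\<^sub>\<infinity>i\<in>I. (cmod (F v i))\<^sup>2)"
      unfolding norm_ell2_sq w_def by (rule infsum_cong_neutral) (use I in \<open>auto simp: if_distrib cong: if_cong\<close>)
    then have w: "?q = (norm w)\<^sup>2" using I by simp
    with le have "norm w * norm w \<le> norm T * norm v * norm w" by (simp add: power2_eq_square)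
    then have "norm w \<le> norm T * norm v"
      by (cases "norm w = 0") (auto simp: mult_le_cancel_right)
    then show "?q \<le> (norm T * norm v)\<^sup>2" unfolding w by (simp add: power_mono)
  qed simp
  define S where "S = Blinfun (\<lambda>v. Abs_ell2 (F v))"
  have "bounded_linear (\<lambda>v. Abs_ell2 (F v))"
  proof (rule bounded_linear_intro[where K = "norm T"])
    show "Abs_ell2 (F (v + w)) = Abs_ell2 (F v) + Abs_ell2 (F w)" for v w
      by (rule ell2_eqI) (simp add: F, simp add: F_def cinner_add_right)
    show "Abs_ell2 (F (r *\<^sub>R v)) = r *\<^sub>R Abs_ell2 (F v)" for r v
      using linear_cmul[OF bounded_linear.linear[OF bounded_linear_cinner_right]]
      by (intro ell2_eqI) (simp add: F, simp add: F_def scaleR_conv_of_real)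
    show "norm (Abs_ell2 (F v)) \<le> norm v * norm T" for v using F[of v] by (simp add: mult.commute)
  qed
  then have S: "S v = Abs_ell2 (F v)" for v by (simp add: S_def bounded_linear_Blinfun_apply)
  have S_adj: "cinner (S v) w = cinner v (T w)" for v w
  proof (rule bounded_linear_ell2_eqI[of "cinner (S v)"])
    show "bounded_linear (cinner (S v))" by (rule bounded_linear_cinner_right)
    show "bounded_linear (\<lambda>w. cinner v (T w))"
      by (rule bounded_linear_compose[OF bounded_linear_cinner_right blinfun.bounded_linear_right])
    fix c i
    have "cinner (S v) (ket i) = cnj (cinner (T (ket i)) v)"
      using F[of v] by (simp add: cinner_ket_right S F_def)
    also have "\<dots> = cinner v (T (ket i))" by (rule cinner_commute[symmetric])
    finally show "cinner (S v) (c *\<^sub>C ket i) = cinner v (T (c *\<^sub>C ket i))"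
      using T by (simp add: clinear_op_def cinner_scale_right)
  qed
  have "adj T = S"
    unfolding adj_def
  proof (rule the_equality)
    fix R :: "'b ell2 \<Rightarrow>\<^sub>L 'a ell2"
    assume "\<forall>v w. cinner (R v) w = cinner v (T w)"
    then have "cinner (R v) (ket i) = cinner (S v) (ket i)" for v i by (simp add: S_adj)
    then have "coef (R v) i = coef (S v) i" for v i
      by (simp add: cinner_ket_right)
    then show "R = S" by (auto intro: blinfun_eqI ell2_eqI)
  qed (simp add: S_adj)
  then show ?thesis by (simp add: S_adj)
qed

lemma cinner_tensor_ell2: "cinner (tensor_ell2 u v) (tensor_ell2 u' v') = cinner u u' * cinner v v'"
proof -
  let ?f = "\<lambda>i j. (cnj (coef u i) * coef u' i) * (cnj (coef v j) * coef v' j)"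
  have eq: "(\<lambda>p. cnj (coef (tensor_ell2 u v) p) * coef (tensor_ell2 u' v') p) = (\<lambda>(i, j). ?f i j)"
    by (auto simp: fun_eq_iff)
  have "(\<Sum>\<^sub>\<infinity>i. \<Sum>\<^sub>\<infinity>j. ?f i j) = (\<Sum>\<^sub>\<infinity>(i, j)\<in>UNIV \<times> UNIV. ?f i j)"
    by (rule infsum_Sigma'_banach)
      (use cinner_summable[of "tensor_ell2 u v" "tensor_ell2 u' v'"] in \<open>simp add: eq\<close>)
  also have "(\<Sum>\<^sub>\<infinity>i. \<Sum>\<^sub>\<infinity>j. ?f i j) = cinner u u' * cinner v v'"
    unfolding cinner.rep_eq by (simp add: infsum_cmult_right cinner_summable infsum_cmult_left)
  finally show ?thesis unfolding cinner.rep_eq[of "tensor_ell2 u v"] eq by simp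
qed

lemma norm_tensor_ell2: "norm (tensor_ell2 v w) = norm v * norm w"
proof -
  have "of_real ((norm (tensor_ell2 v w))\<^sup>2) = (of_real ((norm v * norm w)\<^sup>2) :: complex)"
    unfolding cinner_self[symmetric] cinner_tensor_ell2 by (simp add: cinner_self power_mult_distrib)
  then show ?thesis by (simp only: of_real_eq_iff) (simp add: power2_eq_iff_nonneg)
qed

lemma bounded_bilinear_tensor_ell2: "bounded_bilinear tensor_ell2"
proof
  show "\<exists>K. \<forall>v w. norm (tensor_ell2 v w) \<le> norm v * norm w * K"
    by (rule exI[of _ 1]) (simp add: norm_tensor_ell2)
qed (auto intro!: ell2_eqI simp: algebra_simps)

lemma tensor_ell2_scale:
  "tensor_ell2 (c *\<^sub>C v) w = c *\<^sub>C tensor_ell2 v w" "tensor_ell2 v (c *\<^sub>C w) = c *\<^sub>C tensor_ell2 v w"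
  by (auto intro!: ell2_eqI)

lemma tensor_ell2_ket: "tensor_ell2 (ket i) (ket j) = ket (i, j)"
  by (auto intro!: ell2_eqI)

lemma tensor_ext:
  assumes "clinear_op R" "clinear_op S" "clinear_op T"
    and "\<And>i j. R (ket (i, j)) = tensor_ell2 (S (ket i)) (T (ket j))"
  shows "R (tensor_ell2 v w) = tensor_ell2 (S v) (T w)"
proof (rule bounded_linear_ell2_eqI[of "\<lambda>w. R (tensor_ell2 v w)"])
  note * = bounded_bilinear.bounded_linear_left[OF bounded_bilinear_tensor_ell2]
    bounded_bilinear.bounded_linear_right[OF bounded_bilinear_tensor_ell2]
  note ** = bounded_linear_compose[OF blinfun.bounded_linear_right] bounded_linear_compose[OF _ blinfun.bounded_linear_right]
  show "bounded_linear (\<lambda>w. R (tensor_ell2 v w))" "bounded_linear (\<lambda>w. tensor_ell2 (S v) (T w))"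
    by (intro * **)+
  fix c j
  have "R (tensor_ell2 v (ket j)) = tensor_ell2 (S v) (T (ket j))"
  proof (rule bounded_linear_ell2_eqI[of "\<lambda>v. R (tensor_ell2 v (ket j))"])
    show "bounded_linear (\<lambda>v. R (tensor_ell2 v (ket j)))"
      by (intro * **)
    show "bounded_linear (\<lambda>v. tensor_ell2 (S v) (T (ket j)))"
      by (rule bounded_linear_compose[OF *(1) blinfun.bounded_linear_right])
    show "R (tensor_ell2 (c *\<^sub>C ket i) (ket j)) = tensor_ell2 (S (c *\<^sub>C ket i)) (T (ket j))" for c i
      using assms by (simp add: clinear_op_def tensor_ell2_scale tensor_ell2_ket)
  qed
  then show "R (tensor_ell2 v (c *\<^sub>C ket j)) = tensor_ell2 (S v) (T (c *\<^sub>C ket j))"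
    using assms by (simp add: clinear_op_def tensor_ell2_scale)
qed

lemma ex_tensor_op_left:
  fixes S :: "'a ell2 \<Rightarrow>\<^sub>L 'b ell2"
  assumes S: "clinear_op S"
  shows "\<exists>R :: ('a \<times> 'c) ell2 \<Rightarrow>\<^sub>L ('b \<times> 'c) ell2.
    clinear_op R \<and> (\<forall>i j. R (ket (i, j)) = tensor_ell2 (S (ket i)) (ket j))"
proof -
  let ?F = "\<lambda>(i, j). tensor_ell2 (S (ket i)) (ket j)"
  have "norm (\<Sum>p\<in>I. c p *\<^sub>C ?F p) \<le> norm S * sqrt (\<Sum>p\<in>I. (cmod (c p))\<^sup>2)" if I: "finite I" for I c
  proof -
    define A where "A = fst ` I"
    define B where "B = snd ` I"
    define d where "d p = (if p \<in> I then c p else 0)" for p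
    define w where "w j = (\<Sum>i\<in>A. d (i, j) *\<^sub>C ket i)" for j
    have fin: "finite A" "finite B" and sub: "I \<subseteq> A \<times> B"
      using I by (auto simp: A_def B_def rev_image_eqI)
    have "(\<Sum>p\<in>I. c p *\<^sub>C ?F p) = (\<Sum>p\<in>A \<times> B. d p *\<^sub>C ?F p)"
      by (rule sum.mono_neutral_cong_left) (use fin sub in \<open>auto simp: d_def\<close>)
    also have "\<dots> = (\<Sum>j\<in>B. \<Sum>i\<in>A. d (i, j) *\<^sub>C ?F (i, j))"
      by (subst sum.swap) (simp add: sum.cartesian_product case_prod_unfold)
    also have "\<dots> = (\<Sum>j\<in>B. tensor_ell2 (S (w j)) (ket j))"
      using S by (simp add: w_def blinfun.sum_right clinear_op_def tensor_ell2_scale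
          bounded_bilinear.sum_left[OF bounded_bilinear_tensor_ell2])
    finally have "(norm (\<Sum>p\<in>I. c p *\<^sub>C ?F p))\<^sup>2 = (\<Sum>j\<in>B. (norm (tensor_ell2 (S (w j)) (ket j)))\<^sup>2)"
      using fin by (auto intro!: norm_sum_Pythagorean simp: pairwise_def orthogonal_def inner_ell2_def cinner_tensor_ell2)
    also have "\<dots> \<le> (\<Sum>j\<in>B. (norm S * norm (w j))\<^sup>2)"
      by (intro sum_mono power_mono) (simp_all add: norm_tensor_ell2 norm_blinfun)
    also have "(norm (w j))\<^sup>2 = (\<Sum>i\<in>A. (cmod (d (i, j)))\<^sup>2)" for j
    proof -
      have "(norm (w j))\<^sup>2 = (\<Sum>i\<in>A. (norm (d (i, j) *\<^sub>C ket i))\<^sup>2)"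
        unfolding w_def using fin
        by (auto intro!: norm_sum_Pythagorean simp: pairwise_def orthogonal_def inner_ell2_def cinner_scale_right cinner_commute[of "_ *\<^sub>C _"])
      then show ?thesis by (simp add: norm_scale_ell2)
    qed
    then have "(\<Sum>j\<in>B. (norm S * norm (w j))\<^sup>2) = (norm S)\<^sup>2 * (\<Sum>j\<in>B. \<Sum>i\<in>A. (cmod (d (i, j)))\<^sup>2)"
      by (simp add: power_mult_distrib sum_distrib_left)
    also have "(\<Sum>j\<in>B. \<Sum>i\<in>A. (cmod (d (i, j)))\<^sup>2) = (\<Sum>p\<in>A \<times> B. (cmod (d p))\<^sup>2)"
      by (subst sum.swap) (simp add: sum.cartesian_product case_prod_unfold)
    also have "\<dots> = (\<Sum>p\<in>I. (cmod (c p))\<^sup>2)"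
      by (rule sum.mono_neutral_cong_right) (use fin sub in \<open>auto simp: d_def\<close>)
    finally have "norm (\<Sum>p\<in>I. c p *\<^sub>C ?F p) \<le> sqrt ((norm S)\<^sup>2 * (\<Sum>p\<in>I. (cmod (c p))\<^sup>2))"
      by (rule real_le_rsqrt)
    then show ?thesis by (simp add: real_sqrt_mult)
  qed
  from op_of_basis[of ?F "norm S", OF this] show ?thesis by (intro exI[of _ "op_of_basis ?F"]) auto
qed

lemma ex_swap: "\<exists>U :: ('c \<times> 'd) ell2 \<Rightarrow>\<^sub>L ('d \<times> 'c) ell2.
    clinear_op U \<and> (\<forall>v w. U (tensor_ell2 v w) = tensor_ell2 w v)"
proof -
  define W where "W = op_of_basis (\<lambda>(i :: 'c, j :: 'd). ket (j, i))"
  have "cinner (ket (snd p, fst p)) (ket (snd q, fst q)) = 0" if "p \<noteq> q" for p q :: "'c \<times> 'd"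
    using that by (auto simp: prod_eq_iff)
  then have U: "clinear_op W" "W (ket (i, j)) = ket (j, i)" for i j
    using op_of_basis_orthogonal[of "\<lambda>(i :: 'c, j :: 'd). ket (j, i)" 1]
    by (simp_all add: W_def case_prod_unfold)
  note bl = bounded_bilinear.bounded_linear_left[OF bounded_bilinear_tensor_ell2]
    bounded_bilinear.bounded_linear_right[OF bounded_bilinear_tensor_ell2]
  note cbl = bounded_linear_compose[OF blinfun.bounded_linear_right]
  have "W (tensor_ell2 v (ket j)) = tensor_ell2 (ket j) v" for v j
  proof (rule bounded_linear_ell2_eqI[of "\<lambda>v. W (tensor_ell2 v (ket j))", OF cbl[OF bl(1)] bl(2)])
    show "W (tensor_ell2 (c *\<^sub>C ket i) (ket j)) = tensor_ell2 (ket j) (c *\<^sub>C ket i)" for c i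
      using U(1) unfolding tensor_ell2_scale tensor_ell2_ket clinear_op_def by (simp add: U(2))
  qed
  then have "W (tensor_ell2 v (c *\<^sub>C ket j)) = tensor_ell2 (c *\<^sub>C ket j) v" for v c j
    using U(1) unfolding tensor_ell2_scale clinear_op_def by simp
  then have "W (tensor_ell2 v w) = tensor_ell2 w v" for v w
    by (rule bounded_linear_ell2_eqI[of "\<lambda>w. W (tensor_ell2 v w)", OF cbl[OF bl(2)] bl(1)])
  then show ?thesis using U(1) by blast
qed

lemma tensor_op:
  fixes S :: "'a ell2 \<Rightarrow>\<^sub>L 'a ell2" and T :: "'b ell2 \<Rightarrow>\<^sub>L 'b ell2"
  assumes "clinear_op S" "clinear_op T"
  shows "clinear_op (tensor_op S T)" "tensor_op S T (tensor_ell2 v w) = tensor_ell2 (S v) (T w)"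
proof -
  have id: "clinear_op id_blinfun" by (simp add: clinear_op_def)
  obtain R1 :: "('a \<times> 'b) ell2 \<Rightarrow>\<^sub>L ('a \<times> 'b) ell2"
    where R1: "clinear_op R1" "\<And>i j. R1 (ket (i, j)) = tensor_ell2 (S (ket i)) (ket j)"
    using ex_tensor_op_left[OF assms(1)] by blast
  obtain R2 :: "('b \<times> 'a) ell2 \<Rightarrow>\<^sub>L ('b \<times> 'a) ell2"
    where R2: "clinear_op R2" "\<And>i j. R2 (ket (i, j)) = tensor_ell2 (T (ket i)) (ket j)"
    using ex_tensor_op_left[OF assms(2)] by blast
  obtain U :: "('a \<times> 'b) ell2 \<Rightarrow>\<^sub>L ('b \<times> 'a) ell2"
    where U: "clinear_op U" "\<And>v w. U (tensor_ell2 v w) = tensor_ell2 w v" using ex_swap by blast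
  obtain U' :: "('b \<times> 'a) ell2 \<Rightarrow>\<^sub>L ('a \<times> 'b) ell2"
    where U': "clinear_op U'" "\<And>v w. U' (tensor_ell2 v w) = tensor_ell2 w v" using ex_swap by blast
  define R where "R = U' o\<^sub>L R2 o\<^sub>L U o\<^sub>L R1"
  have R: "clinear_op R" using R1 R2 U U' by (simp add: R_def clinear_op_def)
  have *: "R (tensor_ell2 v w) = tensor_ell2 (S v) (T w)" for v w
  proof -
    have "R1 (tensor_ell2 v w) = tensor_ell2 (S v) (id_blinfun w)"
      by (rule tensor_ext[OF R1(1) assms(1) id]) (simp add: R1)
    moreover have "R2 (tensor_ell2 w (S v)) = tensor_ell2 (T w) (id_blinfun (S v))"
      by (rule tensor_ext[OF R2(1) assms(2) id]) (simp add: R2)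
    ultimately show ?thesis by (simp add: R_def U U')
  qed
  have "tensor_op S T = R"
    unfolding tensor_op_def
  proof (rule the_equality)
    fix R' :: "('a \<times> 'b) ell2 \<Rightarrow>\<^sub>L ('a \<times> 'b) ell2"
    assume R': "clinear_op R' \<and> (\<forall>v w. R' (tensor_ell2 v w) = tensor_ell2 (S v) (T w))"
    then have "R' (ket (i, j)) = R (ket (i, j))" for i j
      unfolding tensor_ell2_ket[symmetric] by (simp add: *)
    then show "R' = R" using R' R by (auto intro: clinear_op_eqI)
  qed (simp add: R *)
  then show "clinear_op (tensor_op S T)" "tensor_op S T (tensor_ell2 v w) = tensor_ell2 (S v) (T w)"
    by (simp_all add: R *)
qed

end

theory Submission
  imports Defs
begin

text \<open>
  Let \<open>\<T>\<close> be the Toeplitz algebra. Two families of partial isometries compare the representation of the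
  Serre algebra on the tree with that of \<open>\<T> \<otimes> C(\<int>\<^sub>s)\<close>, both intertwining asymptotically.

  First, for an \<open>s\<close>-adic integer \<open>a\<close> and a level \<open>N\<close>, a unit vector in the kernel of the adjoint of \<open>W\<close>
  that is supported on level \<open>N + 1\<close> above \<open>a mod s ^ N\<close> generates under \<open>W\<close> a copy of the unilateral shift,
  on which \<open>M\<^sub>f\<close> is close to the scalar \<open>f a\<close>. Compressing to all these copies and letting \<open>N\<close> tend to
  infinity defines a contractive *-homomorphism, the symbol map, that annihilates the compact operators.

  Secondly, on the levels \<open>\<ge> m\<close> the shift \<open>W\<close> is a pure isometry that commutes with \<open>M\<^sub>f\<close> for every \<open>f\<close>
  depending only on the residue modulo \<open>s ^ m\<close>. Its Wold decomposition embeds these levels into a multiple of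
  the unilateral shift, so modulo compact operators an element of the algebra has norm at most that of its
  symbol. Therefore the kernel of the symbol map consists of compact operators and its range is closed; the
  range contains the generators of \<open>\<T> \<otimes> C(\<int>\<^sub>s)\<close>.

  Conversely the algebra contains every compact operator, because the commutators of \<open>W\<close> with locally
  constant functions have finite rank and produce all matrix units.
\<close>

section \<open>Completeness and adjoints\<close>

text \<open>The commutator of \<open>W\<close> with \<open>M_f\<close> is small on deep levels,
  because \<open>f\<close> varies little between a deep vertex and its children, but it is not zero;
  hence the symbol is reached only in a limit. No universal property of the algebra is used. The
  symbol is first introduced as a relation between operators that is compatible with sums, products,
  adjoints and norm limits; the operators related to some symbol then form a C*-algebra, and it
  suffices to inspect the generators. The two families give opposite inequalities. The branches
  bound the symbol by the operator, so the symbol is unique and survives limits; the Wold embeddings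
  bound the distance to the compact operators by the symbol. Together they make the induced map on
  the quotient isometric, which takes the place of the general theorems on injective homomorphisms
  and closed ranges of C*-algebras.\<close>

lemma cmod_coef_le_norm: "cmod (coef v i) \<le> norm v"
  using sum_coef_le_norm[of "{i}" v] by simp

text \<open>Completeness carries over to bounded operators; this gives limits to Cauchy sequences of
  symbols and to the series that lifts a limit of symbols, and in \<open>compact_opI\<close> it
  turns total boundedness into compactness.\<close>

instance ell2 :: (type) banach
proof
  fix X :: "nat \<Rightarrow> 'a ell2"
  assume X: "Cauchy X"
  have "Cauchy (\<lambda>n. coef (X n) i)" for i
  proof (rule metric_CauchyI)
    fix e :: real assume "0 < e"
    then obtain M where M: "\<And>m n. m \<ge> M \<Longrightarrow> n \<ge> M \<Longrightarrow> dist (X m) (X n) < e"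
      using metric_CauchyD[OF X] by blast
    have "dist (coef (X m) i) (coef (X n) i) < e" if "m \<ge> M" "n \<ge> M" for m n
      using M[OF that] cmod_coef_le_norm[of "X m - X n" i] by (simp add: dist_norm)
    then show "\<exists>M. \<forall>m\<ge>M. \<forall>n\<ge>M. dist (coef (X m) i) (coef (X n) i) < e" by blast
  qed
  then have "\<exists>l. (\<lambda>n. coef (X n) i) \<longlonglongrightarrow> l" for i
    by (simp add: Cauchy_convergent_iff convergent_def)
  then obtain L where L: "\<And>i. (\<lambda>n. coef (X n) i) \<longlonglongrightarrow> L i" by metis
  define d where "d n = (\<lambda>i. coef (X n) i - L i)" for n
  have d: "\<exists>N. \<forall>n\<ge>N. coef (Abs_ell2 (d n)) = d n \<and> norm (Abs_ell2 (d n)) \<le> e" if e: "0 < e" for e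
  proof -
    obtain M where M: "\<And>m n. m \<ge> M \<Longrightarrow> n \<ge> M \<Longrightarrow> dist (X m) (X n) < e"
      using metric_CauchyD[OF X e] by blast
    have "coef (Abs_ell2 (d n)) = d n \<and> norm (Abs_ell2 (d n)) \<le> e" if n: "n \<ge> M" for n
    proof (rule ell2_boundedI)
      fix I :: "'a set" assume I: "finite I"
      show "(\<Sum>i\<in>I. (cmod (d n i))\<^sup>2) \<le> e\<^sup>2"
      proof (rule tendsto_upperbound)
        show "((\<lambda>m. \<Sum>i\<in>I. (cmod (coef (X n) i - coef (X m) i))\<^sup>2) \<longlongrightarrow> (\<Sum>i\<in>I. (cmod (d n i))\<^sup>2)) sequentially"
          unfolding d_def by (intro tendsto_intros L)
        have "(\<Sum>i\<in>I. (cmod (coef (X n) i - coef (X m) i))\<^sup>2) \<le> e\<^sup>2" if "m \<ge> M" for m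
        proof -
          have "sqrt (\<Sum>i\<in>I. (cmod (coef (X n - X m) i))\<^sup>2) \<le> e"
            using order_trans[OF sum_coef_le_norm[OF I]] M[OF n that] by (metis dist_norm less_eq_real_def)
          then show ?thesis by (simp add: sqrt_le_D)
        qed
        then show "\<forall>\<^sub>F m in sequentially. (\<Sum>i\<in>I. (cmod (coef (X n) i - coef (X m) i))\<^sup>2) \<le> e\<^sup>2"
          by (auto simp: eventually_sequentially)
      qed simp
    qed (use e in simp)
    then show ?thesis by blast
  qed
  obtain N where N: "coef (Abs_ell2 (d N)) = d N" using d[of 1] by auto
  \<comment> \<open>\<open>L\<close> is so far only a coordinatewise limit; it is square summable
    because it differs from \<open>X N\<close> by the square summable \<open>d N\<close>.\<close>
  define Y where "Y = X N - Abs_ell2 (d N)"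
  have Y: "coef Y i = L i" for i by (simp add: Y_def N) (simp add: d_def)
  have "X \<longlonglongrightarrow> Y"
  proof (rule metric_LIMSEQ_I)
    fix e :: real assume "0 < e"
    then obtain N where N: "\<And>n. n \<ge> N \<Longrightarrow> coef (Abs_ell2 (d n)) = d n \<and> norm (Abs_ell2 (d n)) \<le> e / 2"
      using d[of "e / 2"] by auto
    have "dist (X n) Y < e" if "n \<ge> N" for n
    proof -
      have "X n - Y = Abs_ell2 (d n)"
        by (rule ell2_eqI) (use N[OF that] Y in \<open>simp add: d_def\<close>)
      then show ?thesis using N[OF that] \<open>0 < e\<close> by (simp add: dist_norm)
    qed
    then show "\<exists>N. \<forall>n\<ge>N. dist (X n) Y < e" by blast
  qed
  then show "convergent X" by (auto simp: convergent_def)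
qed

interpretation blinfun_compose: bounded_bilinear "(o\<^sub>L)"
  by (rule bounded_bilinear_blinfun_compose)

lemma blinfun_compose_assoc: "(A o\<^sub>L B) o\<^sub>L C = A o\<^sub>L (B o\<^sub>L C)"
  by (auto intro: blinfun_eqI)

lemma blinfun_compose_id [simp]: "id_blinfun o\<^sub>L A = A" "A o\<^sub>L id_blinfun = A"
  by (auto intro: blinfun_eqI)

lemma coef_uminus [simp]: "coef (- v) i = - coef v i"
  by transfer simp

lemma clinear_op_scale: "clinear_op T \<Longrightarrow> T (c *\<^sub>C v) = c *\<^sub>C T v"
  by (simp add: clinear_op_def)

lemma scale_ell2_minus: "c *\<^sub>C (v - w) = c *\<^sub>C v - c *\<^sub>C w"
  by (auto intro!: ell2_eqI simp: algebra_simps)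

lemma scale_ell2_of_real: "of_real r *\<^sub>C v = r *\<^sub>R v"
  by (auto intro: ell2_eqI)

lemma clinear_op_intros [simp, intro]:
  "clinear_op 0" "clinear_op id_blinfun"
  "clinear_op S \<Longrightarrow> clinear_op T \<Longrightarrow> clinear_op (S + T)"
  "clinear_op S \<Longrightarrow> clinear_op T \<Longrightarrow> clinear_op (S - T)"
  "clinear_op A \<Longrightarrow> clinear_op B \<Longrightarrow> clinear_op (A o\<^sub>L B)"
  "clinear_op S \<Longrightarrow> clinear_op (scale_op c S)"
  "clinear_op S \<Longrightarrow> clinear_op (r *\<^sub>R S)"
  by (auto simp: clinear_op_def blinfun.add_left blinfun.diff_left blinfun.scaleR_left
      scale_ell2_distrib scale_ell2_minus scale_op_apply mult.commute intro!: ell2_eqI)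

lemma clinear_op_sum: "(\<And>k. k \<in> K \<Longrightarrow> clinear_op (f k)) \<Longrightarrow> clinear_op (\<Sum>k\<in>K. f k)"
  by (induction K rule: infinite_finite_induct) auto

lemma closed_clinear_op: "closed {T. clinear_op T}"
proof -
  have "closed {T :: 'a ell2 \<Rightarrow>\<^sub>L 'b ell2. T (c *\<^sub>C v) = c *\<^sub>C T v}" for c v
    by (intro closed_Collect_eq continuous_intros
        bounded_linear.continuous_on[OF bounded_linear_scale_ell2])
  then have "closed (\<Inter>c. \<Inter>v. {T :: 'a ell2 \<Rightarrow>\<^sub>L 'b ell2. T (c *\<^sub>C v) = c *\<^sub>C T v})" by blast
  also have "\<dots> = {T. clinear_op T}" by (auto simp: clinear_op_def)
  finally show ?thesis .
qed

lemma cinner_scale_left: "cinner (c *\<^sub>C v) w = cnj c * cinner v w"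
  by (metis cinner_commute cinner_scale_right complex_cnj_mult)

lemma cinner_add_left: "cinner (u + v) w = cinner u w + cinner v w"
  by (metis cinner_commute cinner_add_right complex_cnj_add)

lemma cinner_minus_right: "cinner u (v - w) = cinner u v - cinner u w"
  using cinner_add_right[of u "v - w" w] by simp

lemma cinner_minus_left: "cinner (u - v) w = cinner u w - cinner v w"
  using cinner_add_left[of "u - v" v w] by simp

lemma cinner_0 [simp]: "cinner 0 v = 0" "cinner v 0 = 0"
  by (simp_all add: cinner.rep_eq)

lemma cinner_sum_right: "cinner u (\<Sum>k\<in>K. f k) = (\<Sum>k\<in>K. cinner u (f k))"
  by (induction K rule: infinite_finite_induct) (auto simp: cinner_add_right)

lemma cinner_sum_left: "cinner (\<Sum>k\<in>K. f k) u = (\<Sum>k\<in>K. cinner (f k) u)"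
  by (induction K rule: infinite_finite_induct) (auto simp: cinner_add_left)

lemma cinner_adj_right: "clinear_op T \<Longrightarrow> cinner v (adj T w) = cinner (T v) w"
  by (metis cinner_adj cinner_commute)

lemma adj_eqI:
  fixes T :: "'a ell2 \<Rightarrow>\<^sub>L 'b ell2" and S :: "'b ell2 \<Rightarrow>\<^sub>L 'a ell2"
  assumes "clinear_op T" "\<And>v w. cinner (S v) w = cinner v (T w)"
  shows "adj T = S"
proof (rule blinfun_eqI)
  fix v
  show "adj T v = S v"
  proof (rule ell2_eqI)
    fix i
    have "cinner (adj T v) (ket i) = cinner (S v) (ket i)"
      by (simp add: cinner_adj[OF assms(1)] assms(2))
    then show "coef (adj T v) i = coef (S v) i" by (simp add: cinner_ket_right)
  qed
qed

lemma coef_adj: "clinear_op T \<Longrightarrow> coef (adj T v) i = cinner (T (ket i)) v"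
  by (metis cinner_adj_right cinner_ket)

lemma clinear_adj [simp]: "clinear_op T \<Longrightarrow> clinear_op (adj T)"
  by (auto simp: clinear_op_def[of "adj T"] coef_adj cinner_scale_right intro: ell2_eqI)

lemma adj_adj [simp]: "clinear_op T \<Longrightarrow> adj (adj T) = T"
  by (rule adj_eqI) (simp_all add: cinner_adj_right)

lemma adj_compose: "clinear_op A \<Longrightarrow> clinear_op B \<Longrightarrow> adj (A o\<^sub>L B) = adj B o\<^sub>L adj A"
  by (rule adj_eqI) (auto simp: cinner_adj)

lemma adj_add: "clinear_op S \<Longrightarrow> clinear_op T \<Longrightarrow> adj (S + T) = adj S + adj T"
  by (rule adj_eqI) (auto simp: cinner_adj cinner_add_left cinner_add_right blinfun.add_left)

lemma adj_diff: "clinear_op S \<Longrightarrow> clinear_op T \<Longrightarrow> adj (S - T) = adj S - adj T"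
  by (rule adj_eqI) (auto simp: cinner_adj cinner_minus_left cinner_minus_right blinfun.diff_left)

lemma adj_scale: "clinear_op T \<Longrightarrow> adj (scale_op c T) = scale_op (cnj c) (adj T)"
  by (rule adj_eqI) (auto simp: cinner_adj cinner_scale_left cinner_scale_right scale_op_apply)

lemma adj_0 [simp]: "adj 0 = 0" and adj_id [simp]: "adj id_blinfun = id_blinfun"
  by (rule adj_eqI; simp)+

lemma norm_sq_le:
  assumes "cinner u u = cinner v w"
  shows "(norm u)\<^sup>2 \<le> norm v * norm w"
proof -
  have "(norm u)\<^sup>2 = cmod (cinner v w)"
    unfolding assms[symmetric] cinner_self norm_of_real by simp
  then show ?thesis by (simp add: cmod_cinner_le)
qed

lemma norm_adj_le:
  assumes "clinear_op T"
  shows "norm (adj T) \<le> norm T"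
proof (rule norm_blinfun_bound)
  fix v
  have "(norm (adj T v))\<^sup>2 \<le> norm v * norm (T (adj T v))"
    by (rule norm_sq_le) (simp only: cinner_adj[OF assms])
  also have "\<dots> \<le> norm v * (norm T * norm (adj T v))" by (intro mult_left_mono norm_blinfun) simp
  finally have "norm (adj T v) * norm (adj T v) \<le> norm T * norm v * norm (adj T v)"
    by (simp add: power2_eq_square ac_simps)
  then show "norm (adj T v) \<le> norm T * norm v"
    by (cases "norm (adj T v) = 0") (auto simp: mult_le_cancel_right)
qed simp

lemma norm_adj: "clinear_op T \<Longrightarrow> norm (adj T) = norm T"
  using norm_adj_le[of T] norm_adj_le[of "adj T"] by simp

lemma scale_op_eq:
  "scale_op c (S + T) = scale_op c S + scale_op c T"
  "scale_op c S o\<^sub>L A = scale_op c (S o\<^sub>L A)"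
  "clinear_op B \<Longrightarrow> B o\<^sub>L scale_op c S = scale_op c (B o\<^sub>L S)"
  "scale_op c (S - T) = scale_op c S - scale_op c T"
  "scale_op c 0 = 0"
  "scale_op c (scale_op d S) = scale_op (c * d) S"
  "scale_op (of_real r) S = r *\<^sub>R S"
  by (auto intro!: blinfun_eqI simp: scale_op_apply blinfun.add_left blinfun.diff_left blinfun.scaleR_left
      scale_ell2_distrib scale_ell2_minus clinear_op_scale scale_ell2_of_real)

lemma norm_scale_op: "norm (scale_op c T) = cmod c * norm T"
proof -
  have le: "norm (scale_op c T) \<le> cmod c * norm T" for c and T :: "'a ell2 \<Rightarrow>\<^sub>L 'b ell2"
    by (rule norm_blinfun_bound) (simp_all add: scale_op_apply norm_scale_ell2 mult.assoc mult_left_mono norm_blinfun)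
  show ?thesis
  proof (cases "c = 0")
    case True then show ?thesis using le[of c T] by simp
  next
    case False
    have "scale_op 1 T = T" by (rule blinfun_eqI) (simp add: scale_op_apply)
    then have "norm T \<le> cmod (1 / c) * norm (scale_op c T)"
      using le[of "1 / c" "scale_op c T"] False by (simp add: scale_op_eq)
    then show ?thesis using False le[of c T] by (simp add: norm_divide field_simps)
  qed
qed

lemma minus_eq_scale: "X - Y = X + scale_op (- 1) Y"
  by (auto intro!: blinfun_eqI ell2_eqI simp: scale_op_apply blinfun.diff_left blinfun.add_left blinfun.minus_left)

lemma bounded_linear_scale_op: "bounded_linear (scale_op c)"
proof (rule bounded_linear_intro[where K = "cmod c"])
  show "scale_op c (r *\<^sub>R T) = r *\<^sub>R scale_op c T" for r and T :: "'a ell2 \<Rightarrow>\<^sub>L 'b ell2"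
    by (auto intro!: blinfun_eqI ell2_eqI simp: scale_op_apply blinfun.scaleR_left)
  show "norm (scale_op c T) \<le> norm T * cmod c" for T :: "'a ell2 \<Rightarrow>\<^sub>L 'b ell2"
    by (simp add: norm_scale_op mult.commute)
qed (rule scale_op_eq(1))

section \<open>Diagonal operators and coordinate projections\<close>

lemma coef_diag_op:
  assumes "\<And>i. i \<in> I \<Longrightarrow> cmod (g i) \<le> B"
  shows "coef (diag_op I g v) i = (if i \<in> I then g i * coef v i else 0)"
proof -
  have g: "\<And>i. i \<in> I \<Longrightarrow> cmod (g i) \<le> \<bar>B\<bar>" by (rule order_trans[OF assms abs_ge_self])
  note d = diag_op[of I g "\<bar>B\<bar>", OF g abs_ge_zero]
  let ?g = "\<lambda>i. if i \<in> I then g i else 0"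
  have "cinner (ket i) (diag_op I g v) = ?g i * cinner (ket i) v"
  proof (rule bounded_linear_ell2_eqI)
    show "bounded_linear (\<lambda>v. cinner (ket i) (diag_op I g v))"
      by (rule bounded_linear_compose[OF bounded_linear_cinner_right blinfun.bounded_linear_right])
    show "bounded_linear (\<lambda>v. ?g i * cinner (ket i) v)"
      by (rule bounded_linear_compose[OF bounded_linear_mult_right bounded_linear_cinner_right])
    show "cinner (ket i) (diag_op I g (c *\<^sub>C ket j)) = ?g i * cinner (ket i) (c *\<^sub>C ket j)" for c j
      by (simp add: d(2) clinear_op_scale[OF d(1)])
  qed
  then show ?thesis by simp
qed

lemma adj_diag_op:
  assumes "\<And>i. i \<in> I \<Longrightarrow> cmod (g i) \<le> B"
  shows "adj (diag_op I g) = diag_op I (\<lambda>i. cnj (g i))"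
proof (rule blinfun_eqI, rule ell2_eqI)
  fix v i
  have g: "\<And>i. i \<in> I \<Longrightarrow> cmod (g i) \<le> \<bar>B\<bar>" by (rule order_trans[OF assms abs_ge_self])
  note d = diag_op[of I g "\<bar>B\<bar>", OF g abs_ge_zero]
  have c: "\<And>i. i \<in> I \<Longrightarrow> cmod (cnj (g i)) \<le> B" using assms by (simp only: complex_mod_cnj)
  show "coef (adj (diag_op I g) v) i = coef (diag_op I (\<lambda>i. cnj (g i)) v) i"
    by (simp only: coef_diag_op[of I "\<lambda>i. cnj (g i)" B v i, OF c] coef_adj[OF d(1)] d(2))
      (simp add: cinner_scale_left)
qed

abbreviation proj :: "'a set \<Rightarrow> ('a ell2 \<Rightarrow>\<^sub>L 'a ell2)"
  where "proj I \<equiv> diag_op I (\<lambda>_. 1)"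

lemma proj [simp]:
  shows "clinear_op (proj I)" "norm (proj I) \<le> 1" "adj (proj I) = proj I"
    and "proj I (ket i) = (if i \<in> I then ket i else 0)"
    and "coef (proj I v) i = (if i \<in> I then coef v i else 0)"
proof -
  show "clinear_op (proj I)"
    by (rule diag_op(1)[where B = 1]) simp_all
  show "norm (proj I) \<le> 1"
    by (rule diag_op(3)[where B = 1]) simp_all
  show "adj (proj I) = proj I"
    by (subst adj_diag_op[where B = 1]) simp_all
  show "proj I (ket i) = (if i \<in> I then ket i else 0)"
    by (subst diag_op(2)[where B = 1]) simp_all
  show "coef (proj I v) i = (if i \<in> I then coef v i else 0)"
    by (subst coef_diag_op[where B = 1]) simp_all
qed

lemma proj_compose: "proj I o\<^sub>L proj J = proj (I \<inter> J)"
  by (auto intro!: blinfun_eqI ell2_eqI)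

lemma norm_proj_le: "norm (proj I v) \<le> norm v"
  using norm_blinfun[of "proj I" v] mult_right_mono[of "norm (proj I)" 1 "norm v"] by simp

lemma proj_tendsto: "((\<lambda>F. proj F v) \<longlongrightarrow> v) (finite_subsets_at_top UNIV)"
proof -
  have "proj F v = (\<Sum>i\<in>F. coef v i *\<^sub>C ket i)" if "finite F" for F
    using that by (auto intro!: ell2_eqI simp: if_distrib cong: if_cong)
  then have "\<forall>\<^sub>F F in finite_subsets_at_top UNIV. (\<Sum>i\<in>F. coef v i *\<^sub>C ket i) = proj F v"
    by (intro eventually_finite_subsets_at_top_weakI) simp
  then show ?thesis using has_sum_ket[of v] unfolding has_sum_def by (rule tendsto_cong[THEN iffD1])
qed

section \<open>Compact operators\<close>

definition compact_op :: "('a ell2 \<Rightarrow>\<^sub>L 'b ell2) \<Rightarrow> bool"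
  where "compact_op T \<longleftrightarrow> clinear_op T \<and> compact (closure (blinfun_apply T ` cball 0 1))"

lemma compact_ops_eq: "compact_ops = {T. compact_op T}"
  by (auto simp: compact_ops_def compact_op_def)

lemma compact_op_clinear [simp]: "compact_op T \<Longrightarrow> clinear_op T"
  by (simp add: compact_op_def)

lemma norm_blinfun_bound_cball:
  fixes T :: "'a ell2 \<Rightarrow>\<^sub>L 'b ell2"
  assumes "\<And>v. norm v \<le> 1 \<Longrightarrow> norm (T v) \<le> e" "0 \<le> e"
  shows "norm T \<le> e"
proof (rule norm_blinfun_bound[OF assms(2)])
  fix v
  show "norm (T v) \<le> e * norm v"
  proof (cases "v = 0")
    case False
    then have "norm (T ((1 / norm v) *\<^sub>R v)) \<le> e" by (intro assms) simp
    then show ?thesis using False by (simp add: blinfun.scaleR_right field_simps)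
  qed simp
qed

lemma norm_diff_add_le: "norm (a - b + c) \<le> norm a + norm b + norm (c :: 'a :: real_normed_vector)"
  by (rule order_trans[OF norm_triangle_ineq add_right_mono[OF norm_triangle_ineq4]])

text \<open>On a finite \<open>e / 3\<close>-net of the image of the unit ball the strong
  convergence of the coordinate projections is uniform, and the net controls the rest because the
  projections are contractions.\<close>

lemma compact_op_approx:
  assumes "compact_op T" "0 < e"
  shows "\<exists>F. finite F \<and> norm (T - (proj F o\<^sub>L T)) \<le> e"
proof -
  let ?K = "closure (blinfun_apply T ` cball 0 1)"
  have "compact ?K" using assms by (simp add: compact_op_def)
  then obtain k where k: "finite k" "?K \<subseteq> (\<Union>x\<in>k. ball x (e / 3))"
    unfolding compact_eq_totally_bounded using assms by (meson divide_pos_pos zero_less_numeral)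
  have "\<forall>x\<in>k. \<forall>\<^sub>F F in finite_subsets_at_top UNIV. dist (proj F x) x < e / 3"
    using proj_tendsto assms(2) unfolding tendsto_iff by (metis divide_pos_pos zero_less_numeral)
  then have "\<forall>\<^sub>F F in finite_subsets_at_top UNIV. \<forall>x\<in>k. dist (proj F x) x < e / 3"
    by (rule eventually_ball_finite[OF k(1)])
  then obtain F where F: "finite F" "\<And>x. x \<in> k \<Longrightarrow> dist (proj F x) x < e / 3"
    unfolding eventually_finite_subsets_at_top by (metis order_refl subset_UNIV)
  have "norm (T - (proj F o\<^sub>L T)) \<le> e"
  proof (rule norm_blinfun_bound_cball)
    fix v :: "'a ell2" assume "norm v \<le> 1"
    then have "T v \<in> ?K" by (intro subsetD[OF closure_subset] imageI) simp
    then obtain x where x: "x \<in> k" "dist x (T v) < e / 3" using k by auto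
    have "(T - (proj F o\<^sub>L T)) v = (T v - x) - (proj F x - x) + proj F (x - T v)"
      by (simp add: blinfun.diff_left blinfun.diff_right)
    also have "norm \<dots> \<le> norm (T v - x) + norm (proj F x - x) + norm (proj F (x - T v))"
      by (rule norm_diff_add_le)
    also have "\<dots> \<le> e"
      using x F(2)[OF x(1)] norm_proj_le[of F "x - T v"] by (simp add: dist_norm norm_minus_commute)
    finally show "norm ((T - (proj F o\<^sub>L T)) v) \<le> e" .
  qed (use assms in simp)
  with F show ?thesis by blast
qed

lemma bounded_linear_scale_left: "bounded_linear (\<lambda>c. c *\<^sub>C v)"
  by (rule bounded_linear_intro[where K = "norm v"])
    (auto intro!: ell2_eqI simp: norm_scale_ell2 algebra_simps scaleR_conv_of_real)

text \<open>A Heine-Borel argument: each further coordinate adds a compact disc, and a sum of two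
  compact sets is compact.\<close>

lemma compact_finite_support:
  assumes "finite F"
  shows "compact {v :: 'a ell2. proj F v = v \<and> (\<forall>i. cmod (coef v i) \<le> r)}"
  using assms
proof (induction F rule: finite_induct)
  case empty
  have "{v :: 'a ell2. proj {} v = v \<and> (\<forall>i. cmod (coef v i) \<le> r)} \<subseteq> {0}"
    by (auto intro!: ell2_eqI dest!: arg_cong[where f = coef] simp: fun_eq_iff)
  then have "finite {v :: 'a ell2. proj {} v = v \<and> (\<forall>i. cmod (coef v i) \<le> r)}"
    by (rule finite_subset) simp
  then show ?case by (rule finite_imp_compact)
next
  case (insert i F)
  let ?C = "\<lambda>F. {v :: 'a ell2. proj F v = v \<and> (\<forall>i. cmod (coef v i) \<le> r)}"
  let ?L = "(\<lambda>c. c *\<^sub>C ket i) ` cball 0 r"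
  have "compact ?L"
    by (intro compact_continuous_image bounded_linear.continuous_on[OF bounded_linear_scale_left]
        continuous_intros compact_cball)
  with insert have "compact (\<Union>x\<in>?C F. \<Union>y\<in>?L. {x + y})" by (intro compact_sums')
  also have "(\<Union>x\<in>?C F. \<Union>y\<in>?L. {x + y}) = ?C (insert i F)"
  proof (intro equalityI subsetI)
    fix v assume "v \<in> (\<Union>x\<in>?C F. \<Union>y\<in>?L. {x + y})"
    then obtain x c where x: "proj F x = x" "\<forall>i. cmod (coef x i) \<le> r" "cmod c \<le> r" "v = x + c *\<^sub>C ket i"
      by auto
    have "coef x j = 0" if "j \<notin> F" for j using that arg_cong[OF x(1), of "\<lambda>v. coef v j"] by simp
    then show "v \<in> ?C (insert i F)" using x insert(2) by (auto intro!: ell2_eqI)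
  next
    fix v assume v: "v \<in> ?C (insert i F)"
    have z: "coef v j = 0" if "j \<notin> insert i F" for j
    proof -
      have "coef v j = coef (proj (insert i F) v) j" using v by simp
      then show ?thesis using that by simp
    qed
    have "v = proj F v + coef v i *\<^sub>C ket i"
      using z insert(2) by (intro ell2_eqI) auto
    moreover have "proj F v \<in> ?C F" using v order_trans[OF norm_ge_zero] by (auto intro!: ell2_eqI)
    moreover have "coef v i *\<^sub>C ket i \<in> ?L" using v by (intro imageI) simp
    ultimately show "v \<in> (\<Union>x\<in>?C F. \<Union>y\<in>?L. {x + y})" by blast
  qed
  finally show ?case .
qed

text \<open>Converse of \<open>compact_op_approx\<close>: up to \<open>e / 4\<close> the image of
  the ball lies in a compact box of finitely many coordinates, from which it inherits a finite net.
  From here on compactness is mostly handled through cut-offs by \<open>proj F\<close>.\<close>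

lemma compact_opI:
  assumes T: "clinear_op T" and approx: "\<And>e. 0 < e \<Longrightarrow> \<exists>F. finite F \<and> norm (T - (proj F o\<^sub>L T)) \<le> e"
  shows "compact_op T"
  unfolding compact_op_def compact_eq_totally_bounded
proof (intro conjI T allI impI)
  show "complete (closure (blinfun_apply T ` cball 0 1))" by (simp add: complete_eq_closed)
  fix e :: real assume e: "0 < e"
  then obtain F where F: "finite F" "norm (T - (proj F o\<^sub>L T)) \<le> e / 4" using approx[of "e / 4"] by auto
  let ?C = "{v. proj F v = v \<and> (\<forall>i. cmod (coef v i) \<le> norm T)}"
  obtain k where k: "finite k" "?C \<subseteq> (\<Union>x\<in>k. ball x (e / 4))"
    using compact_finite_support[OF F(1), of "norm T"] e unfolding compact_eq_totally_bounded
    by (meson divide_pos_pos zero_less_numeral)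
  have "blinfun_apply T ` cball 0 1 \<subseteq> (\<Union>x\<in>k. cball x (e / 2))"
  proof (rule image_subsetI)
    fix v :: "'a ell2" assume "v \<in> cball 0 1"
    then have v: "norm v \<le> 1" by simp
    have Tv: "norm (T v) \<le> norm T"
      using norm_blinfun[of T v] mult_left_mono[OF v, of "norm T"] by simp
    have "proj F (T v) \<in> ?C"
      using order_trans[OF cmod_coef_le_norm Tv] by (auto intro!: ell2_eqI)
    then obtain x where x: "x \<in> k" "dist x (proj F (T v)) < e / 4" using k by auto
    have "norm ((T - (proj F o\<^sub>L T)) v) \<le> norm (T - (proj F o\<^sub>L T))"
      using norm_blinfun[of "T - (proj F o\<^sub>L T)" v] mult_left_mono[OF v, of "norm (T - (proj F o\<^sub>L T))"] by simp
    then have "dist (T v) (proj F (T v)) \<le> e / 4" using F(2) by (simp add: dist_norm blinfun.diff_left)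
    then have "dist x (T v) \<le> e / 2"
      using x(2) dist_triangle2[of x "T v" "proj F (T v)"] by simp
    then show "T v \<in> (\<Union>x\<in>k. cball x (e / 2))" using x(1) by auto
  qed
  moreover have "closed (\<Union>x\<in>k. cball x (e / 2))" using k(1) by (intro closed_UN) auto
  ultimately have "closure (blinfun_apply T ` cball 0 1) \<subseteq> (\<Union>x\<in>k. cball x (e / 2))"
    by (rule closure_minimal)
  also have "\<dots> \<subseteq> (\<Union>x\<in>k. ball x e)" using e by fastforce
  finally show "\<exists>k. finite k \<and> closure (blinfun_apply T ` cball 0 1) \<subseteq> (\<Union>x\<in>k. ball x e)" using k(1) by blast
qed

lemma norm_proj_compose_le: "norm (proj F o\<^sub>L T) \<le> norm T"
  using norm_blinfun_compose[of "proj F" T] mult_right_mono[of "norm (proj F)" 1 "norm T"] by simp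

lemma norm_compose_proj_le: "norm (T o\<^sub>L proj F) \<le> norm T"
  using norm_blinfun_compose[of T "proj F"] mult_left_mono[of "norm (proj F)" 1 "norm T"] by simp

lemma compact_op_limit:
  assumes T: "clinear_op T" and lim: "\<And>e. 0 < e \<Longrightarrow> \<exists>U. compact_op U \<and> norm (T - U) \<le> e"
  shows "compact_op T"
proof (rule compact_opI[OF T])
  fix e :: real assume e: "0 < e"
  then obtain U where U: "compact_op U" "norm (T - U) \<le> e / 3" using lim[of "e / 3"] by auto
  obtain F where F: "finite F" "norm (U - (proj F o\<^sub>L U)) \<le> e / 3"
    using compact_op_approx[OF U(1), of "e / 3"] e by auto
  have "T - (proj F o\<^sub>L T) = (T - U) - (proj F o\<^sub>L (T - U)) + (U - (proj F o\<^sub>L U))"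
    by (simp add: blinfun_compose.diff_right)
  also have "norm \<dots> \<le> norm (T - U) + norm (proj F o\<^sub>L (T - U)) + norm (U - (proj F o\<^sub>L U))"
    by (rule norm_diff_add_le)
  also have "\<dots> \<le> e" using U F norm_proj_compose_le[of F "T - U"] by simp
  finally show "\<exists>F. finite F \<and> norm (T - (proj F o\<^sub>L T)) \<le> e" using F by blast
qed

lemma closed_compact_op: "closed {T. compact_op T}"
  unfolding closed_sequential_limits
proof (intro allI impI, elim conjE)
  fix X and T :: "'a ell2 \<Rightarrow>\<^sub>L 'b ell2"
  assume X: "\<forall>n. X n \<in> {T. compact_op T}" "X \<longlonglongrightarrow> T"
  have "T \<in> {T. clinear_op T}"
    by (rule closed_sequentially[OF closed_clinear_op _ X(2)]) (use X in auto)
  moreover have "\<exists>U. compact_op U \<and> norm (T - U) \<le> e" if "0 < e" for e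
    using metric_LIMSEQ_D[OF X(2) that] X(1)
    by (metis dist_norm dist_commute le_refl less_eq_real_def mem_Collect_eq)
  ultimately show "T \<in> {T. compact_op T}" by (auto intro: compact_op_limit)
qed

lemma compact_op_0 [simp]: "compact_op 0"
  by (rule compact_opI) (auto intro!: exI[of _ "{}"])

lemma compact_op_proj [simp]: "finite F \<Longrightarrow> compact_op (proj F)"
  by (rule compact_opI) (auto intro!: exI[of _ F] simp: proj_compose)

lemma compact_op_compose_right:
  assumes "compact_op S" "clinear_op A"
  shows "compact_op (S o\<^sub>L A)"
proof (rule compact_opI)
  show "clinear_op (S o\<^sub>L A)" using assms by simp
  fix e :: real assume "0 < e"
  \<comment> \<open>The summand 1 keeps the denominator positive when \<open>A\<close> is
    zero.\<close>
  then obtain F where F: "finite F" "norm (S - (proj F o\<^sub>L S)) \<le> e / (norm A + 1)"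
    using compact_op_approx[OF assms(1), of "e / (norm A + 1)"] by (auto simp: add_nonneg_pos)
  have "(S o\<^sub>L A) - (proj F o\<^sub>L (S o\<^sub>L A)) = (S - (proj F o\<^sub>L S)) o\<^sub>L A"
    by (auto intro: blinfun_eqI simp: blinfun.diff_left)
  also have "norm \<dots> \<le> e / (norm A + 1) * norm A"
    by (rule order_trans[OF norm_blinfun_compose]) (intro mult_right_mono F norm_ge_zero)
  also have "\<dots> \<le> e" proof -
    have "e * norm A \<le> e * (norm A + 1)" using \<open>0 < e\<close> by simp
    then have "e * norm A / (norm A + 1) \<le> e" by (simp add: pos_divide_le_eq add_nonneg_pos)
    then show ?thesis by simp
  qed
  finally show "\<exists>F. finite F \<and> norm ((S o\<^sub>L A) - (proj F o\<^sub>L (S o\<^sub>L A))) \<le> e" using F by blast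
qed

text \<open>A cut-off of \<open>S\<close> says nothing about a cut-off placed after
  \<open>A\<close>, so this goes back to the definition: the continuous image of the compact closure
  is compact.\<close>

lemma compact_op_compose_left:
  assumes "compact_op S" "clinear_op A"
  shows "compact_op (A o\<^sub>L S)"
proof -
  let ?K = "closure (blinfun_apply S ` cball 0 1)"
  have K: "compact (blinfun_apply A ` ?K)"
    using assms by (intro compact_continuous_image continuous_intros) (simp add: compact_op_def)
  have "blinfun_apply (A o\<^sub>L S) ` cball 0 1 \<subseteq> blinfun_apply A ` ?K"
    using closure_subset by fastforce
  then have "closure (blinfun_apply (A o\<^sub>L S) ` cball 0 1) \<subseteq> blinfun_apply A ` ?K"
    by (rule closure_minimal) (rule compact_imp_closed[OF K])
  then have "compact (closure (blinfun_apply (A o\<^sub>L S) ` cball 0 1))"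
    using compact_Int_closed[OF K closed_closure] by (metis inf.absorb_iff2)
  then show ?thesis using assms by (simp add: compact_op_def)
qed

lemma compact_op_scale: "compact_op T \<Longrightarrow> compact_op (scale_op c T)"
  using compact_op_compose_left[of T "scale_op c id_blinfun"]
  by (simp add: scale_op_eq(2) blinfun_compose_id)

lemma compact_op_add:
  assumes S: "compact_op S" and T: "compact_op T"
  shows "compact_op (S + T)"
proof (rule compact_opI)
  show "clinear_op (S + T)" using assms by simp
  fix e :: real assume "0 < e"
  then obtain F G where F: "finite F" "norm (S - (proj F o\<^sub>L S)) \<le> e / 4"
    and G: "finite G" "norm (T - (proj G o\<^sub>L T)) \<le> e / 4"
    using compact_op_approx[OF S, of "e / 4"] compact_op_approx[OF T, of "e / 4"] by auto
  \<comment> \<open>A larger cut-off costs at most the factor 2, because it fixes the range of the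
    smaller one; hence \<open>e / 4\<close> above.\<close>
  have *: "norm (U - (proj (F \<union> G) o\<^sub>L U)) \<le> 2 * norm (U - (proj H o\<^sub>L U))" if "H \<subseteq> F \<union> G" for H and U :: "'a ell2 \<Rightarrow>\<^sub>L 'b ell2"
  proof -
    have "proj (F \<union> G) (proj H w) = proj H w" for w using that by (auto intro!: ell2_eqI)
    then have "U - (proj (F \<union> G) o\<^sub>L U) = (U - (proj H o\<^sub>L U)) - (proj (F \<union> G) o\<^sub>L (U - (proj H o\<^sub>L U)))"
      by (auto intro!: blinfun_eqI simp: blinfun.diff_left blinfun.diff_right blinfun.minus_left)
    also have "norm \<dots> \<le> norm (U - (proj H o\<^sub>L U)) + norm (proj (F \<union> G) o\<^sub>L (U - (proj H o\<^sub>L U)))"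
      by (rule norm_triangle_ineq4)
    finally show ?thesis using norm_proj_compose_le[of "F \<union> G" "U - (proj H o\<^sub>L U)"] by simp
  qed
  have "(S + T) - (proj (F \<union> G) o\<^sub>L (S + T)) = (S - (proj (F \<union> G) o\<^sub>L S)) + (T - (proj (F \<union> G) o\<^sub>L T))"
    by (simp add: blinfun_compose.add_right)
  also have "norm \<dots> \<le> e"
    using norm_triangle_ineq[of "S - (proj (F \<union> G) o\<^sub>L S)" "T - (proj (F \<union> G) o\<^sub>L T)"] F(2) G(2) *[of F S] *[of G T] by simp
  finally show "\<exists>F. finite F \<and> norm ((S + T) - (proj F o\<^sub>L (S + T))) \<le> e" using F G by (meson finite_UnI)
qed

lemma compact_op_diff:
  assumes "compact_op S" "compact_op T"
  shows "compact_op (S - T)"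
proof -
  have "S - T = S + scale_op (- 1) T"
    by (auto intro!: blinfun_eqI ell2_eqI simp: scale_op_apply blinfun.diff_left blinfun.add_left blinfun.minus_left)
  then show ?thesis using compact_op_add[OF assms(1) compact_op_scale[OF assms(2), of "- 1"]] by metis
qed

text \<open>Schauder's theorem: the adjoint of a cut-off of \<open>T\<close> is \<open>adj T\<close>
  after a finite-rank projection, hence compact, and adjoints preserve norms.\<close>

lemma compact_op_adj:
  assumes T: "compact_op T"
  shows "compact_op (adj T)"
proof (rule compact_op_limit)
  show "clinear_op (adj T)" using T by simp
  fix e :: real assume "0 < e"
  then obtain F where F: "finite F" "norm (T - (proj F o\<^sub>L T)) \<le> e"
    using compact_op_approx[OF T, of e] by auto
  have "adj T - (adj T o\<^sub>L proj F) = adj (T - (proj F o\<^sub>L T))"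
    using T by (simp add: adj_diff adj_compose)
  then have "norm (adj T - (adj T o\<^sub>L proj F)) \<le> e" using F T by (simp add: norm_adj)
  moreover have "compact_op (adj T o\<^sub>L proj F)" using F T by (intro compact_op_compose_left) auto
  ultimately show "\<exists>U. compact_op U \<and> norm (adj T - U) \<le> e" by blast
qed

lemma compact_op_approx_right:
  assumes T: "compact_op T" and e: "0 < e"
  shows "\<exists>F. finite F \<and> norm (T - (T o\<^sub>L proj F)) \<le> e"
proof -
  obtain F where F: "finite F" "norm (adj T - (proj F o\<^sub>L adj T)) \<le> e"
    using compact_op_approx[OF compact_op_adj[OF T] e] by auto
  have "T - (T o\<^sub>L proj F) = adj (adj T - (proj F o\<^sub>L adj T))"
    using T by (simp add: adj_diff adj_compose)
  then show ?thesis using F T by (auto simp: norm_adj)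
qed

lemma cstar_algebra_compact_ops: "cstar_algebra compact_ops"
  unfolding cstar_algebra_def compact_ops_eq
  by (auto simp: closed_compact_op compact_op_add compact_op_scale compact_op_adj compact_op_compose_left)

section \<open>C*-algebras and tensor products\<close>

lemma cstar_algebra_clinear: "cstar_algebra {T. clinear_op T}"
  by (auto simp: cstar_algebra_def closed_clinear_op)

lemma cstar_generated:
  assumes "\<And>a. a \<in> G \<Longrightarrow> clinear_op a"
  shows "cstar_algebra (cstar_generated G)"
  unfolding cstar_algebra_def
proof (intro conjI ballI allI)
  show "clinear_op a" if "a \<in> cstar_generated G" for a
    using that cstar_algebra_clinear assms unfolding cstar_generated_def by blast
  show "closed (cstar_generated G)"
    unfolding cstar_generated_def by (rule closed_Inter) (simp add: cstar_algebra_def)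
qed (auto simp: cstar_generated_def cstar_algebra_def)

lemma cstar_generated_subset: "G \<subseteq> cstar_generated G"
  by (auto simp: cstar_generated_def)

lemma cstar_generated_minimal: "cstar_algebra A \<Longrightarrow> G \<subseteq> A \<Longrightarrow> cstar_generated G \<subseteq> A"
  by (auto simp: cstar_generated_def)

lemma cstar_algebraD:
  assumes "cstar_algebra A"
  shows "a \<in> A \<Longrightarrow> clinear_op a" "0 \<in> A" "a \<in> A \<Longrightarrow> b \<in> A \<Longrightarrow> a + b \<in> A"
    "a \<in> A \<Longrightarrow> b \<in> A \<Longrightarrow> a o\<^sub>L b \<in> A" "a \<in> A \<Longrightarrow> scale_op c a \<in> A" "a \<in> A \<Longrightarrow> adj a \<in> A"
    "closed A" "a \<in> A \<Longrightarrow> r *\<^sub>R a \<in> A" "a \<in> A \<Longrightarrow> b \<in> A \<Longrightarrow> a - b \<in> A" "subspace A"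
proof -
  note * = assms[unfolded cstar_algebra_def]
  show "a \<in> A \<Longrightarrow> clinear_op a" "0 \<in> A" "a \<in> A \<Longrightarrow> b \<in> A \<Longrightarrow> a + b \<in> A"
    "a \<in> A \<Longrightarrow> b \<in> A \<Longrightarrow> a o\<^sub>L b \<in> A" "a \<in> A \<Longrightarrow> scale_op c a \<in> A" "a \<in> A \<Longrightarrow> adj a \<in> A"
    "closed A"
    using * by blast+
  have R: "r *\<^sub>R a \<in> A" if "a \<in> A" for r a
    using * that by (metis scale_op_eq(7))
  then show sub: "subspace A" using * by (simp add: subspace_def)
  show "a \<in> A \<Longrightarrow> r *\<^sub>R a \<in> A" by (rule R)
  show "a \<in> A \<Longrightarrow> b \<in> A \<Longrightarrow> a - b \<in> A" using subspace_diff[OF sub] by blast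
qed

lemma closure_sequentialI:
  fixes l :: "'a :: first_countable_topology"
  shows "(\<And>n. x n \<in> S) \<Longrightarrow> x \<longlonglongrightarrow> l \<Longrightarrow> l \<in> closure S"
  unfolding closure_sequential by blast

text \<open>The span is a real one, so complex scalars have to come from \<open>scale\<close> on the
  generators; products and adjoints extend by linearity and then by continuity.\<close>

lemma cstar_algebra_closure_span:
  assumes G: "\<And>a. a \<in> G \<Longrightarrow> clinear_op a"
    and mult: "\<And>a b. a \<in> G \<Longrightarrow> b \<in> G \<Longrightarrow> a o\<^sub>L b \<in> span G"
    and scale: "\<And>a c. a \<in> G \<Longrightarrow> scale_op c a \<in> span G"
    and adj: "\<And>a. a \<in> G \<Longrightarrow> adj a \<in> span G"
  shows "cstar_algebra (closure (span G))"
proof -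
  have lin: "clinear_op a" if "a \<in> span G" for a
    using that by (induction rule: span_induct_alt) (auto simp: G)
  have lin': "clinear_op a" if "a \<in> closure (span G)" for a
    using that closure_minimal[OF _ closed_clinear_op, of "span G"] lin by blast
  have mult1: "a o\<^sub>L b \<in> span G" if "a \<in> span G" "b \<in> G" for a b
    using that(1)
  proof (induction rule: span_induct_alt)
    case (step c x y)
    then show ?case using mult[of x b] that
      by (simp add: blinfun_compose.add_left blinfun_compose.scaleR_left span_add span_scale)
  qed (simp add: span_zero)
  have mult2: "a o\<^sub>L b \<in> span G" if "a \<in> span G" "b \<in> span G" for a b
    using that(2)
  proof (induction rule: span_induct_alt)
    case (step c x y)
    then show ?case using mult1[of a x] that
      by (simp add: blinfun_compose.add_right blinfun_compose.scaleR_right span_add span_scale)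
  qed (simp add: span_zero)
  have scale': "scale_op c a \<in> span G" if "a \<in> span G" for a c
    using that
  proof (induction rule: span_induct_alt)
    case (step r x y)
    have "scale_op c (r *\<^sub>R x) = r *\<^sub>R scale_op c x"
      by (rule linear_cmul[OF bounded_linear.linear[OF bounded_linear_scale_op]])
    with step show ?case using scale[of x c] by (simp add: scale_op_eq(1) span_add span_scale)
  qed (simp add: scale_op_eq span_zero)
  have adj': "adj a \<in> span G" if "a \<in> span G" for a
  proof -
    \<comment> \<open>Linearity is carried through the induction because additivity of
      \<open>adj\<close> is available for complex-linear operators.\<close>
    have "clinear_op a \<and> adj a \<in> span G"
      using that
    proof (induction rule: span_induct_alt)
      case (step r x y)
      have "adj (scale_op (of_real r) x + y) = scale_op (of_real r) (adj x) + adj y"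
        using step by (simp add: adj_add adj_scale G)
      then show ?case using step adj[of x] by (simp add: scale_op_eq(7) span_add span_scale G)
    qed (simp add: span_zero)
    then show ?thesis ..
  qed
  show ?thesis
    unfolding cstar_algebra_def
  proof (intro conjI ballI allI)
    show "0 \<in> closure (span G)" using closure_subset span_zero by blast
    fix a assume a: "a \<in> closure (span G)"
    show "clinear_op a" by (rule lin'[OF a])
    obtain X where X: "\<And>n. X n \<in> span G" "X \<longlonglongrightarrow> a" using a unfolding closure_sequential by blast
    show "scale_op c a \<in> closure (span G)" for c
      by (rule closure_sequentialI[OF scale'[OF X(1)] bounded_linear.tendsto[OF bounded_linear_scale_op X(2)]])
    have "(\<lambda>n. adj (X n)) \<longlonglongrightarrow> adj a"
    proof (rule LIM_zero_cancel, rule tendsto_norm_zero_cancel)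
      have "norm (adj (X n) - adj a) = norm (X n - a)" for n
        using lin[OF X(1)] lin'[OF a] by (simp add: norm_adj flip: adj_diff)
      then show "(\<lambda>n. norm (adj (X n) - adj a)) \<longlonglongrightarrow> 0"
        using X(2) by (simp add: LIM_zero tendsto_norm_zero)
    qed
    then show "adj a \<in> closure (span G)"
      by (rule closure_sequentialI[OF adj'[OF X(1)]])
    fix b assume b: "b \<in> closure (span G)"
    obtain Y where Y: "\<And>n. Y n \<in> span G" "Y \<longlonglongrightarrow> b" using b unfolding closure_sequential by blast
    show "a + b \<in> closure (span G)"
      by (rule closure_sequentialI[OF span_add[OF X(1) Y(1)] tendsto_add[OF X(2) Y(2)]])
    show "a o\<^sub>L b \<in> closure (span G)"
      by (rule closure_sequentialI[OF mult2[OF X(1) Y(1)] blinfun_compose.tendsto[OF X(2) Y(2)]])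
  qed simp
qed

section \<open>Tensor products of operators\<close>

lemma tensor_op_ket:
  "clinear_op S \<Longrightarrow> clinear_op T \<Longrightarrow> tensor_op S T (ket (i, j)) = tensor_ell2 (S (ket i)) (T (ket j))"
  by (metis tensor_op(2) tensor_ell2_ket)

lemma tensor_op_eqI:
  assumes "clinear_op R" "clinear_op S" "clinear_op T"
    and "\<And>i j. R (ket (i, j)) = tensor_ell2 (S (ket i)) (T (ket j))"
  shows "tensor_op S T = R"
proof (rule clinear_op_eqI)
  show "tensor_op S T (ket p) = R (ket p)" for p
    using assms by (cases p) (simp add: tensor_op_ket)
qed (simp_all add: assms tensor_op)

interpretation tensor_ell2: bounded_bilinear tensor_ell2
  by (rule bounded_bilinear_tensor_ell2)

lemma tensor_op_linear:
  assumes [simp]: "clinear_op S" "clinear_op S'" "clinear_op T"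
  shows "tensor_op (S + S') T = tensor_op S T + tensor_op S' T"
    "tensor_op (S - S') T = tensor_op S T - tensor_op S' T"
  by (rule tensor_op_eqI;
      simp add: tensor_op tensor_op_ket blinfun.add_left blinfun.diff_left tensor_ell2.add_left
        tensor_ell2.diff_left)+

lemma tensor_op_scale_left:
  assumes [simp]: "clinear_op S" "clinear_op T"
  shows "tensor_op (scale_op c S) T = scale_op c (tensor_op S T)"
  by (rule tensor_op_eqI; simp add: tensor_op tensor_op_ket scale_op_apply tensor_ell2_scale)

lemma tensor_op_compose:
  assumes [simp]: "clinear_op S" "clinear_op S'" "clinear_op T" "clinear_op T'"
  shows "tensor_op (S o\<^sub>L S') (T o\<^sub>L T') = tensor_op S T o\<^sub>L tensor_op S' T'"
  by (rule tensor_op_eqI; simp add: tensor_op tensor_op_ket)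

lemma adj_tensor_op:
  assumes [simp]: "clinear_op S" "clinear_op T"
  shows "adj (tensor_op S T) = tensor_op (adj S) (adj T)"
proof (rule sym, rule tensor_op_eqI)
  fix i j
  show "adj (tensor_op S T) (ket (i, j)) = tensor_ell2 (adj S (ket i)) (adj T (ket j))"
  proof (rule ell2_eqI)
    fix p
    show "coef (adj (tensor_op S T) (ket (i, j))) p = coef (tensor_ell2 (adj S (ket i)) (adj T (ket j))) p"
      by (cases p) (simp add: coef_adj tensor_op tensor_op_ket cinner_tensor_ell2 flip: tensor_ell2_ket)
  qed
qed (simp_all add: tensor_op)

lemma tensor_op_id_diag:
  assumes "\<And>j. j \<in> I \<Longrightarrow> cmod (g j) \<le> B" "0 \<le> B"
  shows "tensor_op id_blinfun (diag_op I g) = diag_op (UNIV \<times> I) (\<lambda>(i, j). g j)"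
proof (rule tensor_op_eqI)
  have *: "\<And>p. p \<in> UNIV \<times> I \<Longrightarrow> cmod (case p of (i, j) \<Rightarrow> g j) \<le> B" using assms by auto
  note d = diag_op[of I g B, OF assms] diag_op[of "UNIV \<times> I" "\<lambda>(i, j). g j" B, OF * assms(2)]
  show "clinear_op (diag_op (UNIV \<times> I) (\<lambda>(i, j). g j))" "clinear_op (diag_op I g)" by (simp_all add: d)
  show "diag_op (UNIV \<times> I) (\<lambda>(i, j). g j) (ket (i, j)) = tensor_ell2 (id_blinfun (ket i)) (diag_op I g (ket j))" for i j
    by (simp add: d tensor_ell2_scale tensor_ell2_ket tensor_ell2.zero_right)
qed simp

text \<open>The identity tensored with the functional of \<open>ket j\<close>; as an adjoint it
  comes with boundedness and complex linearity.\<close>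

definition slice_op :: "'b \<Rightarrow> (('a \<times> 'b) ell2 \<Rightarrow>\<^sub>L 'a ell2)"
  where "slice_op j = adj (Blinfun (\<lambda>v. tensor_ell2 v (ket j)))"

lemma slice_op:
  fixes u :: "('a \<times> 'b) ell2"
  shows "clinear_op (slice_op j :: ('a \<times> 'b) ell2 \<Rightarrow>\<^sub>L 'a ell2)" "coef (slice_op j u) i = coef u (i, j)"
proof -
  let ?T = "Blinfun (\<lambda>v. tensor_ell2 v (ket j)) :: 'a ell2 \<Rightarrow>\<^sub>L ('a \<times> 'b) ell2"
  have T: "?T v = tensor_ell2 v (ket j)" for v
    by (simp add: bounded_linear_Blinfun_apply tensor_ell2.bounded_linear_left)
  then have *: "clinear_op ?T" by (simp add: clinear_op_def tensor_ell2_scale)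
  then show "clinear_op (slice_op j :: ('a \<times> 'b) ell2 \<Rightarrow>\<^sub>L 'a ell2)" unfolding slice_op_def by simp
  show "coef (slice_op j u) i = coef u (i, j)"
    unfolding slice_op_def coef_adj[OF *] T tensor_ell2_ket by simp
qed

lemma norm_slices:
  fixes u :: "('a \<times> 'b) ell2"
  shows "((\<lambda>j. (norm (slice_op j u))\<^sup>2) has_sum (norm u)\<^sup>2) UNIV"
proof -
  let ?f = "\<lambda>i j. (cmod (coef u (i, j)))\<^sup>2"
  have s: "(\<lambda>(i, j). ?f i j) summable_on UNIV \<times> UNIV"
    using square_summable_coef[of u UNIV] by (simp add: case_prod_unfold)
  have slice: "(norm (slice_op j u))\<^sup>2 = (\<Sum>\<^sub>\<infinity>i. ?f i j)" for j
    unfolding norm_ell2_sq by (simp add: slice_op)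
  have "(norm u)\<^sup>2 = (\<Sum>\<^sub>\<infinity>i. \<Sum>\<^sub>\<infinity>j. ?f i j)"
    using infsum_Sigma'_banach[OF s] by (simp add: norm_ell2_sq case_prod_unfold)
  also have "\<dots> = (\<Sum>\<^sub>\<infinity>j. \<Sum>\<^sub>\<infinity>i. ?f i j)" by (rule infsum_swap_banach[OF s])
  finally have "(norm u)\<^sup>2 = (\<Sum>\<^sub>\<infinity>j. (norm (slice_op j u))\<^sup>2)" by (simp add: slice)
  moreover have "(\<lambda>j. (norm (slice_op j u))\<^sup>2) summable_on UNIV"
  proof -
    have "(\<lambda>(j, i). ?f i j) summable_on UNIV \<times> UNIV"
      using summable_on_swap[of "\<lambda>(i, j). ?f i j" UNIV UNIV] s by simp
    then have "(\<lambda>j. \<Sum>\<^sub>\<infinity>i. ?f i j) summable_on UNIV"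
      using summable_on_Sigma_banach[of "\<lambda>j i. ?f i j" UNIV "\<lambda>_. UNIV"] by simp
    then show ?thesis by (simp add: slice)
  qed
  ultimately show ?thesis by simp
qed

text \<open>The operator acts as \<open>S\<close> on every slice, and the squared norm of a vector
  is the sum over its slices, so the bound is checked slice by slice.\<close>

lemma norm_tensor_op_id_le:
  assumes S: "clinear_op S"
  shows "norm (tensor_op S (id_blinfun :: 'b ell2 \<Rightarrow>\<^sub>L 'b ell2)) \<le> norm S"
proof (rule norm_blinfun_bound)
  fix u :: "('a \<times> 'b) ell2"
  let ?R = "tensor_op S (id_blinfun :: 'b ell2 \<Rightarrow>\<^sub>L 'b ell2)"
  have "slice_op j o\<^sub>L ?R = S o\<^sub>L slice_op j" for j
  proof (rule clinear_op_eqI)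
    show "(slice_op j o\<^sub>L ?R) (ket p) = (S o\<^sub>L slice_op j) (ket p)" for p
    proof (cases p)
      case (Pair i k)
      have "slice_op j (tensor_ell2 v (ket k)) = (if k = j then v else 0)" for v :: "'a ell2"
        by (rule ell2_eqI) (auto simp: slice_op)
      moreover from this have "slice_op j (ket (i, k)) = (if k = j then ket i else 0)"
        unfolding tensor_ell2_ket[symmetric] .
      ultimately show ?thesis unfolding Pair by (simp add: tensor_op_ket S)
    qed
  qed (simp_all add: slice_op(1) S tensor_op(1))
  then have sl: "slice_op j (?R u) = S (slice_op j u)" for j
    by (metis blinfun_apply_blinfun_compose)
  have "(norm (?R u))\<^sup>2 \<le> (norm S)\<^sup>2 * (norm u)\<^sup>2"
  proof (rule has_sum_mono)
    show "((\<lambda>j. (norm (slice_op j (?R u)))\<^sup>2) has_sum (norm (?R u))\<^sup>2) UNIV" by (rule norm_slices)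
    show "((\<lambda>j. (norm S)\<^sup>2 * (norm (slice_op j u))\<^sup>2) has_sum (norm S)\<^sup>2 * (norm u)\<^sup>2) UNIV"
      by (rule has_sum_cmult_right[OF norm_slices])
    show "(norm (slice_op j (?R u)))\<^sup>2 \<le> (norm S)\<^sup>2 * (norm (slice_op j u))\<^sup>2" for j
      unfolding sl power_mult_distrib[symmetric] by (intro power_mono norm_blinfun) simp
  qed
  then have "(norm (?R u))\<^sup>2 \<le> (norm S * norm u)\<^sup>2" by (simp add: power_mult_distrib)
  then show "norm (?R u) \<le> norm S * norm u" by (rule power2_le_imp_le) simp
qed simp

lemma norm_tensor_diff_le:
  "clinear_op x \<Longrightarrow> clinear_op y \<Longrightarrow> norm (tensor_op x id_blinfun - tensor_op y id_blinfun) \<le> norm (x - y)"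
  using norm_tensor_op_id_le[of "x - y"] by (simp add: tensor_op_linear(2))

text \<open>Of \<open>B\<close> only linearity, products and adjoints are asked, so that the
  multiplication operators need not be shown to be norm closed; scalars are absorbed by the factor
  from \<open>A\<close>.\<close>

lemma cstar_algebra_tensor:
  assumes A: "cstar_algebra A"
    and B: "\<And>b. b \<in> B \<Longrightarrow> clinear_op b" "\<And>b b'. b \<in> B \<Longrightarrow> b' \<in> B \<Longrightarrow> b o\<^sub>L b' \<in> B"
      "\<And>b. b \<in> B \<Longrightarrow> adj b \<in> B"
  shows "cstar_algebra (cstar_tensor A B)"
  unfolding cstar_tensor_def
proof (rule cstar_algebra_closure_span)
  note A' = cstar_algebraD[OF A]
  let ?G = "{tensor_op a b |a b. a \<in> A \<and> b \<in> B}"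
  fix x assume "x \<in> ?G"
  then obtain a b where ab: "a \<in> A" "b \<in> B" "x = tensor_op a b" by blast
  show "clinear_op x" using ab A' B by (simp add: tensor_op)
  show "scale_op c x \<in> span ?G" for c
    using ab A' B by (intro span_base) (metis (mono_tags, lifting) mem_Collect_eq tensor_op_scale_left)
  show "adj x \<in> span ?G"
    using ab A' B by (intro span_base) (metis (mono_tags, lifting) mem_Collect_eq adj_tensor_op)
  fix y assume "y \<in> ?G"
  then obtain a' b' where ab': "a' \<in> A" "b' \<in> B" "y = tensor_op a' b'" by blast
  have "x o\<^sub>L y = tensor_op (a o\<^sub>L a') (b o\<^sub>L b')" using ab ab' A' B by (simp add: tensor_op_compose)
  moreover have "a o\<^sub>L a' \<in> A" "b o\<^sub>L b' \<in> B" using ab ab' A'(4) B(2) by simp_all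
  ultimately show "x o\<^sub>L y \<in> span ?G" by (intro span_base) auto
qed

section \<open>The Serre shift\<close>

text \<open>Division with remainder: the children of the vertex \<open>(m, x)\<close> are the
  numbers \<open>x + j * s ^ m\<close>, and \<open>y\<close> is one of them exactly when its top
  digit \<open>y div s ^ m\<close> lies in the range of \<open>j\<close> and the lower digits form
  \<open>x\<close>. This turns the sum in the definition of \<open>W\<close> into a lookup of the
  predecessor.\<close>

lemma int_digit_sum:
  fixes s x y :: int
  assumes s: "s \<ge> 2" and x: "0 \<le> x" "x < s ^ m"
  shows "(\<Sum>j\<in>{0..<s}. if x + j * s ^ m = y then c else 0) =
    (if 0 \<le> y \<and> y < s ^ Suc m \<and> y mod s ^ m = x then c else (0 :: complex))"
proof -
  have pos: "0 < s ^ m" using s by simp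
  have "x + j * s ^ m = y \<longleftrightarrow> j = y div s ^ m \<and> y mod s ^ m = x" for j
  proof
    assume "x + j * s ^ m = y"
    then have "y = x + j * s ^ m" by simp
    moreover have "s ^ m \<noteq> 0" using pos by linarith
    ultimately show "j = y div s ^ m \<and> y mod s ^ m = x"
      using div_mult_self1[of "s ^ m" x j] div_pos_pos_trivial[OF x] mod_pos_pos_trivial[OF x] by simp
  next
    assume "j = y div s ^ m \<and> y mod s ^ m = x"
    then show "x + j * s ^ m = y" using div_mult_mod_eq[of y "s ^ m"] by simp
  qed
  then have "(\<Sum>j\<in>{0..<s}. if x + j * s ^ m = y then c else 0)
      = (\<Sum>j\<in>{0..<s}. if y div s ^ m = j then (if y mod s ^ m = x then c else 0) else 0)"
    by (intro sum.cong) auto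
  also have "\<dots> = (if y div s ^ m \<in> {0..<s} then (if y mod s ^ m = x then c else 0) else 0)"
    by (simp add: sum.delta)
  also have "y div s ^ m \<in> {0..<s} \<longleftrightarrow> 0 \<le> y \<and> y < s ^ Suc m"
  proof -
    have r: "y = y div s ^ m * s ^ m + y mod s ^ m" "0 \<le> y mod s ^ m" "y mod s ^ m < s ^ m"
      using pos pos_mod_bound[OF pos, of y] pos_mod_sign[OF pos, of y] div_mult_mod_eq[of y "s ^ m"] by linarith+
    have "y div s ^ m < s \<longleftrightarrow> y < s * s ^ m"
    proof
      assume "y div s ^ m < s"
      then have "y div s ^ m * s ^ m \<le> (s - 1) * s ^ m" using pos by (intro mult_right_mono) auto
      then have "y div s ^ m * s ^ m \<le> s * s ^ m - s ^ m" by (simp add: algebra_simps)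
      then show "y < s * s ^ m" using r by linarith
    next
      assume *: "y < s * s ^ m"
      show "y div s ^ m < s"
      proof (rule ccontr)
        assume "\<not> y div s ^ m < s"
        then have "s * s ^ m \<le> y div s ^ m * s ^ m" using pos by (intro mult_right_mono) auto
        then show False using r * by linarith
      qed
    qed
    then show ?thesis using pos by (simp add: pos_imp_zdiv_nonneg_iff)
  qed
  finally show ?thesis by auto
qed

locale serre =
  fixes s :: int
  assumes s: "s \<ge> 2"
begin

abbreviation "V \<equiv> vertices s"
abbreviation "Z \<equiv> sadic_ints s"
abbreviation "W \<equiv> serre_shift s"
abbreviation "E \<equiv> proj V"
abbreviation "\<kappa> \<equiv> complex_of_real (1 / sqrt (of_int s))"

lemma pow_pos [simp]: "0 < s ^ n"
  using s by simp

lemma kappa [simp]: "\<kappa> \<noteq> 0" "cnj \<kappa> = \<kappa>" "\<kappa> * \<kappa> * of_int s = 1"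
proof -
  show "\<kappa> \<noteq> 0" using s by simp
  have "\<kappa> * \<kappa> * of_int s = of_real ((1 / sqrt (real_of_int s)) * (1 / sqrt (real_of_int s)) * real_of_int s)"
    by (simp only: of_real_mult of_real_of_int_eq)
  also have "(1 / sqrt (real_of_int s)) * (1 / sqrt (real_of_int s)) * real_of_int s = 1"
    using s by (simp add: field_simps)
  finally show "\<kappa> * \<kappa> * of_int s = 1" by simp
qed simp

lemma vertices_iff: "(n, x) \<in> V \<longleftrightarrow> 0 \<le> x \<and> x < s ^ n"
  by (simp add: vertices_def)

lemma vertices_mod [simp]: "(n, y mod s ^ n) \<in> V"
  by (simp add: vertices_iff)

lemma clinear_shift [simp]: "clinear_op W"
  by (rule serre_shift[OF s])

text \<open>In coordinates \<open>W\<close> copies to each vertex the value at its predecessor,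
  which is obtained by deleting the top digit. The guard \<open>0 < n\<close> matters because
  \<open>n - 1\<close> is truncated: the root would otherwise be its own predecessor.\<close>

lemma coef_shift:
  "coef (W v) (n, y) = (if (n, y) \<in> V \<and> 0 < n then \<kappa> * coef v (n - 1, y mod s ^ (n - 1)) else 0)"
proof -
  let ?d = "if (n, y) \<in> V \<and> 0 < n then \<kappa> else 0"
  have "cinner (ket (n, y)) (W v) = ?d * cinner (ket (n - 1, y mod s ^ (n - 1))) v"
  proof (rule bounded_linear_ell2_eqI)
    show "bounded_linear (\<lambda>v. cinner (ket (n, y)) (W v))"
      by (rule bounded_linear_compose[OF bounded_linear_cinner_right blinfun.bounded_linear_right])
    show "bounded_linear (\<lambda>v. ?d * cinner (ket (n - 1, y mod s ^ (n - 1))) v)"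
      by (rule bounded_linear_compose[OF bounded_linear_mult_right bounded_linear_cinner_right])
    fix c and p :: "nat \<times> int"
    obtain m x where p: "p = (m, x)" by fastforce
    have "coef (W (ket p)) (n, y) = ?d * coef (ket p) (n - 1, y mod s ^ (n - 1))"
    proof (cases "(m, x) \<in> V")
      case True
      then have x: "0 \<le> x" "x < s ^ m" by (auto simp: vertices_iff)
      have "coef (W (ket p)) (n, y) = \<kappa> * (\<Sum>j\<in>{0..<s}. if x + j * s ^ m = y then (if n = m + 1 then 1 else 0) else 0)"
        unfolding p serre_shift(2)[OF s True] by (auto intro!: sum.cong)
      also have "\<dots> = ?d * coef (ket p) (n - 1, y mod s ^ (n - 1))"
        unfolding int_digit_sum[OF s x] p by (cases n) (auto simp: vertices_iff)
      finally show ?thesis .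
    next
      case False
      then have "(m, x) \<noteq> (n - 1, y mod s ^ (n - 1))" by (metis vertices_mod)
      then show ?thesis unfolding p serre_shift(3)[OF s False] by auto
    qed
    then show "cinner (ket (n, y)) (W (c *\<^sub>C ket p)) = ?d * cinner (ket (n - 1, y mod s ^ (n - 1))) (c *\<^sub>C ket p)"
      by (simp add: clinear_op_scale)
  qed
  then show ?thesis by simp
qed

lemma adj_shift_ket:
  "adj W (ket (n, y)) = (if (n, y) \<in> V \<and> 0 < n then \<kappa> *\<^sub>C ket (n - 1, y mod s ^ (n - 1)) else 0)"
  by (rule ell2_eqI) (auto simp: coef_adj cinner_ket_right coef_shift)

lemma coef_adj_shift:
  "coef (adj W v) (n, x) = (if (n, x) \<in> V then \<kappa> * (\<Sum>j\<in>{0..<s}. coef v (n + 1, x + j * s ^ n)) else 0)"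
  by (simp add: coef_adj serre_shift[OF s] cinner_scale_left cinner_sum_left)

text \<open>Each vertex has \<open>s\<close> children of squared weight \<open>1 / s\<close>. On the
  space of all index pairs this gives \<open>E\<close> and not the identity, since \<open>W\<close>
  vanishes outside \<open>V\<close>.\<close>

lemma shift_isometry: "adj W o\<^sub>L W = E"
proof (intro blinfun_eqI ell2_eqI)
  fix v and p :: "nat \<times> int"
  obtain n x where p: "p = (n, x)" by fastforce
  show "coef ((adj W o\<^sub>L W) v) p = coef (E v) p"
  proof (cases "(n, x) \<in> V")
    case True
    then have x: "0 \<le> x" "x < s ^ n" by (auto simp: vertices_iff)
    have "coef (W v) (n + 1, x + j * s ^ n) = \<kappa> * coef v (n, x)" if "j \<in> {0..<s}" for j
    proof -
      have "x + j * s ^ n < s ^ n + (s - 1) * s ^ n"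
        using that x by (intro add_less_le_mono mult_right_mono) auto
      also have "\<dots> = s ^ (n + 1)" by (simp add: algebra_simps)
      finally have "(n + 1, x + j * s ^ n) \<in> V" using that x by (simp add: vertices_iff)
      then show ?thesis using x by (simp add: coef_shift)
    qed
    then have "coef ((adj W o\<^sub>L W) v) p = \<kappa> * (\<Sum>j\<in>{0..<s}. \<kappa> * coef v (n, x))"
      using True by (simp add: p coef_adj_shift)
    also have "\<dots> = (\<kappa> * \<kappa> * of_int s) * coef v (n, x)" using s by simp
    finally show ?thesis using True unfolding kappa by (simp add: p)
  qed (simp add: p coef_adj_shift)
qed

lemma proj_shift [simp]: "E o\<^sub>L W = W" "W o\<^sub>L E = W"
  by (auto intro!: blinfun_eqI ell2_eqI simp: coef_shift)

lemma sadic_of_int_apply [simp]: "sadic_of_int s x m = x mod s ^ m"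
  by (simp add: sadic_of_int_def)

lemma sadic_of_int_in [simp]: "sadic_of_int s x \<in> Z"
  by (rule Defs.sadic_of_int_in[OF s])

lemma sadic_mod: "a \<in> Z \<Longrightarrow> m \<le> n \<Longrightarrow> a n mod s ^ m = a m"
  by (simp add: sadic_ints_def)

lemma sadic_range: "a \<in> Z \<Longrightarrow> 0 \<le> a m \<and> a m < s ^ m"
  by (simp add: sadic_ints_def)

lemma sadic_bounded:
  assumes "continuous_on Z (f :: (nat \<Rightarrow> int) \<Rightarrow> complex)"
  obtains B where "0 \<le> B" "\<And>a. a \<in> Z \<Longrightarrow> cmod (f a) \<le> B"
proof -
  have "bounded (f ` Z)"
    by (intro compact_imp_bounded compact_continuous_image assms compact_sadic_ints)
  then show ?thesis using that by (auto simp: bounded_pos intro: less_imp_le)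
qed

lemma coef_mult:
  assumes "continuous_on Z f"
  shows "coef (serre_mult s f v) (n, x) = (if (n, x) \<in> V then f (sadic_of_int s x) * coef v (n, x) else 0)"
proof -
  obtain B where "\<And>a. a \<in> Z \<Longrightarrow> cmod (f a) \<le> B" using sadic_bounded[OF assms] by metis
  then have "\<And>p. p \<in> V \<Longrightarrow> cmod (case p of (n, x) \<Rightarrow> f (sadic_of_int s x)) \<le> B" by auto
  from coef_diag_op[of V "\<lambda>(n, x). f (sadic_of_int s x)", OF this] show ?thesis by (simp add: serre_mult_def)
qed

lemma clinear_mult [simp]: "continuous_on Z f \<Longrightarrow> clinear_op (serre_mult s f)"
  by (rule serre_mult[OF s])

lemma adj_mult:
  assumes "continuous_on Z f"
  shows "adj (serre_mult s f) = serre_mult s (\<lambda>a. cnj (f a))"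
proof -
  obtain B where "\<And>a. a \<in> Z \<Longrightarrow> cmod (f a) \<le> B" using sadic_bounded[OF assms] by metis
  then have "\<And>p. p \<in> V \<Longrightarrow> cmod (case p of (n, x) \<Rightarrow> f (sadic_of_int s x)) \<le> B" by auto
  from adj_diag_op[of V "\<lambda>(n, x). f (sadic_of_int s x)", OF this] show ?thesis by (simp add: serre_mult_def case_prod_unfold)
qed

lemma norm_mult_diff_le:
  assumes f: "continuous_on Z f" and g: "continuous_on Z g"
    and le: "\<And>a. a \<in> Z \<Longrightarrow> cmod (f a - g a) \<le> e" and e: "0 \<le> e"
  shows "norm (serre_mult s f - serre_mult s g) \<le> e"
proof -
  let ?d = "\<lambda>(n :: nat, x). f (sadic_of_int s x) - g (sadic_of_int s x)"
  have d: "\<And>p. p \<in> V \<Longrightarrow> cmod (?d p) \<le> e" using le by auto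
  have "serre_mult s f - serre_mult s g = diag_op V ?d"
    by (auto intro!: blinfun_eqI ell2_eqI
        simp: blinfun.diff_left coef_mult[OF f] coef_mult[OF g] coef_diag_op[of V ?d, OF d] left_diff_distrib)
  then show ?thesis using diag_op(3)[of V ?d, OF d e] by simp
qed

lemma proj_mult [simp]:
  assumes "continuous_on Z f"
  shows "E o\<^sub>L serre_mult s f = serre_mult s f" "serre_mult s f o\<^sub>L E = serre_mult s f"
  by (auto intro!: blinfun_eqI ell2_eqI simp: coef_mult[OF assms])

section \<open>Locally constant functions on the s-adic integers\<close>

definition locally_const :: "nat \<Rightarrow> ((nat \<Rightarrow> int) \<Rightarrow> complex) \<Rightarrow> bool"
  where "locally_const m f \<longleftrightarrow> (\<forall>a\<in>Z. \<forall>b\<in>Z. a m = b m \<longrightarrow> f a = f b)"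

lemma locally_const_eq:
  assumes "locally_const m f" "a \<in> Z" "m \<le> n"
  shows "f (sadic_of_int s (a n)) = f a"
proof -
  have "sadic_of_int s (a n) m = a m" using sadic_mod[OF assms(2,3)] by simp
  then show ?thesis using assms(1,2) sadic_of_int_in unfolding locally_const_def by blast
qed

lemma locally_const_mod:
  assumes "locally_const m f" "m \<le> n"
  shows "f (sadic_of_int s (x mod s ^ n)) = f (sadic_of_int s x)"
  using locally_const_eq[OF assms(1) sadic_of_int_in assms(2), of x] by simp

lemma locally_const_continuous:
  assumes "locally_const m f"
  shows "continuous_on Z f"
proof -
  have "continuous_on Z (\<lambda>a. f (sadic_of_int s (a m)))"
    by (rule continuous_on_compose2[where g = "\<lambda>k. f (sadic_of_int s k)" and t = UNIV])
      (auto intro: continuous_on_subset[OF continuous_on_product_coordinates] continuous_on_discrete)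
  then show ?thesis
    using locally_const_eq[OF assms _ order_refl] by (metis (no_types, lifting) continuous_on_eq)
qed

lemma locally_const_approx: "locally_const m (\<lambda>a. f (sadic_of_int s (a m)))"
  by (simp add: locally_const_def)

text \<open>Locally constant functions are uniformly dense. A basic open set of the product topology
  restricts finitely many coordinates, and for s-adic integers the last of these determines the
  others; compactness then gives one level \<open>m\<close> for all points.\<close>

lemma sadic_uniform:
  assumes f: "continuous_on Z (f :: (nat \<Rightarrow> int) \<Rightarrow> complex)" and e: "0 < e"
  obtains m where "\<And>a. a \<in> Z \<Longrightarrow> cmod (f (sadic_of_int s (a m)) - f a) \<le> e"
proof -
  have "\<exists>n. \<forall>b\<in>Z. b n = a n \<longrightarrow> dist (f b) (f a) < e / 2" if a: "a \<in> Z" for a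
  proof -
    have "f a \<in> ball (f a) (e / 2)" using e by simp
    with f a obtain U where U: "open U" "a \<in> U" "\<And>b. b \<in> Z \<Longrightarrow> b \<in> U \<Longrightarrow> f b \<in> ball (f a) (e / 2)"
      unfolding continuous_on_topological using open_ball by metis
    have "openin (product_topology (\<lambda>_. euclidean) UNIV) U"
      using U(1) by (simp add: euclidean_product_topology)
    from product_topology_open_contains_basis[OF this U(2)]
    obtain X where X: "a \<in> (\<Pi>\<^sub>E i\<in>UNIV. X i)" "finite {i. X i \<noteq> UNIV}" "(\<Pi>\<^sub>E i\<in>UNIV. X i) \<subseteq> U"
      by auto
    \<comment> \<open>If no coordinate is restricted, this is \<open>Max\<close> of the empty set,
      but then its value does not matter: the case of a restricted coordinate below does not
      arise.\<close>
    define n where "n = Max {i. X i \<noteq> UNIV}"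
    have "dist (f b) (f a) < e / 2" if b: "b \<in> Z" "b n = a n" for b
    proof -
      have "b i \<in> X i" for i
      proof (cases "X i = UNIV")
        case False
        then have "i \<le> n" unfolding n_def using X(2) by (intro Max_ge) auto
        then have "b i = a i" using sadic_mod[OF a] sadic_mod[OF b(1)] b(2) by metis
        then show ?thesis using X(1) by auto
      qed simp
      then have "b \<in> U" using X(3) by auto
      then show ?thesis using U(3)[OF b(1)] by (simp add: dist_commute)
    qed
    then show ?thesis by blast
  qed
  then obtain n where n: "\<And>a b. a \<in> Z \<Longrightarrow> b \<in> Z \<Longrightarrow> b (n a) = a (n a) \<Longrightarrow> dist (f b) (f a) < e / 2" by metis
  have "open {b :: nat \<Rightarrow> int. b k = c}" for k c
    using open_vimage[OF open_discrete[of "{c}"] continuous_on_product_coordinates[of k]]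
    by (simp add: vimage_def)
  then have op: "\<And>a. a \<in> Z \<Longrightarrow> open {b :: nat \<Rightarrow> int. b (n a) = a (n a)}" by blast
  have cov: "Z \<subseteq> (\<Union>a\<in>Z. {b. b (n a) = a (n a)})" by auto
  obtain C where C: "C \<subseteq> Z" "finite C" "Z \<subseteq> (\<Union>a\<in>C. {b. b (n a) = a (n a)})"
    by (rule compactE_image[OF compact_sadic_ints op cov])
  define m where "m = Max (n ` C)"
  have "cmod (f (sadic_of_int s (b m)) - f b) \<le> e" if b: "b \<in> Z" for b
  proof -
    obtain a where a: "a \<in> C" "b (n a) = a (n a)" using C b by auto
    have "n a \<le> m" unfolding m_def using C a by simp
    then have "sadic_of_int s (b m) (n a) = a (n a)" using sadic_mod[OF b] a by simp
    then have "dist (f (sadic_of_int s (b m))) (f a) < e / 2" "dist (f b) (f a) < e / 2"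
      using n[of a] a b C sadic_of_int_in by blast+
    then show ?thesis using dist_triangle2[of "f (sadic_of_int s (b m))" "f b" "f a"] by (simp add: dist_norm)
  qed
  then show ?thesis by (rule that)
qed

subsection \<open>The compact operators in the algebra\<close>

lemma cstar_serre: "cstar_algebra (serre_algebra s)"
  unfolding serre_algebra_def by (rule cstar_generated) auto

lemma shift_in: "W \<in> serre_algebra s"
  unfolding serre_algebra_def by (rule subsetD[OF cstar_generated_subset]) simp

lemma mult_in: "continuous_on Z f \<Longrightarrow> serre_mult s f \<in> serre_algebra s"
  unfolding serre_algebra_def by (rule subsetD[OF cstar_generated_subset]) auto

definition matunit :: "nat \<times> int \<Rightarrow> nat \<times> int \<Rightarrow> (nat \<times> int) ell2 \<Rightarrow>\<^sub>L (nat \<times> int) ell2"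
  where "matunit p q = op_of_basis (\<lambda>i. if i = q then ket p else 0)"

lemma matunit: "clinear_op (matunit p q)" "matunit p q v = coef v q *\<^sub>C ket p"
proof -
  let ?F = "\<lambda>i. if i = q then ket p else 0"
  have F: "cinner (?F i) (?F j) = 0" if "i \<noteq> j" for i j using that by auto
  have B: "norm (?F i) \<le> 1" for i by simp
  note * = op_of_basis_orthogonal[of ?F 1, OF F B zero_le_one]
  show "clinear_op (matunit p q)" unfolding matunit_def by (rule *)
  show "matunit p q v = coef v q *\<^sub>C ket p"
  proof (rule bounded_linear_ell2_eqI[where f = "blinfun_apply (matunit p q)" and g = "\<lambda>v. coef v q *\<^sub>C ket p"])
    show "bounded_linear (\<lambda>v :: (nat \<times> int) ell2. coef v q *\<^sub>C ket p)"
      using bounded_linear_compose[OF bounded_linear_scale_left bounded_linear_cinner_right, of "ket q" "ket p"] by simp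
    show "matunit p q (c *\<^sub>C ket i) = coef (c *\<^sub>C ket i) q *\<^sub>C ket p" for c i
      using * by (auto simp: matunit_def clinear_op_scale)
  qed (rule blinfun.bounded_linear_right)
qed

lemma adj_matunit: "adj (matunit p q) = matunit q p"
  by (intro blinfun_eqI ell2_eqI) (simp add: coef_adj matunit cinner_scale_left)

text \<open>Outside the root, \<open>W\<close> preserves residues modulo \<open>s\<close>, so compressing it between the functions
  supported on two different residue classes leaves an operator of rank one.\<close>

lemma matunit_root_in: "p \<in> V \<Longrightarrow> matunit p (0, 0) \<in> serre_algebra s"
proof (induction p)
  case (Pair n x)
  note A = cstar_algebraD[OF cstar_serre]
  define ind where "ind k c a = (if a k = c then 1 else 0 :: complex)" for k :: nat and c :: int and a :: "nat \<Rightarrow> int"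
  have ind: "continuous_on Z (ind k c)" for k c
    by (rule locally_const_continuous[of k]) (simp add: locally_const_def ind_def)
  have unscale: "T \<in> serre_algebra s" if "scale_op c T \<in> serre_algebra s" "c \<noteq> 0" for c T
  proof -
    have "scale_op (1 / c) (scale_op c T) = T"
      using that(2) by (auto intro!: blinfun_eqI simp: scale_op_apply)
    then show ?thesis using A(5)[OF that(1), of "1 / c"] by simp
  qed
  have s1: "s \<noteq> 1" "s \<noteq> 0" "0 < s" "1 mod s = 1" using s by auto
  from Pair show ?case
  proof (induction n arbitrary: x)
    case 0
    then have [simp]: "x = 0" by (simp add: vertices_iff)
    have "(serre_mult s (ind 1 1) o\<^sub>L W o\<^sub>L serre_mult s (ind 1 0)) = scale_op \<kappa> (matunit (1, 1) (0, 0))"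
    proof (intro blinfun_eqI ell2_eqI)
      fix v and p :: "nat \<times> int"
      obtain n y where p: "p = (n, y)" by fastforce
      consider "n = 0" | "n = 1" | k where "n = Suc (Suc k)" by (metis One_nat_def nat.exhaust)
      then show "coef ((serre_mult s (ind 1 1) o\<^sub>L W o\<^sub>L serre_mult s (ind 1 0)) v) p = coef (scale_op \<kappa> (matunit (1, 1) (0, 0)) v) p"
      proof cases
        case 1
        then show ?thesis by (simp add: p coef_mult[OF ind] coef_shift scale_op_apply matunit)
      next
        case 2
        then show ?thesis using s1
          by (auto simp: p coef_mult[OF ind] coef_shift scale_op_apply matunit ind_def vertices_iff)
      next
        case 3
        have "y mod s ^ Suc k mod s = y mod s"
          by (rule mod_mod_cancel) simp
        then show ?thesis using 3
          by (auto simp: p coef_mult[OF ind] coef_shift scale_op_apply matunit ind_def)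
      qed
    qed
    then have "scale_op \<kappa> (matunit (1, 1) (0, 0)) \<in> serre_algebra s"
      by (metis A(4) mult_in[OF ind] shift_in)
    \<comment> \<open>The adjoint of \<open>W\<close> leads from \<open>(1, 1)\<close> back to the
      root and so yields the projection onto the root.\<close>
    then have "adj W o\<^sub>L matunit (1, 1) (0, 0) \<in> serre_algebra s"
      by (rule A(4)[OF A(6)[OF shift_in] unscale[OF _ kappa(1)]])
    also have "adj W o\<^sub>L matunit (1, 1) (0, 0) = scale_op \<kappa> (matunit (0, 0) (0, 0))"
      using s by (auto intro!: blinfun_eqI simp: matunit scale_op_apply clinear_op_scale adj_shift_ket vertices_iff mult.commute)
    finally have "matunit (0, 0) (0, 0) \<in> serre_algebra s" by (rule unscale[OF _ kappa(1)])
    then show ?case by simp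
  next
    case (Suc n y)
    \<comment> \<open>Climbing one level: \<open>W\<close> spreads the predecessor of
      \<open>(Suc n, y)\<close> over all its children, and the indicator of the residue
      \<open>y\<close> modulo \<open>s ^ Suc n\<close> selects one of them.\<close>
    have "(serre_mult s (ind (Suc n) y) o\<^sub>L W o\<^sub>L matunit (n, y mod s ^ n) (0, 0)) = scale_op \<kappa> (matunit (Suc n, y) (0, 0))"
    proof (intro blinfun_eqI ell2_eqI)
      fix v and p :: "nat \<times> int"
      obtain k z where p: "p = (k, z)" by fastforce
      show "coef ((serre_mult s (ind (Suc n) y) o\<^sub>L W o\<^sub>L matunit (n, y mod s ^ n) (0, 0)) v) p = coef (scale_op \<kappa> (matunit (Suc n, y) (0, 0)) v) p"
        using Suc.prems
        by (cases k) (auto simp: p coef_mult[OF ind] coef_shift scale_op_apply matunit ind_def vertices_iff)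
    qed
    moreover have "matunit (n, y mod s ^ n) (0, 0) \<in> serre_algebra s" by (rule Suc.IH) simp
    ultimately have "scale_op \<kappa> (matunit (Suc n, y) (0, 0)) \<in> serre_algebra s"
      by (metis A(4) mult_in[OF ind] shift_in)
    then show ?case by (rule unscale[OF _ kappa(1)])
  qed
qed

lemma matunit_in:
  assumes "p \<in> V" "q \<in> V"
  shows "matunit p q \<in> serre_algebra s"
proof -
  have "matunit p q = matunit p (0, 0) o\<^sub>L adj (matunit q (0, 0))"
    by (auto intro!: blinfun_eqI simp: adj_matunit matunit)
  then show ?thesis
    using cstar_algebraD(4,6)[OF cstar_serre] matunit_root_in assms by metis
qed

text \<open>Cutting \<open>T\<close> off on both sides leaves a finite combination of matrix units,
  and such combinations approximate \<open>T\<close> in norm.\<close>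

lemma compact_in:
  assumes T: "compact_op T" and ET: "E o\<^sub>L T = T" "T o\<^sub>L E = T"
  shows "T \<in> serre_algebra s"
proof -
  note A = cstar_algebraD[OF cstar_serre]
  have "T \<in> closure (serre_algebra s)"
    unfolding closure_approachable
  proof (intro allI impI)
    fix e :: real assume e: "0 < e"
    obtain F where F: "finite F" "norm (T - (proj F o\<^sub>L T)) \<le> e / 3"
      using compact_op_approx[OF T, of "e / 3"] e by auto
    obtain G where G: "finite G" "norm (T - (T o\<^sub>L proj G)) \<le> e / 3"
      using compact_op_approx_right[OF T, of "e / 3"] e by auto
    define X where "X = (\<Sum>p\<in>F. \<Sum>q\<in>G. scale_op (coef (T (ket q)) p) (matunit p q))"
    \<comment> \<open>Only matrix units between vertices are known to lie in the algebra; the others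
      enter \<open>X\<close> with coefficient 0.\<close>
    have zero: "coef (T (ket q)) p = 0" if "p \<notin> V \<or> q \<notin> V" for p q
    proof -
      have "T (ket q) = E (T (E (ket q)))" using ET by (metis blinfun_apply_blinfun_compose)
      then show ?thesis using that by (auto simp: proj(4,5))
    qed
    have "scale_op (coef (T (ket q)) p) (matunit p q) \<in> serre_algebra s" for p q
    proof (cases "p \<in> V \<and> q \<in> V")
      case True then show ?thesis using A(5) matunit_in by blast
    next
      case False
      then have "scale_op (coef (T (ket q)) p) (matunit p q) = 0"
        using zero[of p q] by (auto intro!: blinfun_eqI simp: scale_op_apply)
      then show ?thesis using A(2) by simp
    qed
    then have "X \<in> serre_algebra s"
      unfolding X_def by (intro subspace_sum[OF A(10)])
    moreover have "X = proj F o\<^sub>L T o\<^sub>L proj G"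
    proof (rule clinear_op_eqI)
      show "clinear_op X" unfolding X_def by (intro clinear_op_sum clinear_op_intros matunit)
      show "clinear_op (proj F o\<^sub>L T o\<^sub>L proj G)" using T by simp
      fix q
      show "X (ket q) = (proj F o\<^sub>L T o\<^sub>L proj G) (ket q)"
      proof (rule ell2_eqI)
        fix r
        have "coef (X (ket q)) r = (\<Sum>p\<in>F. \<Sum>q'\<in>G. if p = r then if q = q' then coef (T (ket q')) p else 0 else 0)"
          unfolding X_def by (auto simp: blinfun.sum_left scale_op_apply matunit intro!: sum.cong)
        also have "\<dots> = (\<Sum>p\<in>F. if p = r then \<Sum>q'\<in>G. if q = q' then coef (T (ket q')) p else 0 else 0)"
          by (intro sum.cong) auto
        also have "\<dots> = coef ((proj F o\<^sub>L T o\<^sub>L proj G) (ket q)) r"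
          using F(1) G(1) by simp
        finally show "coef (X (ket q)) r = coef ((proj F o\<^sub>L T o\<^sub>L proj G) (ket q)) r" .
      qed
    qed
    moreover have "norm (T - (proj F o\<^sub>L T o\<^sub>L proj G)) \<le> e / 3 + e / 3"
    proof -
      have "T - (proj F o\<^sub>L T o\<^sub>L proj G) = (T - (proj F o\<^sub>L T)) + (proj F o\<^sub>L (T - (T o\<^sub>L proj G)))"
        by (auto intro!: blinfun_eqI simp: blinfun.diff_left blinfun.add_left blinfun.diff_right blinfun.minus_left)
      also have "norm \<dots> \<le> e / 3 + e / 3"
        by (rule norm_triangle_mono[OF F(2) order_trans[OF norm_proj_compose_le G(2)]])
      finally show ?thesis .
    qed
    ultimately show "\<exists>y\<in>serre_algebra s. dist y T < e"
      using e by (intro bexI[of _ X]) (auto simp: dist_norm norm_minus_commute)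
  qed
  then show ?thesis using A(7) by (simp add: closure_closed)
qed

text \<open>The ambient space has more coordinates than the vertices. That \<open>E\<close> is a
  two-sided unit describes the operators on the vertices alone, and this condition is preserved by
  all algebraic operations and by limits.\<close>

lemma serre_algebra_corner:
  assumes "a \<in> serre_algebra s"
  shows "clinear_op a" "E o\<^sub>L a = a" "a o\<^sub>L E = a"
proof -
  let ?C = "{a. clinear_op a \<and> E o\<^sub>L a = a \<and> a o\<^sub>L E = a}"
  have "cstar_algebra ?C"
    unfolding cstar_algebra_def
  proof (intro conjI ballI allI)
    fix a assume a: "a \<in> ?C"
    then show "clinear_op a" by simp
    show "scale_op c a \<in> ?C" for c using a by (auto simp: scale_op_eq)
    have "E o\<^sub>L adj a = adj (a o\<^sub>L E)" "adj a o\<^sub>L E = adj (E o\<^sub>L a)"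
      using adj_compose[of a E] adj_compose[of E a] a by simp_all
    then show "adj a \<in> ?C" using a by auto
    fix b assume b: "b \<in> ?C"
    show "a + b \<in> ?C" using a b by (auto simp: blinfun_compose.add_left blinfun_compose.add_right)
    show "a o\<^sub>L b \<in> ?C" using a b by (auto simp: blinfun_compose_assoc) (metis blinfun_compose_assoc)
  next
    have "closed ({a. clinear_op a} \<inter> {a. E o\<^sub>L a = a} \<inter> {a. a o\<^sub>L E = a})"
      by (intro closed_Int closed_clinear_op closed_Collect_eq continuous_intros)
    then show "closed ?C" by (simp add: Collect_conj_eq Int_assoc)
  qed auto
  then have "serre_algebra s \<subseteq> ?C"
    unfolding serre_algebra_def by (rule cstar_generated_minimal) auto
  then show "clinear_op a" "E o\<^sub>L a = a" "a o\<^sub>L E = a" using assms by auto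
qed

end

section \<open>Two families of intertwiners\<close>

abbreviation toeplitz_gen :: "nat ell2 \<Rightarrow>\<^sub>L nat ell2"
  where "toeplitz_gen \<equiv> op_of_basis (\<lambda>n. ket (Suc n))"

declare toeplitz_shift [simp]

lemma adj_toeplitz_ket: "adj toeplitz_gen (ket n) = (if n = 0 then 0 else ket (n - 1))"
  by (rule ell2_eqI) (auto simp: coef_adj)

lemma toeplitz_isometry: "adj toeplitz_gen o\<^sub>L toeplitz_gen = id_blinfun"
  by (rule clinear_op_eqI) (auto simp: adj_toeplitz_ket)

context serre
begin

subsection \<open>Copies of the unilateral shift deep in the tree\<close>

text \<open>Support in the part of the tree beyond the vertex \<open>(N, x)\<close>. The residue
  condition makes multiplication operators nearly scalar there, and the strict bound
  \<open>N < k\<close> makes such vectors escape every finite set of vertices as \<open>N\<close>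
  grows.\<close>

definition near :: "nat \<Rightarrow> int \<Rightarrow> (nat \<times> int) ell2 \<Rightarrow> bool"
  where "near N x v \<longleftrightarrow> (\<forall>k y. coef v (k, y) \<noteq> 0 \<longrightarrow> (k, y) \<in> V \<and> N < k \<and> y mod s ^ N = x)"

lemma near_shift:
  assumes "near N x v"
  shows "near N x (W v)"
  unfolding near_def
proof (intro allI impI)
  fix k y assume "coef (W v) (k, y) \<noteq> 0"
  then have *: "(k, y) \<in> V" "0 < k" "coef v (k - 1, y mod s ^ (k - 1)) \<noteq> 0"
    by (auto simp: coef_shift split: if_splits)
  then have "N < k - 1" "y mod s ^ (k - 1) mod s ^ N = x" using assms unfolding near_def by blast+
  then show "(k, y) \<in> V \<and> N < k \<and> y mod s ^ N = x"
    using * mod_mod_cancel[of "s ^ N" "s ^ (k - 1)" y] by (simp add: le_imp_power_dvd)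
qed

lemma near_proj: "near N x v \<Longrightarrow> E v = v"
  unfolding near_def by (intro ell2_eqI) (auto simp: proj(5))

text \<open>The two vertices have the same predecessor, so the vector is killed by the adjoint of \<open>W\<close>;
  hence its orbit under \<open>W\<close> spans a reducing subspace on which \<open>W\<close> is a unilateral shift.\<close>

definition root_vec :: "nat \<Rightarrow> int \<Rightarrow> (nat \<times> int) ell2"
  where "root_vec N x = of_real (1 / sqrt 2) *\<^sub>C (ket (Suc N, x) - ket (Suc N, x + s ^ N))"

definition branch_vec :: "nat \<Rightarrow> nat \<Rightarrow> int \<Rightarrow> (nat \<times> int) ell2"
  where "branch_vec N n x = (blinfun_apply W ^^ n) (root_vec N x)"

lemma branch_vec_Suc: "branch_vec N (Suc n) x = W (branch_vec N n x)"
  by (simp add: branch_vec_def)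

lemma branch_vec_0: "branch_vec N 0 x = root_vec N x"
  by (simp add: branch_vec_def)

lemma root_vertices:
  assumes "0 \<le> x" "x < s ^ N"
  shows "(Suc N, x) \<in> V" "(Suc N, x + s ^ N) \<in> V"
proof -
  have "2 * s ^ N \<le> s * s ^ N" using s by (intro mult_right_mono) auto
  then have *: "2 * s ^ N \<le> s ^ Suc N" by simp
  show "(Suc N, x) \<in> V" "(Suc N, x + s ^ N) \<in> V"
    using assms * pow_pos[of N] unfolding vertices_iff by linarith+
qed

lemma near_branch:
  assumes "0 \<le> x" "x < s ^ N"
  shows "near N x (branch_vec N n x)"
proof (induction n)
  case 0
  show ?case
    unfolding branch_vec_0 near_def root_vec_def using root_vertices[OF assms] assms by auto
qed (simp add: branch_vec_Suc near_shift)

lemma adj_shift_root: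
  assumes "0 \<le> x" "x < s ^ N"
  shows "adj W (root_vec N x) = 0"
proof -
  have "s \<noteq> 0" using s by simp
  then show ?thesis
    using root_vertices[OF assms] assms
    by (simp add: root_vec_def clinear_op_scale blinfun.diff_right adj_shift_ket)
qed

text \<open>A factor \<open>W\<close> on both sides cancels, by \<open>shift_isometry\<close> for
  vectors supported on \<open>V\<close>; if powers of \<open>W\<close> are left on one side only,
  moving one of them across meets the root vector, which the adjoint kills.\<close>

lemma cinner_branch:
  assumes "0 \<le> x" "x < s ^ N"
  shows "cinner (branch_vec N n x) (branch_vec N k x) = (if n = k then 1 else 0)"
proof (induction n arbitrary: k)
  case 0
  show ?case
  proof (cases k)
    case 0
    have s0: "s \<noteq> 0" using s by simp
    have r: "complex_of_real (1 / sqrt 2) * complex_of_real (1 / sqrt 2) = 1 / 2"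
      by (simp flip: of_real_mult)
    have "cinner (root_vec N x) (root_vec N x) = complex_of_real (1 / sqrt 2) * complex_of_real (1 / sqrt 2) * 2"
      unfolding root_vec_def using s0
      by (simp add: cinner_scale_left cinner_scale_right cinner_minus_left cinner_minus_right del: of_real_divide)
    then show ?thesis using 0 unfolding r by (simp add: branch_vec_0)
  next
    case (Suc k)
    then show ?thesis
      by (simp add: branch_vec_Suc branch_vec_0 adj_shift_root[OF assms] flip: cinner_adj)
  qed
next
  case (Suc n)
  show ?case
  proof (cases k)
    case 0
    have "cinner (W (branch_vec N n x)) (root_vec N x) = 0"
      by (simp add: adj_shift_root[OF assms] flip: cinner_adj_right)
    then show ?thesis using 0 by (simp add: branch_vec_Suc branch_vec_0)
  next
    case (Suc l)
    have "adj W (W (branch_vec N l x)) = branch_vec N l x"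
      using arg_cong[OF shift_isometry, of "\<lambda>T. T (branch_vec N l x)"] near_proj[OF near_branch[OF assms]] by simp
    then have "cinner (W (branch_vec N n x)) (W (branch_vec N l x)) = cinner (branch_vec N n x) (branch_vec N l x)"
      by (simp flip: cinner_adj_right)
    then show ?thesis using Suc Suc.IH[of l] by (simp add: branch_vec_Suc)
  qed
qed

text \<open>The factor \<open>ket a\<close> keeps the orbits for different \<open>a\<close> orthogonal, although the underlying
  vectors coincide whenever the \<open>a\<close> agree modulo \<open>s ^ N\<close>.\<close>

definition branch_op :: "nat \<Rightarrow> (nat \<times> (nat \<Rightarrow> int)) ell2 \<Rightarrow>\<^sub>L ((nat \<times> int) \<times> (nat \<Rightarrow> int)) ell2"
  where "branch_op N = op_of_basis (\<lambda>(n, a). if a \<in> Z then tensor_ell2 (branch_vec N n (a N)) (ket a) else 0)"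

lemma branch_op:
  shows "clinear_op (branch_op N)"
    and "branch_op N (ket (n, a)) = (if a \<in> Z then tensor_ell2 (branch_vec N n (a N)) (ket a) else 0)"
    and "norm (branch_op N) \<le> 1"
    and "adj (branch_op N) o\<^sub>L branch_op N = proj (UNIV \<times> Z)"
proof -
  let ?F = "\<lambda>(n, a). if a \<in> Z then tensor_ell2 (branch_vec N n (a N)) (ket a) else 0"
  have F: "cinner (?F p) (?F q) = (if p = q \<and> snd p \<in> Z then 1 else 0)" for p q
  proof -
    have "cinner (branch_vec N (fst p) (a N)) (branch_vec N (fst q) (a N)) = (if fst p = fst q then 1 else 0)" if "a \<in> Z" for a
      using cinner_branch[of "a N" N] sadic_range[OF that] by blast
    then show ?thesis
      by (cases p; cases q) (auto simp: cinner_tensor_ell2 coef_simps)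
  qed
  have n: "norm (?F p) \<le> 1" for p
  proof -
    have "of_real ((norm (?F p))\<^sup>2) = complex_of_real (if snd p \<in> Z then 1 else 0)"
      unfolding cinner_self[symmetric] F by simp
    then have "(norm (?F p))\<^sup>2 = (if snd p \<in> Z then 1 else 0)" by (simp only: of_real_eq_iff)
    then have "(norm (?F p))\<^sup>2 \<le> 1\<^sup>2" by simp
    then show ?thesis by (rule power2_le_imp_le) simp
  qed
  have orth: "\<And>p q. p \<noteq> q \<Longrightarrow> cinner (?F p) (?F q) = 0" using F by simp
  note * = op_of_basis_orthogonal[of ?F 1, OF orth n zero_le_one, folded branch_op_def]
  show lin: "clinear_op (branch_op N)" by (rule *(1))
  show "norm (branch_op N) \<le> 1" by (rule *(3))
  show "branch_op N (ket (n, a)) = (if a \<in> Z then tensor_ell2 (branch_vec N n (a N)) (ket a) else 0)"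
    using *(2)[of "(n, a)"] by simp
  show "adj (branch_op N) o\<^sub>L branch_op N = proj (UNIV \<times> Z)"
  proof (rule clinear_op_eqI)
    show "(adj (branch_op N) o\<^sub>L branch_op N) (ket q) = proj (UNIV \<times> Z) (ket q)" for q
      by (rule ell2_eqI) (auto simp: coef_adj[OF lin] *(2) F proj(4,5) mem_Times_iff)
  qed (use lin in auto)
qed

lemma branch_op_shift:
  "tensor_op W id_blinfun o\<^sub>L branch_op N = branch_op N o\<^sub>L tensor_op toeplitz_gen (proj Z)"
proof (rule clinear_op_eqI)
  show "(tensor_op W id_blinfun o\<^sub>L branch_op N) (ket p) = (branch_op N o\<^sub>L tensor_op toeplitz_gen (proj Z)) (ket p)" for p
    by (cases p) (simp add: branch_op tensor_op_ket tensor_op tensor_ell2_ket branch_vec_Suc tensor_ell2.zero_right)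
qed (simp_all add: branch_op tensor_op)

text \<open>Taking adjoints in \<open>branch_op_shift\<close> would yield a relation for the adjoint
  of \<open>branch_op N\<close>. This one holds because the branches reduce \<open>W\<close>: the
  root vector is killed, and every later vector is sent back by one step.\<close>

lemma branch_op_adj_shift:
  "tensor_op (adj W) id_blinfun o\<^sub>L branch_op N = branch_op N o\<^sub>L tensor_op (adj toeplitz_gen) (proj Z)"
proof (rule clinear_op_eqI)
  fix p :: "nat \<times> (nat \<Rightarrow> int)"
  obtain n a where p: "p = (n, a)" by fastforce
  show "(tensor_op (adj W) id_blinfun o\<^sub>L branch_op N) (ket p) = (branch_op N o\<^sub>L tensor_op (adj toeplitz_gen) (proj Z)) (ket p)"
  proof (cases "a \<in> Z")
    case True
    note r = sadic_range[OF True, of N, THEN conjunct1] sadic_range[OF True, of N, THEN conjunct2]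
    show ?thesis
    proof (cases n)
      case 0
      then show ?thesis using True
        by (simp add: p branch_op tensor_op_ket tensor_op branch_vec_0 adj_shift_root[OF r]
            adj_toeplitz_ket tensor_ell2.zero_left)
    next
      case (Suc k)
      have "adj W (W (branch_vec N k (a N))) = branch_vec N k (a N)"
        using arg_cong[OF shift_isometry, of "\<lambda>T. T (branch_vec N k (a N))"] near_proj[OF near_branch[OF r]] by simp
      then show ?thesis using True Suc
        by (simp add: p branch_op tensor_op_ket tensor_op branch_vec_Suc adj_toeplitz_ket tensor_ell2_ket)
    qed
  qed (simp add: p branch_op tensor_op_ket tensor_ell2.zero_right)
qed (simp_all add: branch_op tensor_op)

lemma clinear_diag_sadic [simp]:
  assumes "continuous_on Z f"
  shows "clinear_op (diag_op Z f)" "diag_op Z f (ket a) = (if a \<in> Z then f a *\<^sub>C ket a else 0)"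
proof -
  obtain B where B: "0 \<le> B" "\<And>a. a \<in> Z \<Longrightarrow> cmod (f a) \<le> B" using sadic_bounded[OF assms] by metis
  show "clinear_op (diag_op Z f)" "diag_op Z f (ket a) = (if a \<in> Z then f a *\<^sub>C ket a else 0)"
    by (rule diag_op[of Z f B, OF B(2,1)], assumption)+
qed

text \<open>All vertices that support a branch at \<open>a\<close> agree with \<open>a\<close>
  modulo \<open>s ^ N\<close>, hence modulo \<open>s ^ m\<close>, so \<open>f\<close> is constant on
  them.\<close>

lemma branch_op_mult:
  assumes f: "locally_const m f" and mN: "m \<le> N"
  shows "tensor_op (serre_mult s f) id_blinfun o\<^sub>L branch_op N = branch_op N o\<^sub>L tensor_op id_blinfun (diag_op Z f)"
proof (rule clinear_op_eqI)
  note [simp] = locally_const_continuous[OF f]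
  fix p :: "nat \<times> (nat \<Rightarrow> int)"
  obtain n a where p: "p = (n, a)" by fastforce
  have "serre_mult s f (branch_vec N n (a N)) = f a *\<^sub>C branch_vec N n (a N)" if a: "a \<in> Z"
  proof (rule ell2_eqI)
    fix q :: "nat \<times> int"
    obtain k y where q: "q = (k, y)" by fastforce
    have near: "near N (a N) (branch_vec N n (a N))"
      using near_branch[of "a N" N n] sadic_range[OF a, of N] by blast
    show "coef (serre_mult s f (branch_vec N n (a N))) q = coef (f a *\<^sub>C branch_vec N n (a N)) q"
    proof (cases "coef (branch_vec N n (a N)) q = 0")
      case False
      then have y: "(k, y) \<in> V" "y mod s ^ N = a N" using near unfolding q near_def by blast+
      have "f (sadic_of_int s y) = f a"
        using locally_const_mod[OF f mN, of y] locally_const_eq[OF f a mN] y(2) by simp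
      then show ?thesis using y(1) by (simp add: q coef_mult)
    qed (simp add: q coef_mult)
  qed
  then show "(tensor_op (serre_mult s f) id_blinfun o\<^sub>L branch_op N) (ket p) = (branch_op N o\<^sub>L tensor_op id_blinfun (diag_op Z f)) (ket p)"
    by (simp add: p branch_op tensor_op_ket tensor_op tensor_ell2_scale tensor_ell2_ket tensor_ell2.zero_right
        clinear_op_scale[OF branch_op(1)])
qed (simp_all add: branch_op tensor_op locally_const_continuous[OF f])

text \<open>A branch at \<open>N\<close> lives strictly beyond level \<open>N\<close>. This is why
  compact operators have symbol zero.\<close>

lemma branch_op_finite:
  assumes F: "finite F"
  shows "\<exists>N0. \<forall>N\<ge>N0. tensor_op (proj F) id_blinfun o\<^sub>L branch_op N = 0"
proof (intro exI allI impI)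
  fix N assume N: "Max (fst ` F) \<le> N"
  show "tensor_op (proj F) id_blinfun o\<^sub>L branch_op N = 0"
  proof (rule clinear_op_eqI)
    fix p :: "nat \<times> (nat \<Rightarrow> int)"
    obtain n a where p: "p = (n, a)" by fastforce
    have "proj F (branch_vec N n (a N)) = 0" if a: "a \<in> Z"
    proof (rule ell2_eqI)
      fix q :: "nat \<times> int"
      obtain k y where q: "q = (k, y)" by fastforce
      have "near N (a N) (branch_vec N n (a N))"
        using near_branch[of "a N" N n] sadic_range[OF a, of N] by blast
      moreover have "k \<le> N" if "q \<in> F"
      proof -
        have "k \<in> fst ` F" using that q by force
        then have "k \<le> Max (fst ` F)" using F by simp
        then show ?thesis using N by simp
      qed
      ultimately show "coef (proj F (branch_vec N n (a N))) q = coef 0 q"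
        unfolding near_def q proj(5) coef_simps(1) using q by (metis not_less)
    qed
    then show "(tensor_op (proj F) id_blinfun o\<^sub>L branch_op N) (ket p) = blinfun_apply 0 (ket p)"
      by (simp add: p branch_op tensor_op tensor_ell2.zero_left)
  qed (simp_all add: branch_op tensor_op)
qed

subsection \<open>The Wold decomposition below a level\<close>

definition below :: "nat \<Rightarrow> (nat \<times> int) set"
  where "below m = {(n, x). (n, x) \<in> V \<and> m \<le> n}"

text \<open>The isometry on the levels from \<open>m\<close> on, its adjoint, and the projection
  onto the orthogonal complement of its range there, which is the wandering subspace of the Wold
  decomposition.\<close>

abbreviation "Wl m \<equiv> W o\<^sub>L proj (below m)"
abbreviation "Rl m \<equiv> adj (Wl m)"
abbreviation "Dl m \<equiv> proj (below m) - (Wl m o\<^sub>L Rl m)"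

lemma level_clinear [simp]: "clinear_op (Wl m)" "clinear_op (Rl m)" "clinear_op (Dl m)"
  by simp_all

lemma coef_Wl: "coef (Wl m v) (n, y) = (if (n, y) \<in> V \<and> m < n then \<kappa> * coef v (n - 1, y mod s ^ (n - 1)) else 0)"
  by (auto simp: coef_shift below_def proj(5))

lemma Rl_eq: "Rl m = proj (below m) o\<^sub>L adj W"
  by (simp add: adj_compose)

lemma Rl_ket: "Rl m (ket (n, y)) = (if (n, y) \<in> V \<and> m < n then \<kappa> *\<^sub>C ket (n - 1, y mod s ^ (n - 1)) else 0)"
  unfolding Rl_eq by (auto simp: adj_shift_ket clinear_op_scale below_def)

lemma level_relations:
  "Rl m o\<^sub>L Wl m = proj (below m)" "proj (below m) o\<^sub>L Wl m = Wl m" "proj (below m) o\<^sub>L Rl m = Rl m"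
  "Rl m o\<^sub>L proj (below m) = Rl m" "Dl m o\<^sub>L Wl m = 0" "adj (Dl m) o\<^sub>L Dl m = Dl m"
proof -
  let ?P = "proj (below m)"
  have I: "V \<inter> below m = below m" by (auto simp: below_def)
  have "Rl m o\<^sub>L Wl m = ?P o\<^sub>L ((adj W o\<^sub>L W) o\<^sub>L ?P)"
    by (simp add: Rl_eq blinfun_compose_assoc)
  also have "\<dots> = ?P" by (simp add: shift_isometry proj_compose I)
  finally show RW: "Rl m o\<^sub>L Wl m = ?P" .
  show PW: "?P o\<^sub>L Wl m = Wl m"
  proof (intro blinfun_eqI ell2_eqI)
    fix v p show "coef ((?P o\<^sub>L Wl m) v) p = coef (Wl m v) p"
      by (cases p) (auto simp: coef_shift below_def proj(5))
  qed
  show PR: "?P o\<^sub>L Rl m = Rl m" by (simp add: Rl_eq proj_compose flip: blinfun_compose_assoc)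
  show RP: "Rl m o\<^sub>L ?P = Rl m"
    using arg_cong[OF PW, of adj] by (simp add: adj_compose blinfun_compose_assoc)
  have WP: "Wl m o\<^sub>L ?P = Wl m" by (simp add: blinfun_compose_assoc proj_compose)
  show DW: "Dl m o\<^sub>L Wl m = 0"
    by (simp only: blinfun_compose.diff_left PW blinfun_compose_assoc[of "Wl m"] RW WP diff_self)
  have "adj (Dl m) = Dl m"
    by (simp add: adj_diff adj_compose)
  moreover have "Dl m o\<^sub>L Dl m = Dl m"
  proof -
    have "Dl m o\<^sub>L ?P = Dl m"
      by (simp only: blinfun_compose.diff_left blinfun_compose_assoc[of "Wl m"] RP proj_compose Int_absorb)
    moreover have "Dl m o\<^sub>L (Wl m o\<^sub>L Rl m) = 0"
      using blinfun_compose_assoc[of "Dl m" "Wl m" "Rl m"] unfolding DW by simp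
    ultimately show ?thesis by (simp only: blinfun_compose.diff_right diff_zero)
  qed
  ultimately show "adj (Dl m) o\<^sub>L Dl m = Dl m" by simp
qed

text \<open>Written as a difference so that the sum over the powers of \<open>Rl m\<close>
  telescopes; it holds because \<open>Dl m\<close> is a projection.\<close>

lemma cinner_Dl: "cinner (Dl m u) (Dl m v) = cinner u (proj (below m) v) - cinner (Rl m u) (Rl m v)"
proof -
  have "cinner (Dl m u) (Dl m v) = cinner u ((adj (Dl m) o\<^sub>L Dl m) v)"
    by (simp only: blinfun_apply_blinfun_compose cinner_adj_right[OF level_clinear(3)])
  also have "\<dots> = cinner u (proj (below m) v) - cinner u (Wl m (Rl m v))"
    unfolding level_relations(6) by (simp add: blinfun.diff_left cinner_minus_right)
  also have "cinner u (Wl m (Rl m v)) = cinner (Rl m u) (Rl m v)"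
    by (rule cinner_adj[OF level_clinear(1), symmetric])
  finally show ?thesis .
qed

primrec Rpow :: "nat \<Rightarrow> nat \<Rightarrow> (nat \<times> int) ell2 \<Rightarrow>\<^sub>L (nat \<times> int) ell2"
  where "Rpow m 0 = id_blinfun" | "Rpow m (Suc k) = Rpow m k o\<^sub>L Rl m"

lemma clinear_Rpow [simp]: "clinear_op (Rpow m k)"
  by (induction k) (auto simp del: adj_compose)

lemma Rpow_commute: "Rl m o\<^sub>L Rpow m k = Rpow m k o\<^sub>L Rl m"
  by (induction k) (simp_all flip: blinfun_compose_assoc)

text \<open>Each step lowers the level by one. This is the purity of the isometry: on a basis vector
  only finitely many terms of the Wold decomposition survive.\<close>

lemma Rpow_zero: "n < k \<Longrightarrow> Rpow m k (ket (n, x)) = 0"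
proof (induction k arbitrary: n x)
  case (Suc k)
  show ?case
  proof (cases "(n, x) \<in> V \<and> m < n")
    case True
    then have "Rpow m k (ket (n - 1, x mod s ^ (n - 1))) = 0"
      using Suc.prems by (intro Suc.IH) linarith
    then show ?thesis using True by (simp add: Rl_ket clinear_op_scale[OF clinear_Rpow] del: blinfun_compose.zero_right)
  qed (auto simp: Rl_ket)
qed simp

text \<open>The index \<open>k\<close> is the place in the unilateral shift and
  \<open>sadic_of_int s x\<close> the point at which functions are evaluated; the label
  \<open>(n, x)\<close> is a multiplicity that keeps vertices with the same \<open>x\<close> on
  different levels orthogonal.\<close>

definition leaf_op :: "nat \<Rightarrow> (nat \<times> int) ell2 \<Rightarrow>\<^sub>L ((nat \<times> (nat \<Rightarrow> int)) \<times> (nat \<times> int)) ell2"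
  where "leaf_op k = op_of_basis (\<lambda>(n, x). ket ((k, sadic_of_int s x), (n, x)))"

lemma leaf_op:
  "clinear_op (leaf_op k)" "leaf_op k (ket (n, x)) = ket ((k, sadic_of_int s x), (n, x))"
  "cinner (leaf_op k v) (leaf_op l w) = (if k = l then cinner v w else 0)"
proof -
  let ?F = "\<lambda>k (n, x). ket ((k, sadic_of_int s x), (n, x)) :: ((nat \<times> (nat \<Rightarrow> int)) \<times> (nat \<times> int)) ell2"
  have F: "cinner (?F k p) (?F k q) = 0" if "p \<noteq> q" for k p q using that by (cases p; cases q) auto
  have n: "norm (?F k p) \<le> 1" for k p by (cases p) simp
  note * = op_of_basis_orthogonal[of "?F k" 1 for k, OF F n zero_le_one, folded leaf_op_def]
  show lin: "clinear_op (leaf_op k)" for k by (rule *(1))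
  show ket: "leaf_op k (ket (n, x)) = ket ((k, sadic_of_int s x), (n, x))" for k n x using *(2)[of k "(n, x)"] by simp
  have "adj (leaf_op k) o\<^sub>L leaf_op l = (if k = l then id_blinfun else 0)"
  proof (rule clinear_op_eqI)
    fix q :: "nat \<times> int"
    obtain n x where q: "q = (n, x)" by fastforce
    show "(adj (leaf_op k) o\<^sub>L leaf_op l) (ket q) = (if k = l then id_blinfun else 0) (ket q)"
    proof (rule ell2_eqI)
      fix p :: "nat \<times> int"
      show "coef ((adj (leaf_op k) o\<^sub>L leaf_op l) (ket q)) p = coef ((if k = l then id_blinfun else 0) (ket q)) p"
        by (cases p) (auto simp: q coef_adj lin ket)
    qed
  qed (simp_all add: lin)
  then have "cinner v ((adj (leaf_op k) o\<^sub>L leaf_op l) w) = (if k = l then cinner v w else 0)" by simp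
  then show "cinner (leaf_op k v) (leaf_op l w) = (if k = l then cinner v w else 0)"
    by (simp add: cinner_adj_right[OF lin])
qed

text \<open>A vector supported on the levels \<open>\<ge> m\<close> is the orthogonal sum of the vectors obtained by applying the
  \<open>k\<close>-th power of \<open>Wl m\<close> to \<open>Dl m (Rpow m k v)\<close>; the operator stores the \<open>k\<close>-th component in the copy \<open>leaf_op k\<close>.
  On the basis vector \<open>ket (n, x)\<close> the sum stops at \<open>k = n\<close>.\<close>

definition wold_sum :: "nat \<Rightarrow> nat \<Rightarrow> (nat \<times> int) ell2 \<Rightarrow>\<^sub>L ((nat \<times> (nat \<Rightarrow> int)) \<times> (nat \<times> int)) ell2"
  where "wold_sum m K = (\<Sum>k<K. leaf_op k o\<^sub>L Dl m o\<^sub>L Rpow m k)"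

lemma clinear_wold_sum [simp]: "clinear_op (wold_sum m K)"
  unfolding wold_sum_def by (intro clinear_op_sum clinear_op_intros leaf_op clinear_Rpow clinear_adj proj clinear_shift)

lemma wold_sum_apply: "wold_sum m K v = (\<Sum>k<K. leaf_op k (Dl m (Rpow m k v)))"
  by (simp add: wold_sum_def blinfun.sum_left)

definition wold_op :: "nat \<Rightarrow> (nat \<times> int) ell2 \<Rightarrow>\<^sub>L ((nat \<times> (nat \<Rightarrow> int)) \<times> (nat \<times> int)) ell2"
  where "wold_op m = op_of_basis (\<lambda>p. wold_sum m (Suc (fst p)) (ket p))"

lemma wold_sum_ket:
  assumes "n < K"
  shows "wold_sum m (Suc n) (ket (n, x)) = wold_sum m K (ket (n, x))"
  unfolding wold_sum_apply
  by (rule sum.mono_neutral_left) (use assms in \<open>auto simp: Rpow_zero\<close>)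

text \<open>Different copies are orthogonal, and within the copies \<open>cinner_Dl\<close> makes
  the sum telescope; the last term vanishes because the levels are less than
  \<open>K\<close>.\<close>

lemma cinner_wold_sum:
  assumes "n < K" "n' < K"
  shows "cinner (wold_sum m K (ket (n, x))) (wold_sum m K (ket (n', x')))
    = cinner (ket (n, x)) (proj (below m) (ket (n', x')))"
proof -
  let ?p = "ket (n, x)" and ?q = "ket (n', x')"
  define g where "g k = cinner (Rpow m k ?p) (proj (below m) (Rpow m k ?q))" for k
  \<comment> \<open>The projection in \<open>g\<close> is invisible for positive powers; it survives
    in \<open>g 0\<close>, which is how \<open>below m\<close> enters the result.\<close>
  have P: "proj (below m) (Rpow m (Suc k) v) = Rpow m (Suc k) v" for k v
  proof -
    have "Rpow m (Suc k) = proj (below m) o\<^sub>L Rpow m (Suc k)"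
      unfolding Rpow.simps Rpow_commute[symmetric] blinfun_compose_assoc[symmetric] level_relations(3) ..
    then show ?thesis by (metis blinfun_apply_blinfun_compose)
  qed
  have R: "Rl m (Rpow m k v) = Rpow m (Suc k) v" for k v
    using arg_cong[OF Rpow_commute, of "\<lambda>T. T v"] by simp
  have "cinner (wold_sum m K ?p) (wold_sum m K ?q) = (\<Sum>k<K. cinner (Dl m (Rpow m k ?p)) (Dl m (Rpow m k ?q)))"
    unfolding wold_sum_apply cinner_sum_left cinner_sum_right leaf_op(3) by (simp add: sum.delta)
  also have "\<dots> = (\<Sum>k<K. g k - g (Suc k))"
    by (intro sum.cong refl) (simp only: cinner_Dl R g_def P)
  also have "\<dots> = g 0 - g K" by (rule sum_lessThan_telescope')
  also have "g K = 0" using assms by (simp add: g_def Rpow_zero)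
  finally show ?thesis by (simp add: g_def)
qed

lemma wold_op:
  shows "clinear_op (wold_op m)"
    and "n < K \<Longrightarrow> wold_op m (ket (n, x)) = wold_sum m K (ket (n, x))"
    and "norm (wold_op m) \<le> 1"
    and "adj (wold_op m) o\<^sub>L wold_op m = proj (below m)"
proof -
  let ?F = "\<lambda>p. wold_sum m (Suc (fst p)) (ket p)"
  have F: "cinner (?F p) (?F q) = cinner (ket p) (proj (below m) (ket q))" for p q
  proof -
    obtain n x n' x' where pq: "p = (n, x)" "q = (n', x')" by fastforce
    let ?K = "Suc (max n n')"
    show ?thesis
      using cinner_wold_sum[of n ?K n' m x x'] wold_sum_ket[of n ?K m x] wold_sum_ket[of n' ?K m x']
      by (simp add: pq)
  qed
  have n: "norm (?F p) \<le> 1" for p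
  proof -
    have "of_real ((norm (?F p))\<^sup>2) = complex_of_real (if p \<in> below m then 1 else 0)"
      unfolding cinner_self[symmetric] F by simp
    then have "(norm (?F p))\<^sup>2 = (if p \<in> below m then 1 else 0)" by (simp only: of_real_eq_iff)
    then have "(norm (?F p))\<^sup>2 \<le> 1\<^sup>2" by simp
    then show ?thesis by (rule power2_le_imp_le) simp
  qed
  have orth: "\<And>p q. p \<noteq> q \<Longrightarrow> cinner (?F p) (?F q) = 0" unfolding F by simp
  note * = op_of_basis_orthogonal[of ?F 1, OF orth n zero_le_one, folded wold_op_def]
  have ket: "wold_op m (ket p) = wold_sum m (Suc (fst p)) (ket p)" for p by (rule *(2))
  show lin: "clinear_op (wold_op m)" by (rule *(1))
  show "norm (wold_op m) \<le> 1" by (rule *(3))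
  show "wold_op m (ket (n, x)) = wold_sum m K (ket (n, x))" if "n < K"
    using ket[of "(n, x)"] wold_sum_ket[OF that, of m x] by simp
  show "adj (wold_op m) o\<^sub>L wold_op m = proj (below m)"
  proof (rule clinear_op_eqI)
    show "(adj (wold_op m) o\<^sub>L wold_op m) (ket q) = proj (below m) (ket q)" for q
      by (rule ell2_eqI) (simp only: blinfun_apply_blinfun_compose coef_adj[OF lin] ket F cinner_ket)
  qed (use lin in auto)
qed

lemma wold_op_below: "wold_op m o\<^sub>L proj (below m) = wold_op m"
proof (rule clinear_op_eqI)
  fix p
  have "wold_op m (ket p) = 0" if "p \<notin> below m"
  proof -
    have "of_real ((norm (wold_op m (ket p)))\<^sup>2) = cinner (ket p) ((adj (wold_op m) o\<^sub>L wold_op m) (ket p))"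
      by (simp only: cinner_self[symmetric] blinfun_apply_blinfun_compose cinner_adj_right[OF wold_op(1)])
    also have "\<dots> = 0" unfolding wold_op(4) using that by simp
    finally show ?thesis by simp
  qed
  then show "(wold_op m o\<^sub>L proj (below m)) (ket p) = wold_op m (ket p)" by simp
qed (simp_all add: wold_op)

section \<open>Intertwining relations of the Wold embedding\<close>

abbreviation ampl :: "((nat \<times> (nat \<Rightarrow> int)) ell2 \<Rightarrow>\<^sub>L (nat \<times> (nat \<Rightarrow> int)) ell2) \<Rightarrow>
    (((nat \<times> (nat \<Rightarrow> int)) \<times> (nat \<times> int)) ell2 \<Rightarrow>\<^sub>L ((nat \<times> (nat \<Rightarrow> int)) \<times> (nat \<times> int)) ell2)"
  where "ampl T \<equiv> tensor_op T id_blinfun"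

lemma leaf_op_shift: "ampl (tensor_op toeplitz_gen (proj Z)) o\<^sub>L leaf_op k = leaf_op (Suc k)"
proof (rule clinear_op_eqI)
  show "(ampl (tensor_op toeplitz_gen (proj Z)) o\<^sub>L leaf_op k) (ket p) = leaf_op (Suc k) (ket p)" for p
    by (cases p) (simp add: leaf_op tensor_op_ket tensor_op tensor_ell2_ket)
qed (simp_all add: leaf_op tensor_op)

lemma leaf_op_adj_shift:
  "ampl (tensor_op (adj toeplitz_gen) (proj Z)) o\<^sub>L leaf_op (Suc k) = leaf_op k"
  "ampl (tensor_op (adj toeplitz_gen) (proj Z)) o\<^sub>L leaf_op 0 = 0"
proof (rule_tac [!] clinear_op_eqI)
  show "(ampl (tensor_op (adj toeplitz_gen) (proj Z)) o\<^sub>L leaf_op (Suc k)) (ket p) = leaf_op k (ket p)"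
    "(ampl (tensor_op (adj toeplitz_gen) (proj Z)) o\<^sub>L leaf_op 0) (ket p) = blinfun_apply 0 (ket p)" for p
    by (cases p; simp add: leaf_op tensor_op_ket tensor_op tensor_ell2_ket adj_toeplitz_ket tensor_ell2.zero_left)+
qed (simp_all add: leaf_op tensor_op)

lemma leaf_op_mult:
  assumes f: "continuous_on Z f"
  shows "ampl (tensor_op id_blinfun (diag_op Z f)) o\<^sub>L leaf_op k o\<^sub>L E = leaf_op k o\<^sub>L serre_mult s f"
proof (rule clinear_op_eqI)
  show "(ampl (tensor_op id_blinfun (diag_op Z f)) o\<^sub>L leaf_op k o\<^sub>L E) (ket p) = (leaf_op k o\<^sub>L serre_mult s f) (ket p)" for p
  proof (cases p)
    case (Pair n x)
    then show ?thesis
      by (cases "(n, x) \<in> V")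
        (simp_all add: leaf_op tensor_op_ket tensor_op f tensor_ell2_ket serre_mult[OF s f]
          tensor_ell2_scale clinear_op_scale[OF leaf_op(1)])
  qed
qed (simp_all add: leaf_op tensor_op f)

text \<open>One application of the adjoint raises the exponent of \<open>Rpow\<close> by one, so
  component \<open>k\<close> of the image is component \<open>k + 1\<close> of the original. The
  relation is exact because \<open>wold_op m\<close> sees only \<open>below m\<close>, and cutting
  the adjoint of \<open>W\<close> down to it gives \<open>Rl m\<close>.\<close>

lemma wold_op_adj_shift:
  "wold_op m o\<^sub>L adj W = ampl (tensor_op (adj toeplitz_gen) (proj Z)) o\<^sub>L wold_op m"
proof (rule clinear_op_eqI)
  let ?S = "ampl (tensor_op (adj toeplitz_gen) (proj Z))"
  fix p :: "nat \<times> int"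
  obtain n x where p: "p = (n, x)" by fastforce
  have leaf: "?S (leaf_op (Suc k) v) = leaf_op k v" "?S (leaf_op 0 v) = 0" for k v
    using arg_cong[OF leaf_op_adj_shift(1), of "\<lambda>T. T v"] arg_cong[OF leaf_op_adj_shift(2), of "\<lambda>T. T v"] by simp_all
  have "wold_op m (ket (n - 1, y)) = wold_sum m (Suc n) (ket (n - 1, y))" for y
    by (rule wold_op(2)) simp
  then have R: "wold_op m (Rl m (ket p)) = wold_sum m (Suc n) (Rl m (ket p))"
    unfolding p Rl_ket by (simp add: clinear_op_scale wold_op(1) del: One_nat_def)
  have "(wold_op m o\<^sub>L adj W) (ket p) = wold_op m (Rl m (ket p))"
    unfolding Rl_eq using arg_cong[OF wold_op_below, of "\<lambda>T. T (adj W (ket p))"] by simp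
  also have "\<dots> = (\<Sum>k<Suc n. leaf_op k (Dl m (Rpow m (Suc k) (ket p))))"
    unfolding R wold_sum_apply by simp
  also have "\<dots> = ?S (\<Sum>k<Suc (Suc n). leaf_op k (Dl m (Rpow m k (ket p))))"
    unfolding sum.lessThan_Suc_shift[of _ "Suc n"] blinfun.add_right blinfun.sum_right leaf by simp
  also have "\<dots> = (?S o\<^sub>L wold_op m) (ket p)"
    by (simp add: p wold_op(2)[of n "Suc (Suc n)"] wold_sum_apply)
  finally show "(wold_op m o\<^sub>L adj W) (ket p) = (?S o\<^sub>L wold_op m) (ket p)" .
qed (simp_all add: wold_op tensor_op)

text \<open>The range of \<open>Wl m\<close> is orthogonal to the wandering subspace, so component 0
  of the image vanishes, and \<open>Rl m\<close> undoes \<open>Wl m\<close>, so the others move up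
  by one place.\<close>

lemma wold_op_Wl: "wold_op m o\<^sub>L Wl m = ampl (tensor_op toeplitz_gen (proj Z)) o\<^sub>L wold_op m"
proof (rule clinear_op_eqI)
  let ?S = "ampl (tensor_op toeplitz_gen (proj Z))"
  fix p :: "nat \<times> int"
  obtain n x where p: "p = (n, x)" by fastforce
  have leaf: "?S (leaf_op k v) = leaf_op (Suc k) v" for k v
    using arg_cong[OF leaf_op_shift, of "\<lambda>T. T v"] by simp
  have ev: "wold_op m v = wold_sum m (Suc (Suc n)) v"
    if "v = Wl m (ket p)" for v
  proof (cases "p \<in> below m")
    case True
    then have "(n, x) \<in> V" by (simp add: below_def p)
    then show ?thesis using True unfolding that p
      by (simp add: serre_shift(2)[OF s] clinear_op_scale wold_op(1) blinfun.sum_right wold_op(2)[of "Suc n" "Suc (Suc n)"])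
  qed (simp add: that)
  have RW: "Rpow m (Suc k) (Wl m v) = Rpow m k (proj (below m) v)" for k v
    using arg_cong[OF level_relations(1)[of m], of "\<lambda>T. Rpow m k (T v)"] by simp
  have "(wold_op m o\<^sub>L Wl m) (ket p) = wold_sum m (Suc (Suc n)) (Wl m (ket p))"
    using ev[OF refl] by simp
  also have "\<dots> = leaf_op 0 ((Dl m o\<^sub>L Wl m) (ket p)) + (\<Sum>k<Suc n. leaf_op (Suc k) (Dl m (Rpow m (Suc k) (Wl m (ket p)))))"
    unfolding wold_sum_apply sum.lessThan_Suc_shift[of _ "Suc n"] by simp
  also have "\<dots> = ?S (wold_sum m (Suc n) (proj (below m) (ket p)))"
    unfolding level_relations(5) RW wold_sum_apply blinfun.sum_right leaf by simp
  also have "wold_sum m (Suc n) (proj (below m) (ket p)) = wold_op m (proj (below m) (ket p))"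
    by (simp add: p wold_op(2)[of n "Suc n"])
  also have "\<dots> = wold_op m (ket p)"
    using arg_cong[OF wold_op_below, of "\<lambda>T. T (ket p)"] by simp
  finally show "(wold_op m o\<^sub>L Wl m) (ket p) = (?S o\<^sub>L wold_op m) (ket p)" by simp
qed (simp_all add: wold_op tensor_op)

text \<open>The full shift also leads into level \<open>m\<close> from the level before it, which
  \<open>Wl m\<close> ignores. Only the finitely many vertices on levels less than \<open>m\<close>
  are affected; this defect is why the Wold side works modulo compact operators.\<close>

lemma wold_op_shift:
  "compact_op ((wold_op m o\<^sub>L W) - (ampl (tensor_op toeplitz_gen (proj Z)) o\<^sub>L wold_op m))"
proof -
  let ?F = "{(n, x). (n, x) \<in> V \<and> n < m}"
  have "?F \<subseteq> (\<Union>n<m. {n} \<times> {0..<s ^ n})" by (auto simp: vertices_iff)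
  then have fin: "finite ?F" by (rule finite_subset) auto
  have "E - proj (below m) = proj ?F"
    by (intro blinfun_eqI ell2_eqI) (auto simp: blinfun.diff_left below_def)
  from arg_cong[OF this, of "\<lambda>T. W o\<^sub>L T"] have WF: "W o\<^sub>L proj ?F = W - Wl m"
    by (simp add: blinfun_compose.diff_right)
  have "wold_op m o\<^sub>L W o\<^sub>L proj ?F = (wold_op m o\<^sub>L W) - (wold_op m o\<^sub>L Wl m)"
    unfolding blinfun_compose_assoc[of "wold_op m" W "proj ?F"] WF by (rule blinfun_compose.diff_right)
  also have "\<dots> = (wold_op m o\<^sub>L W) - (ampl (tensor_op toeplitz_gen (proj Z)) o\<^sub>L wold_op m)"
    unfolding wold_op_Wl ..
  finally show ?thesis
    using compact_op_compose_left[OF compact_op_proj[OF fin], of "wold_op m o\<^sub>L W"] by (simp add: wold_op)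
qed

text \<open>From level \<open>m\<close> on, a vertex and its children have the same residue modulo
  \<open>s ^ m\<close>, so \<open>f\<close> takes the same value on them.\<close>

lemma level_mult_commute:
  assumes f: "locally_const m f"
  shows "serre_mult s f o\<^sub>L Wl m = Wl m o\<^sub>L serre_mult s f"
    "serre_mult s f o\<^sub>L Rl m = Rl m o\<^sub>L serre_mult s f"
    "serre_mult s f o\<^sub>L Dl m = Dl m o\<^sub>L serre_mult s f"
    "serre_mult s f o\<^sub>L Rpow m k = Rpow m k o\<^sub>L serre_mult s f"
proof -
  \<comment> \<open>Shown for every such function, because the relation for \<open>Rl m\<close> is
    the adjoint of this one for the conjugate function.\<close>
  have W: "serre_mult s f o\<^sub>L Wl m = Wl m o\<^sub>L serre_mult s f" if f: "locally_const m f" for f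
  proof (intro blinfun_eqI ell2_eqI)
    fix v and p :: "nat \<times> int"
    obtain n y where p: "p = (n, y)" by fastforce
    show "coef ((serre_mult s f o\<^sub>L Wl m) v) p = coef ((Wl m o\<^sub>L serre_mult s f) v) p"
      using locally_const_mod[OF f, of "n - 1" y] vertices_mod[of "n - 1" y]
      unfolding p blinfun_apply_blinfun_compose[of _ "serre_mult s f"] blinfun_apply_blinfun_compose[of "serre_mult s f"]
        coef_mult[OF locally_const_continuous[OF f]] coef_Wl
      by auto
  qed
  note [simp] = locally_const_continuous[OF f]
  have cf: "locally_const m (\<lambda>a. cnj (f a))" using f unfolding locally_const_def complex_cnj_cancel_iff .
  show W': "serre_mult s f o\<^sub>L Wl m = Wl m o\<^sub>L serre_mult s f" by (rule W[OF f])
  have adj: "adj (serre_mult s (\<lambda>a. cnj (f a))) = serre_mult s f"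
    using adj_mult[OF locally_const_continuous[OF cf]] by simp
  have "adj (serre_mult s (\<lambda>a. cnj (f a)) o\<^sub>L Wl m) = adj (Wl m o\<^sub>L serre_mult s (\<lambda>a. cnj (f a)))"
    using W[OF cf] by simp
  then show R: "serre_mult s f o\<^sub>L Rl m = Rl m o\<^sub>L serre_mult s f"
    using adj_compose[of "serre_mult s (\<lambda>a. cnj (f a))" "Wl m"] adj_compose[of "Wl m" "serre_mult s (\<lambda>a. cnj (f a))"]
      locally_const_continuous[OF cf] by (simp only: adj level_clinear clinear_mult)
  have P: "serre_mult s f o\<^sub>L proj (below m) = proj (below m) o\<^sub>L serre_mult s f"
    by (intro blinfun_eqI ell2_eqI) (auto simp: coef_mult)
  have "serre_mult s f o\<^sub>L (Wl m o\<^sub>L Rl m) = (serre_mult s f o\<^sub>L Wl m) o\<^sub>L Rl m" by (simp only: blinfun_compose_assoc)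
  also have "\<dots> = Wl m o\<^sub>L (serre_mult s f o\<^sub>L Rl m)" unfolding W' by (simp only: blinfun_compose_assoc)
  also have "\<dots> = (Wl m o\<^sub>L Rl m) o\<^sub>L serre_mult s f" unfolding R by (simp only: blinfun_compose_assoc)
  finally show "serre_mult s f o\<^sub>L Dl m = Dl m o\<^sub>L serre_mult s f"
    by (simp only: blinfun_compose.diff_left blinfun_compose.diff_right P)
  show "serre_mult s f o\<^sub>L Rpow m k = Rpow m k o\<^sub>L serre_mult s f"
  proof (induction k)
    case (Suc k)
    have "serre_mult s f o\<^sub>L Rpow m (Suc k) = (serre_mult s f o\<^sub>L Rpow m k) o\<^sub>L Rl m" by (simp only: Rpow.simps blinfun_compose_assoc)
    also have "\<dots> = Rpow m k o\<^sub>L (serre_mult s f o\<^sub>L Rl m)" unfolding Suc by (simp only: blinfun_compose_assoc)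
    also have "\<dots> = Rpow m (Suc k) o\<^sub>L serre_mult s f" unfolding R by (simp only: Rpow.simps blinfun_compose_assoc)
    finally show ?case .
  qed simp
qed

lemma wold_op_mult:
  assumes f: "locally_const m f"
  shows "wold_op m o\<^sub>L serre_mult s f = ampl (tensor_op id_blinfun (diag_op Z f)) o\<^sub>L wold_op m"
proof (rule clinear_op_eqI)
  let ?S = "ampl (tensor_op id_blinfun (diag_op Z f))" and ?M = "serre_mult s f"
  note cont [simp] = locally_const_continuous[OF f]
  fix p :: "nat \<times> int"
  obtain n x where p: "p = (n, x)" by fastforce
  have "?S (leaf_op k (Dl m v)) = leaf_op k (?M (Dl m v))" for k v
  proof -
    \<comment> \<open>\<open>serre_mult s f\<close> vanishes outside \<open>V\<close>, where the
      amplified diagonal operator need not; the two match on the range of \<open>Dl m\<close>, which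
      is supported on the vertices.\<close>
    have "E (Dl m v) = Dl m v"
      by (intro ell2_eqI) (auto simp: blinfun.diff_left coef_shift below_def proj(5))
    then show ?thesis using arg_cong[OF leaf_op_mult[OF cont, of k], of "\<lambda>T. T (Dl m v)"] by simp
  qed
  moreover have "?M (Dl m (Rpow m k v)) = Dl m (Rpow m k (?M v))" for k v
    using arg_cong[OF level_mult_commute(3)[OF f], of "\<lambda>T. T (Rpow m k v)"]
      arg_cong[OF level_mult_commute(4)[OF f, of k], of "\<lambda>T. T v"]
    by (simp only: blinfun_apply_blinfun_compose)
  ultimately have leaf: "?S (leaf_op k (Dl m (Rpow m k v))) = leaf_op k (Dl m (Rpow m k (?M v)))" for k v by simp
  have "(?S o\<^sub>L wold_op m) (ket p) = wold_sum m (Suc n) (?M (ket p))"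
    by (simp only: blinfun_apply_blinfun_compose p wold_op(2)[of n "Suc n"] lessI wold_sum_apply blinfun.sum_right leaf)
  also have "\<dots> = wold_op m (?M (ket p))"
    by (cases "(n, x) \<in> V")
      (simp_all add: p serre_mult[OF s cont] clinear_op_scale wold_op(1) wold_op(2)[of n "Suc n"])
  finally show "(wold_op m o\<^sub>L ?M) (ket p) = (?S o\<^sub>L wold_op m) (ket p)" by simp
qed (simp_all add: wold_op tensor_op locally_const_continuous[OF f])

end

section \<open>Asymptotic intertwining\<close>

text \<open>With \<open>\<K> = {0}\<close> the relation below says that \<open>A Q\<^sub>m - Q\<^sub>m B\<close> tends to zero in norm, and with the
  compact operators for \<open>\<K>\<close> that it does so in the essential norm.\<close>

locale intertwiner_family =
  fixes \<K> :: "('a ell2 \<Rightarrow>\<^sub>L 'b ell2) set" and Q :: "nat \<Rightarrow> ('a ell2 \<Rightarrow>\<^sub>L 'b ell2)"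
  assumes zero: "0 \<in> \<K>"
    and add: "K \<in> \<K> \<Longrightarrow> L \<in> \<K> \<Longrightarrow> K + L \<in> \<K>"
    and left: "K \<in> \<K> \<Longrightarrow> clinear_op A \<Longrightarrow> A o\<^sub>L K \<in> \<K>"
    and right: "K \<in> \<K> \<Longrightarrow> clinear_op B \<Longrightarrow> K o\<^sub>L B \<in> \<K>"
    and norm_Q: "norm (Q m) \<le> 1"
    and clinear_Q: "clinear_op (Q m)"
begin

definition intertwines :: "('b ell2 \<Rightarrow>\<^sub>L 'b ell2) \<Rightarrow> ('a ell2 \<Rightarrow>\<^sub>L 'a ell2) \<Rightarrow> bool"
  where "intertwines A B \<longleftrightarrow>
    (\<forall>e>0. \<exists>m0. \<forall>m\<ge>m0. \<exists>K\<in>\<K>. norm ((A o\<^sub>L Q m) - (Q m o\<^sub>L B) - K) \<le> e)"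

lemma intertwinesI:
  assumes "\<And>m. m \<ge> m0 \<Longrightarrow> (A o\<^sub>L Q m) - (Q m o\<^sub>L B) \<in> \<K>"
  shows "intertwines A B"
  unfolding intertwines_def
proof (intro allI impI exI)
  fix e :: real and m assume "0 < e" "m0 \<le> m"
  then show "\<exists>K\<in>\<K>. norm ((A o\<^sub>L Q m) - (Q m o\<^sub>L B) - K) \<le> e" by (intro bexI[OF _ assms]) auto
qed

lemma intertwines_add:
  assumes "intertwines A B" "intertwines A' B'"
  shows "intertwines (A + A') (B + B')"
  unfolding intertwines_def
proof (intro allI impI)
  fix e :: real assume "0 < e"
  then obtain m1 m2
    where m1: "\<And>m. m \<ge> m1 \<Longrightarrow> \<exists>K\<in>\<K>. norm ((A o\<^sub>L Q m) - (Q m o\<^sub>L B) - K) \<le> e / 2"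
      and m2: "\<And>m. m \<ge> m2 \<Longrightarrow> \<exists>K\<in>\<K>. norm ((A' o\<^sub>L Q m) - (Q m o\<^sub>L B') - K) \<le> e / 2"
    using assms unfolding intertwines_def by (meson half_gt_zero)
  have "\<exists>K\<in>\<K>. norm (((A + A') o\<^sub>L Q m) - (Q m o\<^sub>L (B + B')) - K) \<le> e" if mm: "max m1 m2 \<le> m" for m
  proof -
    obtain K L where K: "K \<in> \<K>" "norm ((A o\<^sub>L Q m) - (Q m o\<^sub>L B) - K) \<le> e / 2"
      and L: "L \<in> \<K>" "norm ((A' o\<^sub>L Q m) - (Q m o\<^sub>L B') - L) \<le> e / 2"
      using m1[of m] m2[of m] mm by (meson max.bounded_iff)
    have eq: "((A + A') o\<^sub>L Q m) - (Q m o\<^sub>L (B + B')) - (K + L)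
        = ((A o\<^sub>L Q m) - (Q m o\<^sub>L B) - K) + ((A' o\<^sub>L Q m) - (Q m o\<^sub>L B') - L)"
      by (simp add: blinfun_compose.add_left blinfun_compose.add_right)
    have "norm (((A + A') o\<^sub>L Q m) - (Q m o\<^sub>L (B + B')) - (K + L)) \<le> e"
      using norm_triangle_mono[OF K(2) L(2)] unfolding eq by (simp only: field_sum_of_halves)
    then show ?thesis using add[OF K(1) L(1)] by blast
  qed
  then show "\<exists>m0. \<forall>m\<ge>m0. \<exists>K\<in>\<K>. norm (((A + A') o\<^sub>L Q m) - (Q m o\<^sub>L (B + B')) - K) \<le> e" by blast
qed

text \<open>The error of a product is \<open>A\<close> times the error of the second pair plus the
  error of the first pair times \<open>B'\<close>. This is why \<open>\<K>\<close> has to absorb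
  operators on both sides, and it explains the denominator of \<open>r\<close>.\<close>

lemma intertwines_compose:
  assumes AB: "intertwines A B" "intertwines A' B'" and lin: "clinear_op A" "clinear_op B'"
  shows "intertwines (A o\<^sub>L A') (B o\<^sub>L B')"
  unfolding intertwines_def
proof (intro allI impI)
  fix e :: real assume e: "0 < e"
  define r where "r = e / (norm A + norm B' + 1)"
  have pos: "0 < norm A + norm B' + 1" by (simp add: add_nonneg_pos)
  then have r: "0 < r" using e by (simp add: r_def)
  obtain m1 m2
    where m1: "\<And>m. m \<ge> m1 \<Longrightarrow> \<exists>K\<in>\<K>. norm ((A o\<^sub>L Q m) - (Q m o\<^sub>L B) - K) \<le> r"
      and m2: "\<And>m. m \<ge> m2 \<Longrightarrow> \<exists>K\<in>\<K>. norm ((A' o\<^sub>L Q m) - (Q m o\<^sub>L B') - K) \<le> r"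
    using AB r unfolding intertwines_def by meson
  have "\<exists>K\<in>\<K>. norm (((A o\<^sub>L A') o\<^sub>L Q m) - (Q m o\<^sub>L (B o\<^sub>L B')) - K) \<le> e" if mm: "max m1 m2 \<le> m" for m
  proof -
    obtain K L where K: "K \<in> \<K>" "norm ((A o\<^sub>L Q m) - (Q m o\<^sub>L B) - K) \<le> r"
      and L: "L \<in> \<K>" "norm ((A' o\<^sub>L Q m) - (Q m o\<^sub>L B') - L) \<le> r"
      using m1[of m] m2[of m] mm by (meson max.bounded_iff)
    let ?X = "(A o\<^sub>L Q m) - (Q m o\<^sub>L B) - K" and ?Y = "(A' o\<^sub>L Q m) - (Q m o\<^sub>L B') - L"
    have eq: "((A o\<^sub>L A') o\<^sub>L Q m) - (Q m o\<^sub>L (B o\<^sub>L B')) - ((A o\<^sub>L L) + (K o\<^sub>L B')) = (A o\<^sub>L ?Y) + (?X o\<^sub>L B')"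
      by (simp add: blinfun_compose.diff_left blinfun_compose.diff_right blinfun_compose_assoc)
    have "norm (A o\<^sub>L ?Y) \<le> norm A * r" "norm (?X o\<^sub>L B') \<le> r * norm B'"
      by (rule order_trans[OF norm_blinfun_compose], intro mult_left_mono mult_right_mono K L norm_ge_zero)+
    then have "norm ((A o\<^sub>L ?Y) + (?X o\<^sub>L B')) \<le> norm A * r + r * norm B'" by (rule norm_triangle_mono)
    also have "\<dots> \<le> r * (norm A + norm B' + 1)" using r by (simp add: algebra_simps)
    also have "\<dots> = e" using pos by (simp add: r_def)
    finally show ?thesis
      unfolding eq[symmetric] using add[OF left[OF L(1) lin(1)] right[OF K(1) lin(2)]] by blast
  qed
  then show "\<exists>m0. \<forall>m\<ge>m0. \<exists>K\<in>\<K>. norm (((A o\<^sub>L A') o\<^sub>L Q m) - (Q m o\<^sub>L (B o\<^sub>L B')) - K) \<le> e" by blast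
qed

lemma intertwines_scale_id: "intertwines (scale_op c id_blinfun) (scale_op c id_blinfun)"
proof (rule intertwinesI)
  show "(scale_op c id_blinfun o\<^sub>L Q m) - (Q m o\<^sub>L scale_op c id_blinfun) \<in> \<K>" for m
    using zero by (simp add: scale_op_eq(2) scale_op_eq(3)[OF clinear_Q])
qed

lemma intertwines_scale:
  assumes "intertwines A B" "clinear_op B"
  shows "intertwines (scale_op c A) (scale_op c B)"
  using intertwines_compose[OF intertwines_scale_id[of c] assms(1)] assms(2) by (simp add: scale_op_eq(2))

text \<open>Since every \<open>Q m\<close> is a contraction, replacing \<open>A\<close> and
  \<open>B\<close> by approximations costs an error that does not depend on
  \<open>m\<close>.\<close>

lemma intertwines_limit:
  assumes lim: "\<And>e. 0 < e \<Longrightarrow> \<exists>A' B'. intertwines A' B' \<and> norm (A - A') \<le> e \<and> norm (B - B') \<le> e"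
  shows "intertwines A B"
  unfolding intertwines_def
proof (intro allI impI)
  fix e :: real assume "0 < e"
  then obtain A' B' where AB: "intertwines A' B'" and d: "norm (A - A') \<le> e / 3" "norm (B - B') \<le> e / 3"
    using lim[of "e / 3"] by auto
  obtain m0 where m0: "\<And>m. m \<ge> m0 \<Longrightarrow> \<exists>K\<in>\<K>. norm ((A' o\<^sub>L Q m) - (Q m o\<^sub>L B') - K) \<le> e / 3"
    using AB \<open>0 < e\<close> unfolding intertwines_def by (metis divide_pos_pos zero_less_numeral)
  have "\<exists>K\<in>\<K>. norm ((A o\<^sub>L Q m) - (Q m o\<^sub>L B) - K) \<le> e" if mm: "m0 \<le> m" for m
  proof -
    obtain K where K: "K \<in> \<K>" "norm ((A' o\<^sub>L Q m) - (Q m o\<^sub>L B') - K) \<le> e / 3" using m0[OF mm] by blast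
    have 1: "norm ((A - A') o\<^sub>L Q m) \<le> e / 3"
      using order_trans[OF norm_blinfun_compose mult_mono[OF d(1) norm_Q]] \<open>0 < e\<close> by simp
    have 2: "norm (Q m o\<^sub>L (B - B')) \<le> e / 3"
      using order_trans[OF norm_blinfun_compose mult_mono[OF norm_Q d(2)]] by simp
    have eq: "(A o\<^sub>L Q m) - (Q m o\<^sub>L B) - K
        = ((A - A') o\<^sub>L Q m) - (Q m o\<^sub>L (B - B')) + ((A' o\<^sub>L Q m) - (Q m o\<^sub>L B') - K)"
      by (simp add: blinfun_compose.diff_left blinfun_compose.diff_right)
    have "norm ((A o\<^sub>L Q m) - (Q m o\<^sub>L B) - K) \<le> e / 3 + e / 3 + e / 3"
      unfolding eq by (rule order_trans[OF norm_diff_add_le add_mono[OF add_mono[OF 1 2] K(2)]])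
    then have "norm ((A o\<^sub>L Q m) - (Q m o\<^sub>L B) - K) \<le> e" by simp
    then show ?thesis using K(1) by blast
  qed
  then show "\<exists>m0. \<forall>m\<ge>m0. \<exists>K\<in>\<K>. norm ((A o\<^sub>L Q m) - (Q m o\<^sub>L B) - K) \<le> e" by blast
qed

end

context serre
begin

interpretation branch: intertwiner_family "{0}" branch_op
  by unfold_locales (auto simp: branch_op)

interpretation wold: intertwiner_family "{K. compact_op K}" wold_op
  by unfold_locales (auto simp: wold_op compact_op_add intro: compact_op_compose_left compact_op_compose_right)

section \<open>The symbol map\<close>

abbreviation "\<C> \<equiv> cstar_tensor toeplitz_algebra (function_algebra Z)"

lemma cstar_toeplitz: "cstar_algebra toeplitz_algebra"
  unfolding toeplitz_algebra_def by (rule cstar_generated) auto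

lemma toeplitz_gen_in: "toeplitz_gen \<in> toeplitz_algebra"
  unfolding toeplitz_algebra_def by (rule subsetD[OF cstar_generated_subset]) simp

lemma id_in_toeplitz: "id_blinfun \<in> toeplitz_algebra"
  using cstar_algebraD(4,6)[OF cstar_toeplitz] toeplitz_gen_in toeplitz_isometry by metis

lemma coef_diag_sadic:
  assumes "continuous_on Z f"
  shows "coef (diag_op Z f v) a = (if a \<in> Z then f a * coef v a else 0)"
proof -
  obtain B where "\<And>a. a \<in> Z \<Longrightarrow> cmod (f a) \<le> B" using sadic_bounded[OF assms] by metis
  then show ?thesis by (rule coef_diag_op)
qed

lemma adj_diag_sadic:
  assumes "continuous_on Z f"
  shows "adj (diag_op Z f) = diag_op Z (\<lambda>a. cnj (f a))"
proof -
  obtain B where "\<And>a. a \<in> Z \<Longrightarrow> cmod (f a) \<le> B" using sadic_bounded[OF assms] by metis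
  then show ?thesis by (rule adj_diag_op)
qed

lemma cstar_symbols: "cstar_algebra \<C>"
proof (rule cstar_algebra_tensor[OF cstar_toeplitz])
  fix b assume "b \<in> function_algebra Z"
  then obtain f where f: "continuous_on Z f" "b = diag_op Z f" by (auto simp: function_algebra_def)
  show "clinear_op b" using f by simp
  show "adj b \<in> function_algebra Z"
    unfolding f(2) adj_diag_sadic[OF f(1)] function_algebra_def
    using f(1) by (auto intro!: exI[of _ "\<lambda>a. cnj (f a)"] continuous_intros)
  fix b' assume "b' \<in> function_algebra Z"
  then obtain g where g: "continuous_on Z g" "b' = diag_op Z g" by (auto simp: function_algebra_def)
  have fg: "continuous_on Z (\<lambda>a. f a * g a)" using f g by (intro continuous_intros)
  have "b o\<^sub>L b' = diag_op Z (\<lambda>a. f a * g a)"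
    unfolding f(2) g(2)
    by (intro blinfun_eqI ell2_eqI) (simp add: coef_diag_sadic f(1) g(1) coef_diag_sadic[OF fg])
  then show "b o\<^sub>L b' \<in> function_algebra Z" unfolding function_algebra_def using fg by blast
qed

lemma tensor_in_symbols:
  "a \<in> toeplitz_algebra \<Longrightarrow> continuous_on Z f \<Longrightarrow> tensor_op a (diag_op Z f) \<in> \<C>"
  unfolding cstar_tensor_def function_algebra_def
  by (rule subsetD[OF closure_subset], rule span_base) blast

text \<open>This projection is the unit of the tensor product and also the initial projection of
  every \<open>branch_op N\<close>, so a symbol can be recovered by cancelling
  \<open>branch_op N\<close>.\<close>

lemma symbols_corner:
  assumes "T \<in> \<C>"
  shows "proj (UNIV \<times> Z) o\<^sub>L T = T"
proof -
  let ?C = "{T. proj (UNIV \<times> Z) o\<^sub>L T = T}"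
  have "closed ?C" by (intro closed_Collect_eq continuous_intros)
  moreover have "subspace ?C"
    by (auto simp: subspace_def blinfun_compose.add_right blinfun_compose.scaleR_right)
  moreover have "tensor_op a b \<in> ?C" if ab: "a \<in> toeplitz_algebra" "b \<in> function_algebra Z" for a b
  proof -
    obtain f where f: "continuous_on Z f" "b = diag_op Z f" using ab(2) by (auto simp: function_algebra_def)
    have a: "clinear_op a" using cstar_algebraD(1)[OF cstar_toeplitz ab(1)] .
    have "proj ((UNIV :: nat set) \<times> Z) = tensor_op id_blinfun (proj Z)"
      by (subst tensor_op_id_diag[where B = 1]) (auto simp: case_prod_unfold)
    moreover have "proj Z o\<^sub>L b = b"
      unfolding f(2) by (intro blinfun_eqI ell2_eqI) (simp add: coef_diag_sadic f(1))
    ultimately show ?thesis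
      using tensor_op_compose[OF clinear_op_intros(2) a proj(1)[of Z], of b] f by simp
  qed
  ultimately have "\<C> \<subseteq> ?C"
    unfolding cstar_tensor_def by (intro closure_minimal span_minimal) auto
  then show ?thesis using assms by auto
qed

text \<open>The branches determine \<open>T\<close> from \<open>a\<close> and give \<open>\<parallel>T\<parallel> \<le> \<parallel>a\<parallel>\<close>; the Wold decompositions bound the
  distance from \<open>a\<close> to the compact operators by \<open>\<parallel>T\<parallel>\<close>. The conditions on the adjoints are not formal
  consequences of the others, since the ranges of the intertwiners need not be invariant.\<close>

definition symbol_of :: "((nat \<times> int) ell2 \<Rightarrow>\<^sub>L (nat \<times> int) ell2) \<Rightarrow> ((nat \<times> (nat \<Rightarrow> int)) ell2 \<Rightarrow>\<^sub>L (nat \<times> (nat \<Rightarrow> int)) ell2) \<Rightarrow> bool"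
  where "symbol_of a T \<longleftrightarrow> clinear_op a \<and> T \<in> \<C> \<and>
    branch.intertwines (tensor_op a id_blinfun) T \<and> wold.intertwines (ampl T) a \<and>
    branch.intertwines (tensor_op (adj a) id_blinfun) (adj T) \<and> wold.intertwines (ampl (adj T)) (adj a)"

lemma symbol_of_clinear:
  assumes "symbol_of a T"
  shows "clinear_op a" "clinear_op T" "T \<in> \<C>"
  using assms cstar_algebraD(1)[OF cstar_symbols] by (auto simp: symbol_of_def)

lemma symbol_of_add:
  assumes "symbol_of a T" "symbol_of b U"
  shows "symbol_of (a + b) (T + U)"
  using assms symbol_of_clinear[OF assms(1)] symbol_of_clinear[OF assms(2)] cstar_algebraD(3)[OF cstar_symbols]
  unfolding symbol_of_def
  by (simp add: adj_add tensor_op_linear(1) branch.intertwines_add wold.intertwines_add)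

lemma tensor_op_id_compose:
  "clinear_op a \<Longrightarrow> clinear_op b \<Longrightarrow>
    tensor_op (a o\<^sub>L b) id_blinfun = tensor_op a id_blinfun o\<^sub>L tensor_op b id_blinfun"
  using tensor_op_compose[of a b id_blinfun id_blinfun] by simp

lemma symbol_of_compose:
  assumes "symbol_of a T" "symbol_of b U"
  shows "symbol_of (a o\<^sub>L b) (T o\<^sub>L U)"
  using assms symbol_of_clinear[OF assms(1)] symbol_of_clinear[OF assms(2)] cstar_algebraD(4)[OF cstar_symbols]
  unfolding symbol_of_def
  by (simp add: adj_compose tensor_op_id_compose tensor_op branch.intertwines_compose wold.intertwines_compose)

lemma symbol_of_scale:
  assumes "symbol_of a T"
  shows "symbol_of (scale_op c a) (scale_op c T)"
  using assms symbol_of_clinear[OF assms(1)] cstar_algebraD(5)[OF cstar_symbols]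
  unfolding symbol_of_def
  by (simp add: adj_scale tensor_op_scale_left branch.intertwines_scale wold.intertwines_scale)

lemma symbol_of_adj:
  assumes "symbol_of a T"
  shows "symbol_of (adj a) (adj T)"
  using assms symbol_of_clinear[OF assms(1)] cstar_algebraD(6)[OF cstar_symbols]
  unfolding symbol_of_def by simp

lemma symbol_of_diff:
  assumes "symbol_of a T" "symbol_of b U"
  shows "symbol_of (a - b) (T - U)"
proof -
  show ?thesis
    unfolding minus_eq_scale by (intro symbol_of_add symbol_of_scale assms)
qed

lemma symbol_of_limit:
  assumes a: "clinear_op a" and T: "T \<in> \<C>"
    and lim: "\<And>e. 0 < e \<Longrightarrow> \<exists>a' T'. symbol_of a' T' \<and> norm (a - a') \<le> e \<and> norm (T - T') \<le> e"
  shows "symbol_of a T"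
proof -
  have lT: "clinear_op T" using cstar_algebraD(1)[OF cstar_symbols T] .
  show ?thesis
    unfolding symbol_of_def
  proof (intro conjI a T)
    show "branch.intertwines (tensor_op a id_blinfun) T"
    proof (rule branch.intertwines_limit)
      fix e :: real assume "0 < e"
      then obtain a' T' where *: "symbol_of a' T'" "norm (a - a') \<le> e" "norm (T - T') \<le> e" using lim by blast
      then show "\<exists>A' B'. branch.intertwines A' B' \<and> norm (tensor_op a id_blinfun - A') \<le> e \<and> norm (T - B') \<le> e"
        using order_trans[OF norm_tensor_diff_le[OF a symbol_of_clinear(1)[OF *(1)]] *(2)]
        unfolding symbol_of_def by blast
    qed
    show "wold.intertwines (ampl T) a"
    proof (rule wold.intertwines_limit)
      fix e :: real assume "0 < e"
      then obtain a' T' where *: "symbol_of a' T'" "norm (a - a') \<le> e" "norm (T - T') \<le> e" using lim by blast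
      then show "\<exists>A' B'. wold.intertwines A' B' \<and> norm (ampl T - A') \<le> e \<and> norm (a - B') \<le> e"
        using order_trans[OF norm_tensor_diff_le[OF lT symbol_of_clinear(2)[OF *(1)]] *(3)]
        unfolding symbol_of_def by blast
    qed
    have lim': "\<exists>a' T'. symbol_of a' T' \<and> norm (adj a - adj a') \<le> e \<and> norm (adj T - adj T') \<le> e" if "0 < e" for e
    proof -
      obtain a' T' where *: "symbol_of a' T'" "norm (a - a') \<le> e" "norm (T - T') \<le> e" using lim[OF \<open>0 < e\<close>] by blast
      note l = symbol_of_clinear[OF *(1)]
      show ?thesis
        using * l by (intro exI[of _ a'] exI[of _ T']) (simp add: a lT norm_adj flip: adj_diff)
    qed
    show "branch.intertwines (tensor_op (adj a) id_blinfun) (adj T)"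
    proof (rule branch.intertwines_limit)
      fix e :: real assume "0 < e"
      then obtain a' T' where *: "symbol_of a' T'" "norm (adj a - adj a') \<le> e" "norm (adj T - adj T') \<le> e" using lim' by blast
      then show "\<exists>A' B'. branch.intertwines A' B' \<and> norm (tensor_op (adj a) id_blinfun - A') \<le> e \<and> norm (adj T - B') \<le> e"
        using order_trans[OF norm_tensor_diff_le[OF clinear_adj[OF a] clinear_adj[OF symbol_of_clinear(1)[OF *(1)]]] *(2)]
        unfolding symbol_of_def by blast
    qed
    show "wold.intertwines (ampl (adj T)) (adj a)"
    proof (rule wold.intertwines_limit)
      fix e :: real assume "0 < e"
      then obtain a' T' where *: "symbol_of a' T'" "norm (adj a - adj a') \<le> e" "norm (adj T - adj T') \<le> e" using lim' by blast
      then show "\<exists>A' B'. wold.intertwines A' B' \<and> norm (ampl (adj T) - A') \<le> e \<and> norm (adj a - B') \<le> e"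
        using order_trans[OF norm_tensor_diff_le[OF clinear_adj[OF lT] clinear_adj[OF symbol_of_clinear(2)[OF *(1)]]] *(3)]
        unfolding symbol_of_def by blast
    qed
  qed
qed

text \<open>\<open>T\<close> is the adjoint of \<open>branch_op N\<close> applied to the product of
  \<open>branch_op N\<close> and \<open>T\<close>, and that product is close to the one of
  \<open>A\<close> and \<open>branch_op N\<close>. The bound is asked for large \<open>N\<close>
  only, which for compact operators allows arbitrarily small \<open>r\<close>.\<close>

lemma branch_norm_le:
  assumes "T \<in> \<C>" "branch.intertwines A T" "\<exists>N0. \<forall>N\<ge>N0. norm (A o\<^sub>L branch_op N) \<le> r"
  shows "norm T \<le> r"
proof (rule field_le_epsilon)
  fix e :: real assume e: "0 < e"
  obtain N1 where N1: "\<And>N. N \<ge> N1 \<Longrightarrow> norm ((A o\<^sub>L branch_op N) - (branch_op N o\<^sub>L T)) \<le> e"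
    using assms(2) e unfolding branch.intertwines_def by auto
  obtain N2 where N2: "\<And>N. N \<ge> N2 \<Longrightarrow> norm (A o\<^sub>L branch_op N) \<le> r" using assms(3) by blast
  define N where "N = max N1 N2"
  have "T = adj (branch_op N) o\<^sub>L (branch_op N o\<^sub>L T)"
    using symbols_corner[OF assms(1)] by (simp add: branch_op(4) flip: blinfun_compose_assoc)
  then have "norm T \<le> norm (adj (branch_op N)) * norm (branch_op N o\<^sub>L T)"
    by (metis norm_blinfun_compose)
  also have "\<dots> \<le> 1 * norm (branch_op N o\<^sub>L T)"
    by (intro mult_right_mono) (simp_all add: norm_adj branch_op)
  also have "norm (branch_op N o\<^sub>L T) \<le> norm (A o\<^sub>L branch_op N) + norm ((A o\<^sub>L branch_op N) - (branch_op N o\<^sub>L T))"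
    using norm_triangle_sub[of "branch_op N o\<^sub>L T" "A o\<^sub>L branch_op N"] by (simp add: norm_minus_commute)
  also have "\<dots> \<le> r + e" using N1[of N] N2[of N] by (intro add_mono) (auto simp: N_def)
  finally show "norm T \<le> r + e" by simp
qed

lemma symbol_norm_le:
  assumes "symbol_of a T"
  shows "norm T \<le> norm a"
proof (rule branch_norm_le)
  show "T \<in> \<C>" "branch.intertwines (tensor_op a id_blinfun) T" using assms by (simp_all add: symbol_of_def)
  have "norm (tensor_op a id_blinfun o\<^sub>L branch_op N) \<le> norm a" for N
  proof -
    have "norm (tensor_op a id_blinfun o\<^sub>L branch_op N) \<le> norm a * 1"
      by (intro order_trans[OF norm_blinfun_compose] mult_mono norm_tensor_op_id_le branch_op symbol_of_clinear(1)[OF assms]) auto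
    then show ?thesis by simp
  qed
  then show "\<exists>N0. \<forall>N\<ge>N0. norm (tensor_op a id_blinfun o\<^sub>L branch_op N) \<le> norm a" by blast
qed

lemma symbol_of_unique: "symbol_of a T \<Longrightarrow> symbol_of a U \<Longrightarrow> T = U"
  using symbol_norm_le[OF symbol_of_diff[of a T a U]] by simp

text \<open>Up to \<open>e\<close> the operator factors through a finite coordinate projection,
  whose amplification annihilates all deep branches.\<close>

lemma symbol_of_compact:
  assumes sym: "symbol_of a T" and a: "compact_op a"
  shows "T = 0"
proof -
  have "norm T \<le> 0"
  proof (rule field_le_epsilon)
    fix e :: real assume "0 < e"
    then obtain G where G: "finite G" "norm (a - (a o\<^sub>L proj G)) \<le> e" using compact_op_approx_right[OF a] by blast
    obtain N0 where N0: "\<And>N. N \<ge> N0 \<Longrightarrow> tensor_op (proj G) id_blinfun o\<^sub>L branch_op N = 0"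
      using branch_op_finite[OF G(1)] by blast
    have "norm (tensor_op a id_blinfun o\<^sub>L branch_op N) \<le> e" if "N \<ge> N0" for N
    proof -
      have "tensor_op (a - (a o\<^sub>L proj G)) id_blinfun o\<^sub>L branch_op N
          = (tensor_op a id_blinfun o\<^sub>L branch_op N) - (tensor_op a id_blinfun o\<^sub>L (tensor_op (proj G) id_blinfun o\<^sub>L branch_op N))"
        using a by (simp add: tensor_op_linear(2) tensor_op_id_compose blinfun_compose.diff_left blinfun_compose_assoc)
      then have "tensor_op a id_blinfun o\<^sub>L branch_op N = tensor_op (a - (a o\<^sub>L proj G)) id_blinfun o\<^sub>L branch_op N"
        using N0[OF that] by simp
      also have "norm \<dots> \<le> norm (a - (a o\<^sub>L proj G)) * 1"
        using a by (intro order_trans[OF norm_blinfun_compose] mult_mono norm_tensor_op_id_le branch_op) auto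
      finally show ?thesis using G(2) by simp
    qed
    then have "norm T \<le> e"
      using sym unfolding symbol_of_def by (intro branch_norm_le[of T "tensor_op a id_blinfun"]) auto
    then show "norm T \<le> 0 + e" by simp
  qed
  then show ?thesis by simp
qed

text \<open>On all but finitely many vertices \<open>wold_op m\<close> is isometric, and it
  intertwines \<open>a\<close> with the amplification of \<open>T\<close> up to a compact and a
  small error; so \<open>a\<close> differs from a compression of that amplification by the same
  kinds of error.\<close>

lemma compact_approx_symbol:
  assumes sym: "symbol_of a T" and E: "E o\<^sub>L a = a" "a o\<^sub>L E = a" and e: "0 < e"
  shows "\<exists>K. compact_op K \<and> K \<in> serre_algebra s \<and> norm (a - K) \<le> norm T + e"
proof -
  note lin = symbol_of_clinear[OF sym]
  obtain m K where K: "compact_op K" "norm ((ampl T o\<^sub>L wold_op m) - (wold_op m o\<^sub>L a) - K) \<le> e"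
    using sym e unfolding symbol_of_def wold.intertwines_def by blast
  let ?J = "wold_op m" and ?F = "V - below m"
  have J: "clinear_op ?J" "clinear_op (adj ?J)" "norm (adj ?J) \<le> 1" by (simp_all add: wold_op norm_adj)
  have "?F \<subseteq> (\<Union>n<m. {n} \<times> {0..<s ^ n})" by (auto simp: below_def vertices_iff)
  then have fin: "finite ?F" by (rule finite_subset) auto
  have bV: "below m \<subseteq> V" by (auto simp: below_def)
  \<comment> \<open>It collects the low levels and the compact error, so that \<open>a - L\<close>
    is a compression of \<open>ampl T\<close> up to an operator of norm at most
    \<open>e\<close>.\<close>
  define L where "L = (proj ?F o\<^sub>L a) - (adj ?J o\<^sub>L K)"
  have L: "compact_op L"
    unfolding L_def using K lin J fin
    by (intro compact_op_diff compact_op_compose_left compact_op_compose_right) auto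
  have "a - (proj ?F o\<^sub>L a) = proj (below m) o\<^sub>L a"
  proof -
    have "E = proj ?F + proj (below m)"
      using bV by (auto intro!: blinfun_eqI ell2_eqI simp: blinfun.add_left proj(5))
    then have "E o\<^sub>L a = (proj ?F o\<^sub>L a) + (proj (below m) o\<^sub>L a)" by (metis blinfun_compose.add_left)
    then show ?thesis unfolding E(1) diff_eq_eq by (simp only: add.commute)
  qed
  then have "a - L = (adj ?J o\<^sub>L (?J o\<^sub>L a)) + (adj ?J o\<^sub>L K)"
    unfolding L_def blinfun_compose_assoc[symmetric] wold_op(4) by (simp add: algebra_simps)
  also have "\<dots> = (adj ?J o\<^sub>L (ampl T o\<^sub>L ?J)) - (adj ?J o\<^sub>L ((ampl T o\<^sub>L ?J) - (?J o\<^sub>L a) - K))"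
    by (simp add: blinfun_compose.diff_right)
  also have "norm \<dots> \<le> norm T + e"
  proof (rule order_trans[OF norm_triangle_ineq4 add_mono])
    have *: "norm (adj ?J o\<^sub>L X) \<le> norm X" for X :: "(nat \<times> int) ell2 \<Rightarrow>\<^sub>L _"
      using order_trans[OF norm_blinfun_compose mult_right_mono[OF J(3) norm_ge_zero]] by simp
    have "norm (adj ?J o\<^sub>L (ampl T o\<^sub>L ?J)) \<le> norm (ampl T) * norm ?J"
      by (rule order_trans[OF * norm_blinfun_compose])
    also have "\<dots> \<le> norm T * 1"
      using lin by (intro mult_mono norm_tensor_op_id_le wold_op) auto
    finally show "norm (adj ?J o\<^sub>L (ampl T o\<^sub>L ?J)) \<le> norm T" by simp
    show "norm (adj ?J o\<^sub>L ((ampl T o\<^sub>L ?J) - (?J o\<^sub>L a) - K)) \<le> e" using * K(2) by (rule order_trans)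
  qed
  finally have aL: "norm (a - L) \<le> norm T + e" .
  \<comment> \<open>Cutting down to the vertices puts the compact operator into the algebra; since
    \<open>E\<close> is a two-sided unit for \<open>a\<close>, the distance does not grow.\<close>
  define K' where "K' = E o\<^sub>L L o\<^sub>L E"
  have K': "compact_op K'"
    unfolding K'_def using L by (intro compact_op_compose_left compact_op_compose_right) auto
  have "E (E v) = E v" for v by (auto intro!: ell2_eqI)
  then have "E o\<^sub>L K' = K'" "K' o\<^sub>L E = K'"
    unfolding K'_def by (auto intro!: blinfun_eqI)
  then have "K' \<in> serre_algebra s" using compact_in[OF K'] by blast
  moreover have "a - K' = E o\<^sub>L (a - L) o\<^sub>L E"
    unfolding K'_def by (simp add: blinfun_compose.diff_left blinfun_compose.diff_right E)
  then have "norm (a - K') \<le> norm T + e"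
    using order_trans[OF norm_compose_proj_le[of "E o\<^sub>L (a - L)" V] order_trans[OF norm_proj_compose_le aL]] by simp
  ultimately show ?thesis using K' by blast
qed

section \<open>Symbols of the generators\<close>

lemma symbol_of_shift: "symbol_of W (tensor_op toeplitz_gen (proj Z))"
proof -
  let ?T = "tensor_op toeplitz_gen (proj Z)"
  have adjT: "adj ?T = tensor_op (adj toeplitz_gen) (proj Z)" by (simp add: adj_tensor_op)
  have "?T \<in> \<C>" by (rule tensor_in_symbols[OF toeplitz_gen_in]) (rule continuous_on_const)
  moreover have "branch.intertwines (tensor_op W id_blinfun) ?T"
    by (rule branch.intertwinesI) (simp add: branch_op_shift)
  moreover have "branch.intertwines (tensor_op (adj W) id_blinfun) (adj ?T)"
    unfolding adjT by (rule branch.intertwinesI) (simp add: branch_op_adj_shift)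
  moreover have "wold.intertwines (ampl ?T) W"
    by (rule wold.intertwinesI) (use compact_op_diff[OF compact_op_0 wold_op_shift] in simp)
  moreover have "wold.intertwines (ampl (adj ?T)) (adj W)"
    unfolding adjT by (rule wold.intertwinesI) (simp add: wold_op_adj_shift)
  ultimately show ?thesis unfolding symbol_of_def by simp
qed

lemma symbol_of_locally_const:
  assumes f: "locally_const m f"
  shows "symbol_of (serre_mult s f) (tensor_op id_blinfun (diag_op Z f))"
proof -
  have half: "branch.intertwines (tensor_op (serre_mult s f) id_blinfun) (tensor_op id_blinfun (diag_op Z f))"
    "wold.intertwines (ampl (tensor_op id_blinfun (diag_op Z f))) (serre_mult s f)" if f: "locally_const m f" for f
  proof -
    show "branch.intertwines (tensor_op (serre_mult s f) id_blinfun) (tensor_op id_blinfun (diag_op Z f))"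
      by (rule branch.intertwinesI[of m]) (simp add: branch_op_mult[OF f])
    have "locally_const k f" if "m \<le> k" for k
      using f that unfolding locally_const_def by (metis sadic_mod)
    then show "wold.intertwines (ampl (tensor_op id_blinfun (diag_op Z f))) (serre_mult s f)"
      by (intro wold.intertwinesI[of m]) (simp add: wold_op_mult)
  qed
  note cont = locally_const_continuous[OF f]
  have cf: "locally_const m (\<lambda>a. cnj (f a))"
    using f unfolding locally_const_def complex_cnj_cancel_iff .
  have "adj (tensor_op (id_blinfun :: nat ell2 \<Rightarrow>\<^sub>L nat ell2) (diag_op Z f)) = tensor_op id_blinfun (diag_op Z (\<lambda>a. cnj (f a)))"
    using cont by (simp add: adj_tensor_op adj_diag_sadic)
  then show ?thesis
    unfolding symbol_of_def adj_mult[OF cont]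
    using half[OF f] half[OF cf] cont tensor_in_symbols[OF id_in_toeplitz cont] by simp
qed

text \<open>The intertwining relations were shown for locally constant functions; both operators
  depend contractively on \<open>f\<close>, so uniform approximation suffices.\<close>

lemma symbol_of_mult:
  assumes f: "continuous_on Z f"
  shows "symbol_of (serre_mult s f) (tensor_op id_blinfun (diag_op Z f))"
proof (rule symbol_of_limit)
  show "clinear_op (serre_mult s f)" using f by simp
  show "tensor_op id_blinfun (diag_op Z f) \<in> \<C>" by (rule tensor_in_symbols[OF id_in_toeplitz f])
  fix e :: real assume e: "0 < e"
  obtain m where m: "\<And>a. a \<in> Z \<Longrightarrow> cmod (f (sadic_of_int s (a m)) - f a) \<le> e"
    using sadic_uniform[OF f e] by metis
  let ?g = "\<lambda>a. f (sadic_of_int s (a m))"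
  have g: "locally_const m ?g" by (rule locally_const_approx)
  note cg = locally_const_continuous[OF g]
  have le: "cmod (f a - ?g a) \<le> e" if "a \<in> Z" for a using m[OF that] by (simp add: norm_minus_commute)
  have "norm (serre_mult s f - serre_mult s ?g) \<le> e"
    using e by (intro norm_mult_diff_le f cg le) auto
  moreover have "norm (tensor_op id_blinfun (diag_op Z f) - tensor_op id_blinfun (diag_op Z ?g) ::
      (nat \<times> (nat \<Rightarrow> int)) ell2 \<Rightarrow>\<^sub>L _) \<le> e"
  proof -
    have d: "diag_op Z f - diag_op Z ?g = diag_op Z (\<lambda>a. f a - ?g a)"
      using coef_diag_op[of Z "\<lambda>a. f a - ?g a" e, OF le]
      by (intro blinfun_eqI ell2_eqI)
        (simp add: blinfun.diff_left coef_diag_sadic[OF f] coef_diag_sadic[OF cg] left_diff_distrib)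
    have D: "tensor_op id_blinfun (diag_op Z f) - tensor_op id_blinfun (diag_op Z ?g) =
        (tensor_op id_blinfun (diag_op Z f - diag_op Z ?g) :: (nat \<times> (nat \<Rightarrow> int)) ell2 \<Rightarrow>\<^sub>L _)"
      by (rule sym, rule tensor_op_eqI)
        (use f cg in \<open>simp_all add: tensor_op tensor_op_ket blinfun.diff_left tensor_ell2.diff_right\<close>)
    have t: "tensor_op id_blinfun (diag_op Z (\<lambda>a. f a - ?g a)) = diag_op (UNIV \<times> Z) (\<lambda>(i :: nat, a). f a - ?g a)"
      by (rule tensor_op_id_diag[OF le less_imp_le[OF e]])
    show ?thesis
      unfolding D d t using le e by (intro diag_op(3)) auto
  qed
  ultimately show "\<exists>a' T'. symbol_of a' T' \<and> norm (serre_mult s f - a') \<le> e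
      \<and> norm (tensor_op id_blinfun (diag_op Z f) - T') \<le> e"
    using symbol_of_locally_const[OF g] by blast
qed

text \<open>The operators with a symbol form a C*-algebra containing the generators. It is closed
  because the symbol is norm-decreasing, so the symbols of a convergent sequence form a Cauchy
  sequence.\<close>

lemma symbol_exists:
  assumes "a \<in> serre_algebra s"
  shows "\<exists>T. symbol_of a T"
proof -
  let ?G = "{a. \<exists>T. symbol_of a T}"
  have "cstar_algebra ?G"
    unfolding cstar_algebra_def
  proof (intro conjI ballI allI)
    have "symbol_of (scale_op 0 W) (scale_op 0 (tensor_op toeplitz_gen (proj Z)))"
      by (rule symbol_of_scale[OF symbol_of_shift])
    moreover have "scale_op 0 W = 0" by (rule blinfun_eqI) (simp add: scale_op_apply)
    ultimately show "0 \<in> ?G" by auto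
    show "closed ?G"
      unfolding closed_sequential_limits
    proof (intro allI impI, elim conjE)
      fix X a assume X: "\<forall>n. X n \<in> ?G" "X \<longlonglongrightarrow> a"
      have "\<forall>n. \<exists>T. symbol_of (X n) T" using X(1) by simp
      from choice[OF this] obtain T where T: "\<And>n. symbol_of (X n) (T n)" by blast
      have "Cauchy T"
      proof (rule metric_CauchyI)
        fix e :: real assume "0 < e"
        then obtain M where M: "\<And>m n. m \<ge> M \<Longrightarrow> n \<ge> M \<Longrightarrow> dist (X m) (X n) < e"
          using metric_CauchyD[OF LIMSEQ_imp_Cauchy[OF X(2)]] by blast
        have "dist (T m) (T n) < e" if "m \<ge> M" "n \<ge> M" for m n
          using M[OF that] symbol_norm_le[OF symbol_of_diff[OF T T], of m n] by (simp add: dist_norm)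
        then show "\<exists>M. \<forall>m\<ge>M. \<forall>n\<ge>M. dist (T m) (T n) < e" by blast
      qed
      then obtain U where U: "T \<longlonglongrightarrow> U" by (auto simp: Cauchy_convergent_iff convergent_def)
      have "symbol_of a U"
      proof (rule symbol_of_limit)
        have "a \<in> {a. clinear_op a}"
          by (rule closed_sequentially[OF closed_clinear_op _ X(2)]) (use symbol_of_clinear[OF T] in simp)
        then show "clinear_op a" by simp
        show "U \<in> \<C>"
          by (rule closed_sequentially[OF cstar_algebraD(7)[OF cstar_symbols] _ U]) (rule symbol_of_clinear(3)[OF T])
        fix e :: real assume e: "0 < e"
        have "\<forall>\<^sub>F n in sequentially. dist (X n) a < e \<and> dist (T n) U < e"
          using X(2) U e by (intro eventually_conj) (auto dest: tendstoD)
        then obtain n where "dist (X n) a < e" "dist (T n) U < e"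
          using eventually_happens by fastforce
        then show "\<exists>a' T'. symbol_of a' T' \<and> norm (a - a') \<le> e \<and> norm (U - T') \<le> e"
          using T[of n] by (intro exI[of _ "X n"] exI[of _ "T n"]) (simp add: dist_norm norm_minus_commute)
      qed
      then show "a \<in> ?G" by blast
    qed
    fix a assume a: "a \<in> ?G"
    then show "clinear_op a" using symbol_of_clinear by blast
    show "scale_op c a \<in> ?G" for c using a symbol_of_scale by blast
    show "adj a \<in> ?G" using a symbol_of_adj by blast
    fix b assume b: "b \<in> ?G"
    show "a + b \<in> ?G" using a b symbol_of_add by blast
    show "a o\<^sub>L b \<in> ?G" using a b symbol_of_compose by blast
  qed
  then have "serre_algebra s \<subseteq> ?G"
    unfolding serre_algebra_def
    by (rule cstar_generated_minimal) (use symbol_of_shift symbol_of_mult in blast)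
  then show ?thesis using assms by blast
qed

definition symbol :: "((nat \<times> int) ell2 \<Rightarrow>\<^sub>L (nat \<times> int) ell2) \<Rightarrow> ((nat \<times> (nat \<Rightarrow> int)) ell2 \<Rightarrow>\<^sub>L (nat \<times> (nat \<Rightarrow> int)) ell2)"
  where "symbol a = (THE T. symbol_of a T)"

lemma symbol_eq: "symbol_of a T \<Longrightarrow> symbol a = T"
  unfolding symbol_def using symbol_of_unique by blast

lemma symbol_of_symbol: "a \<in> serre_algebra s \<Longrightarrow> symbol_of a (symbol a)"
  using symbol_exists symbol_eq by metis

section \<open>Exactness\<close>

lemma symbol_star_hom: "star_hom (serre_algebra s) \<C> symbol"
  unfolding star_hom_def
proof (intro conjI ballI allI)
  fix a assume a: "a \<in> serre_algebra s"
  note sa = symbol_of_symbol[OF a]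
  show "symbol a \<in> \<C>" by (rule symbol_of_clinear(3)[OF sa])
  show "symbol (scale_op c a) = scale_op c (symbol a)" for c by (rule symbol_eq[OF symbol_of_scale[OF sa]])
  show "symbol (adj a) = adj (symbol a)" by (rule symbol_eq[OF symbol_of_adj[OF sa]])
  fix b assume b: "b \<in> serre_algebra s"
  note sb = symbol_of_symbol[OF b]
  show "symbol (a + b) = symbol a + symbol b" by (rule symbol_eq[OF symbol_of_add[OF sa sb]])
  show "symbol (a o\<^sub>L b) = symbol a o\<^sub>L symbol b" by (rule symbol_eq[OF symbol_of_compose[OF sa sb]])
qed

lemma symbol_kernel:
  assumes a: "a \<in> serre_algebra s"
  shows "symbol a = 0 \<longleftrightarrow> compact_op a"
proof
  assume "symbol a = 0"
  note corner = serre_algebra_corner[OF a]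
  show "compact_op a"
  proof (rule compact_op_limit[OF corner(1)])
    fix e :: real assume "0 < e"
    then show "\<exists>U. compact_op U \<and> norm (a - U) \<le> e"
      using compact_approx_symbol[OF symbol_of_symbol[OF a] corner(2,3)] \<open>symbol a = 0\<close> by auto
  qed
next
  assume "compact_op a"
  then show "symbol a = 0" using symbol_of_compact[OF symbol_of_symbol[OF a]] by simp
qed

text \<open>Subtracting a compact element of the algebra does not change the symbol, and
  \<open>compact_approx_symbol\<close> supplies one that brings the norm down.\<close>

lemma symbol_lift:
  assumes a: "a \<in> serre_algebra s" and e: "0 < e"
  shows "\<exists>b\<in>serre_algebra s. symbol b = symbol a \<and> norm b \<le> norm (symbol a) + e"
proof -
  obtain K where K: "compact_op K" "K \<in> serre_algebra s" "norm (a - K) \<le> norm (symbol a) + e"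
    using compact_approx_symbol[OF symbol_of_symbol[OF a] serre_algebra_corner(2,3)[OF a] e] by blast
  have "symbol K = 0" using symbol_kernel[OF K(2)] K(1) by simp
  then have "symbol (a - K) = symbol a"
    using symbol_eq[OF symbol_of_diff[OF symbol_of_symbol[OF a] symbol_of_symbol[OF K(2)]]] by simp
  then show ?thesis using cstar_algebraD(9)[OF cstar_serre a K(2)] K(3) by blast
qed

text \<open>Completeness of a quotient, carried out by hand: pass to a rapidly convergent
  subsequence, lift its differences with controlled norm, and sum the lifts.\<close>

lemma closed_symbol_range: "closed (symbol ` serre_algebra s)"
  unfolding closed_sequential_limits
proof (intro allI impI, elim conjE)
  note A = cstar_algebraD[OF cstar_serre]
  fix X T assume X: "\<forall>n. X n \<in> symbol ` serre_algebra s" "X \<longlonglongrightarrow> T"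
  have "\<exists>n. \<forall>k\<ge>n. norm (X k - T) < (1 / 2) ^ i" for i
    using LIMSEQ_D[OF X(2), of "(1 / 2) ^ i"] by simp
  then obtain r where r: "\<And>i k. k \<ge> r i \<Longrightarrow> norm (X k - T) < (1 / 2) ^ i" by metis
  define Y where "Y i = X (r i)" for i
  have Y: "norm (Y i - T) < (1 / 2) ^ i" for i unfolding Y_def by (rule r) simp
  have Yr: "\<exists>a\<in>serre_algebra s. symbol a = Y i" for i using X(1) unfolding Y_def by (metis imageE)
  \<comment> \<open>Consecutive terms differ by at most \<open>2 * (1 / 2) ^ i\<close>, and the
    slack in \<open>symbol_lift\<close> is another \<open>(1 / 2) ^ i\<close>.\<close>
  have d: "\<exists>b\<in>serre_algebra s. symbol b = Y (Suc i) - Y i \<and> norm b \<le> 3 * (1 / 2) ^ i" for i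
  proof -
    obtain a a' where a: "a \<in> serre_algebra s" "symbol a = Y (Suc i)" "a' \<in> serre_algebra s" "symbol a' = Y i"
      using Yr by meson
    have sym: "symbol (a - a') = Y (Suc i) - Y i"
      using symbol_eq[OF symbol_of_diff[OF symbol_of_symbol[OF a(1)] symbol_of_symbol[OF a(3)]]] a by simp
    obtain b where b: "b \<in> serre_algebra s" "symbol b = Y (Suc i) - Y i"
      "norm b \<le> norm (Y (Suc i) - Y i) + (1 / 2) ^ i"
      using symbol_lift[OF A(9)[OF a(1,3)], of "(1 / 2) ^ i"] unfolding sym by auto
    have "norm (Y (Suc i) - Y i) \<le> norm (Y (Suc i) - T) + norm (Y i - T)"
      using norm_triangle_ineq4[of "Y (Suc i) - T" "Y i - T"] by simp
    also have "\<dots> \<le> (1 / 2) ^ Suc i + (1 / 2) ^ i" using Y[of i] Y[of "Suc i"] by linarith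
    also have "\<dots> \<le> 2 * (1 / 2) ^ i" by simp
    finally show ?thesis using b by (intro bexI[of _ b]) auto
  qed
  then obtain b where b: "\<And>i. b i \<in> serre_algebra s" "\<And>i. symbol (b i) = Y (Suc i) - Y i"
    "\<And>i. norm (b i) \<le> 3 * (1 / 2) ^ i" by metis
  obtain a0 where a0: "a0 \<in> serre_algebra s" "symbol a0 = Y 0" using Yr by blast
  define S where "S n = a0 + (\<Sum>i<n. b i)" for n
  have S: "S n \<in> serre_algebra s \<and> symbol (S n) = Y n" for n
  proof (induction n)
    case 0
    show ?case using a0 by (simp add: S_def)
  next
    case (Suc n)
    have eq: "S (Suc n) = S n + b n" by (simp add: S_def)
    have "symbol (S n + b n) = symbol (S n) + symbol (b n)"
      using symbol_star_hom Suc b(1)[of n] unfolding star_hom_def by blast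
    then show ?case using Suc b(2) A(3)[of "S n" "b n"] b(1) unfolding eq by simp
  qed
  have "summable b"
    by (rule summable_norm_cancel, rule summable_comparison_test'[of "\<lambda>i. 3 * (1 / 2) ^ i"])
      (use b(3) in \<open>auto intro!: summable_mult summable_geometric\<close>)
  then have lim: "S \<longlonglongrightarrow> a0 + suminf b"
    unfolding S_def by (intro tendsto_add tendsto_const summable_LIMSEQ)
  then have a: "a0 + suminf b \<in> serre_algebra s"
    by (rule closed_sequentially[OF A(7), rotated]) (use S in blast)
  let ?a = "a0 + suminf b"
  have "Y \<longlonglongrightarrow> symbol ?a"
  proof (rule LIM_zero_cancel, rule tendsto_norm_zero_cancel, rule tendsto_sandwich[OF _ _ tendsto_const])
    have "norm (Y n - symbol ?a) \<le> norm (S n - ?a)" for n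
      using symbol_norm_le[OF symbol_of_diff[OF symbol_of_symbol symbol_of_symbol[OF a]], of "S n"] S[of n] by simp
    then show "\<forall>\<^sub>F n in sequentially. norm (Y n - symbol ?a) \<le> norm (S n - ?a)" by simp
    show "(\<lambda>n. norm (S n - ?a)) \<longlonglongrightarrow> 0" using lim by (simp add: LIM_zero tendsto_norm_zero)
  qed simp
  moreover have "Y \<longlonglongrightarrow> T"
  proof (rule LIM_zero_cancel, rule tendsto_norm_zero_cancel, rule tendsto_sandwich[OF _ _ tendsto_const])
    show "\<forall>\<^sub>F n in sequentially. norm (Y n - T) \<le> (1 / 2) ^ n"
      by (intro always_eventually allI less_imp_le Y)
    show "(\<lambda>n. (1 / 2) ^ n :: real) \<longlonglongrightarrow> 0" by (rule LIMSEQ_power_zero) simp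
  qed simp
  ultimately have "T = symbol ?a" by (intro LIMSEQ_unique)
  then show "T \<in> symbol ` serre_algebra s" using a by blast
qed

text \<open>The range is a C*-algebra, so it is enough to reach elementary tensors; each is the
  product of a Toeplitz operator tensored with the unit and the unit tensored with a function, and
  the second factor is the symbol of a multiplication operator.\<close>

lemma symbol_range: "symbol ` serre_algebra s = \<C>"
proof
  show "symbol ` serre_algebra s \<subseteq> \<C>" using symbol_star_hom by (auto simp: star_hom_def)
  let ?R = "symbol ` serre_algebra s"
  note A = cstar_algebraD[OF cstar_serre]
  note hom = symbol_star_hom[unfolded star_hom_def]
  have R: "cstar_algebra ?R"
    unfolding cstar_algebra_def
  proof (intro conjI ballI allI closed_symbol_range)
    show "0 \<in> ?R" using symbol_kernel[OF A(2)] A(2) by (auto intro: rev_image_eqI)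
    fix T assume "T \<in> ?R"
    then obtain a where a: "a \<in> serre_algebra s" "T = symbol a" by blast
    show "clinear_op T" unfolding a(2) by (rule symbol_of_clinear(2)[OF symbol_of_symbol[OF a(1)]])
    have "symbol (scale_op c a) = scale_op c T" "symbol (adj a) = adj T" for c using hom a by auto
    then show "scale_op c T \<in> ?R" "adj T \<in> ?R" for c
      using A(5,6)[OF a(1)] by (metis imageI)+
    fix U assume "U \<in> ?R"
    then obtain b where b: "b \<in> serre_algebra s" "U = symbol b" by blast
    have "symbol (a + b) = T + U" "symbol (a o\<^sub>L b) = T o\<^sub>L U" using hom a b by auto
    then show "T + U \<in> ?R" "T o\<^sub>L U \<in> ?R"
      using A(3,4)[OF a(1) b(1)] by (metis imageI)+
  qed
  note R' = cstar_algebraD[OF R]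
  \<comment> \<open>These \<open>t\<close> form a C*-algebra that contains the unilateral shift,
    which covers the Toeplitz algebra without a description of its elements; \<open>proj Z\<close>
    is the unit of the function algebra.\<close>
  let ?D = "{t. clinear_op t \<and> tensor_op t (proj Z) \<in> ?R}"
  have fin: "tensor_op id_blinfun (diag_op Z f) \<in> ?R" if "continuous_on Z f" for f
    using symbol_eq[OF symbol_of_mult[OF that]] mult_in[OF that] by (metis imageI)
  have split: "tensor_op t b = tensor_op t id_blinfun o\<^sub>L tensor_op id_blinfun b" if "clinear_op t" "clinear_op b"
    for t :: "nat ell2 \<Rightarrow>\<^sub>L nat ell2" and b :: "(nat \<Rightarrow> int) ell2 \<Rightarrow>\<^sub>L (nat \<Rightarrow> int) ell2"
    using tensor_op_compose[of t id_blinfun id_blinfun b] that by simp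
  have "cstar_algebra ?D"
    unfolding cstar_algebra_def
  proof (intro conjI ballI allI)
    have "tensor_op (0 :: nat ell2 \<Rightarrow>\<^sub>L nat ell2) (proj Z) = 0"
      by (rule tensor_op_eqI) (simp_all add: tensor_ell2.zero_left)
    then show "0 \<in> ?D" using R'(2) by simp
    show "closed ?D"
      unfolding closed_sequential_limits
    proof (intro allI impI, elim conjE)
      fix X t assume X: "\<forall>n. X n \<in> ?D" "X \<longlonglongrightarrow> t"
      have "t \<in> {a. clinear_op a}"
        by (rule closed_sequentially[OF closed_clinear_op _ X(2)]) (use X(1) in simp)
      then have t: "clinear_op t" by simp
      have lX: "clinear_op (X n)" for n using X(1) by simp
      have "(\<lambda>n. tensor_op (X n) id_blinfun) \<longlonglongrightarrow> (tensor_op t id_blinfun :: (nat \<times> (nat \<Rightarrow> int)) ell2 \<Rightarrow>\<^sub>L _)"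
      proof (rule LIM_zero_cancel, rule tendsto_norm_zero_cancel, rule tendsto_sandwich[OF _ _ tendsto_const])
        show "\<forall>\<^sub>F n in sequentially. norm (tensor_op (X n) id_blinfun - tensor_op t id_blinfun :: (nat \<times> (nat \<Rightarrow> int)) ell2 \<Rightarrow>\<^sub>L _) \<le> norm (X n - t)"
          using X(1) t by (intro always_eventually allI norm_tensor_diff_le) auto
        show "(\<lambda>n. norm (X n - t)) \<longlonglongrightarrow> 0" using X(2) by (simp add: LIM_zero tendsto_norm_zero)
      qed simp
      from blinfun_compose.tendsto[OF this tendsto_const[of "tensor_op id_blinfun (proj Z)"]]
      have "(\<lambda>n. tensor_op (X n) (proj Z)) \<longlonglongrightarrow> tensor_op t (proj Z)"
        unfolding split[OF t proj(1)] split[OF lX proj(1)] .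
      then have "tensor_op t (proj Z) \<in> ?R"
        by (rule closed_sequentially[OF R'(7), rotated]) (use X(1) in simp)
      then show "t \<in> ?D" using t by simp
    qed
    fix a assume a: "a \<in> ?D"
    then show "clinear_op a" by simp
    show "scale_op c a \<in> ?D" for c using a R'(5) by (simp add: tensor_op_scale_left)
    have "tensor_op (adj a) (proj Z) = adj (tensor_op a (proj Z))" using a by (simp add: adj_tensor_op)
    then show "adj a \<in> ?D" using a R'(6) by simp
    fix b assume b: "b \<in> ?D"
    show "a + b \<in> ?D" using a b R'(3) by (simp add: tensor_op_linear(1))
    have "tensor_op (a o\<^sub>L b) (proj Z) = tensor_op a (proj Z) o\<^sub>L tensor_op b (proj Z)"
      using a b tensor_op_compose[of a b "proj Z" "proj Z"] by (simp add: proj_compose)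
    then show "a o\<^sub>L b \<in> ?D" using a b R'(4) by simp
  qed
  moreover have "toeplitz_gen \<in> ?D"
    using symbol_eq[OF symbol_of_shift] shift_in by (auto intro: rev_image_eqI)
  ultimately have D: "toeplitz_algebra \<subseteq> ?D"
    unfolding toeplitz_algebra_def by (intro cstar_generated_minimal) auto
  have "tensor_op t b \<in> ?R" if t: "t \<in> toeplitz_algebra" and b: "b \<in> function_algebra Z" for t b
  proof -
    obtain f where f: "continuous_on Z f" "b = diag_op Z f" using b by (auto simp: function_algebra_def)
    have "proj Z o\<^sub>L b = b"
      unfolding f(2) by (intro blinfun_eqI ell2_eqI) (simp add: coef_diag_sadic f(1))
    then have "tensor_op t b = tensor_op t (proj Z) o\<^sub>L tensor_op id_blinfun b"
      using tensor_op_compose[of t id_blinfun "proj Z" b] t D f by auto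
    then show ?thesis using R'(4) fin[OF f(1)] t D f(2) by auto
  qed
  then show "\<C> \<subseteq> ?R"
    unfolding cstar_tensor_def
    by (intro closure_minimal span_minimal R'(7) R'(10)) auto
qed

section \<open>The ideal of compact operators\<close>

lemma countable_vertices: "\<exists>e :: nat \<Rightarrow> nat \<times> int. bij_betw e UNIV V"
proof -
  have "inj (\<lambda>n :: nat. (n, 0 :: int))" by (simp add: inj_def)
  then have "infinite (range (\<lambda>n :: nat. (n, 0 :: int)))" by (rule range_inj_infinite)
  moreover have "range (\<lambda>n :: nat. (n, 0 :: int)) \<subseteq> V" by (auto simp: vertices_iff)
  ultimately have "infinite V" using finite_subset by blast
  moreover have "countable V" by simp
  ultimately show ?thesis using bij_betw_from_nat_into by blast
qed

text \<open>An enumeration of the vertices gives an isometry onto the space they span; conjugation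
  by it identifies the compact operators on \<open>nat ell2\<close> with those supported on the
  vertices, and all of these lie in the algebra by \<open>compact_in\<close>.\<close>

lemma compact_embedding:
  "\<exists>\<iota>. star_hom (compact_ops :: (nat ell2 \<Rightarrow>\<^sub>L nat ell2) set) (serre_algebra s) \<iota> \<and>
    inj_on \<iota> compact_ops \<and> \<iota> ` compact_ops = {a \<in> serre_algebra s. compact_op a}"
proof -
  obtain e :: "nat \<Rightarrow> nat \<times> int" where e: "bij_betw e UNIV V" using countable_vertices by blast
  then have e': "e m = e n \<longleftrightarrow> m = n" for m n by (auto simp: bij_betw_def inj_def)
  define U where "U = op_of_basis (\<lambda>n. ket (e n))"
  have U: "clinear_op U" "U (ket n) = ket (e n)" for n
    unfolding U_def by (rule op_of_basis_orthogonal[where B = 1]; simp add: e')+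
  have U1: "adj U o\<^sub>L U = id_blinfun"
  proof (rule clinear_op_eqI)
    show "(adj U o\<^sub>L U) (ket n) = id_blinfun (ket n)" for n
      by (rule ell2_eqI) (simp add: coef_adj U e')
  qed (simp_all add: U)
  have U2: "U o\<^sub>L adj U = E"
  proof (rule clinear_op_eqI)
    fix p
    have "adj U (ket p) = (if p \<in> V then ket (inv_into UNIV e p) else 0)"
    proof (rule ell2_eqI)
      fix n
      have "e n = p \<longleftrightarrow> p \<in> V \<and> inv_into UNIV e p = n"
        using e by (metis UNIV_I bij_betwE bij_betw_inv_into_left bij_betw_inv_into_right)
      then show "coef (adj U (ket p)) n = coef (if p \<in> V then ket (inv_into UNIV e p) else 0) n"
        by (auto simp: coef_adj U)
    qed
    then show "(U o\<^sub>L adj U) (ket p) = E (ket p)"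
      using e by (simp add: U bij_betw_inv_into_right)
  qed (simp_all add: U)
  have EU: "E o\<^sub>L U = U" "adj U o\<^sub>L E = adj U"
    unfolding U2[symmetric] by (simp add: blinfun_compose_assoc U1) (simp add: U1 flip: blinfun_compose_assoc)
  define \<iota> where "\<iota> T = U o\<^sub>L T o\<^sub>L adj U" for T
  have inverse: "adj U o\<^sub>L \<iota> T o\<^sub>L U = T" for T
  proof -
    have "adj U o\<^sub>L \<iota> T o\<^sub>L U = (adj U o\<^sub>L U) o\<^sub>L T o\<^sub>L (adj U o\<^sub>L U)"
      by (simp only: \<iota>_def blinfun_compose_assoc)
    then show ?thesis by (simp add: U1)
  qed
  have c: "compact_op (\<iota> T)" "\<iota> T \<in> serre_algebra s" if T: "compact_op T" for T
  proof -
    show i: "compact_op (\<iota> T)"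
      unfolding \<iota>_def using T U by (intro compact_op_compose_left compact_op_compose_right) auto
    have "E o\<^sub>L \<iota> T = \<iota> T" "\<iota> T o\<^sub>L E = \<iota> T"
      unfolding \<iota>_def by (simp_all add: EU flip: blinfun_compose_assoc) (simp add: EU blinfun_compose_assoc)
    then show "\<iota> T \<in> serre_algebra s" by (rule compact_in[OF i])
  qed
  have "star_hom compact_ops (serre_algebra s) \<iota>"
    unfolding star_hom_def compact_ops_eq
  proof (intro conjI ballI allI)
    fix S assume "S \<in> {T :: nat ell2 \<Rightarrow>\<^sub>L nat ell2. compact_op T}"
    then have S: "compact_op S" by simp
    show "\<iota> S \<in> serre_algebra s" by (rule c[OF S])
    show "\<iota> (scale_op c S) = scale_op c (\<iota> S)" for c
      unfolding \<iota>_def by (simp add: scale_op_eq U)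
    show "\<iota> (adj S) = adj (\<iota> S)"
      unfolding \<iota>_def using S U by (simp add: adj_compose blinfun_compose_assoc)
    fix T assume "T \<in> {T :: nat ell2 \<Rightarrow>\<^sub>L nat ell2. compact_op T}"
    show "\<iota> (S + T) = \<iota> S + \<iota> T"
      unfolding \<iota>_def by (simp add: blinfun_compose.add_left blinfun_compose.add_right)
    have "\<iota> S o\<^sub>L \<iota> T = U o\<^sub>L S o\<^sub>L (adj U o\<^sub>L U) o\<^sub>L T o\<^sub>L adj U"
      unfolding \<iota>_def by (simp only: blinfun_compose_assoc)
    then show "\<iota> (S o\<^sub>L T) = \<iota> S o\<^sub>L \<iota> T"
      unfolding \<iota>_def by (simp add: U1 blinfun_compose_assoc)
  qed
  moreover have "inj_on \<iota> compact_ops" by (rule inj_on_inverseI[of _ "\<lambda>a. adj U o\<^sub>L a o\<^sub>L U"]) (rule inverse)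
  moreover have "\<iota> ` compact_ops = {a \<in> serre_algebra s. compact_op a}"
  proof
    show "\<iota> ` compact_ops \<subseteq> {a \<in> serre_algebra s. compact_op a}" using c by (auto simp: compact_ops_eq)
    show "{a \<in> serre_algebra s. compact_op a} \<subseteq> \<iota> ` compact_ops"
    proof safe
      fix a assume a: "a \<in> serre_algebra s" "compact_op a"
      have "\<iota> (adj U o\<^sub>L a o\<^sub>L U) = (U o\<^sub>L adj U) o\<^sub>L a o\<^sub>L (U o\<^sub>L adj U)"
        by (simp only: \<iota>_def blinfun_compose_assoc)
      also have "\<dots> = a" unfolding U2 by (simp add: serre_algebra_corner[OF a(1)])
      finally have "a = \<iota> (adj U o\<^sub>L a o\<^sub>L U)" by simp
      moreover have "adj U o\<^sub>L a o\<^sub>L U \<in> compact_ops"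
        unfolding compact_ops_eq
        by (intro CollectI compact_op_compose_right[OF compact_op_compose_left[OF a(2)]] clinear_adj U(1))
      ultimately show "a \<in> \<iota> ` compact_ops" by (rule image_eqI)
    qed
  qed
  ultimately show ?thesis by blast
qed

lemma serre_exact:
  "\<exists>\<iota> \<pi>. short_exact (compact_ops :: (nat ell2 \<Rightarrow>\<^sub>L nat ell2) set) \<iota> (serre_algebra s) \<pi> \<C>"
proof -
  obtain \<iota> where \<iota>: "star_hom (compact_ops :: (nat ell2 \<Rightarrow>\<^sub>L nat ell2) set) (serre_algebra s) \<iota>"
    "inj_on \<iota> compact_ops" "\<iota> ` compact_ops = {a \<in> serre_algebra s. compact_op a}"
    using compact_embedding by blast
  have "{a \<in> serre_algebra s. compact_op a} = {a \<in> serre_algebra s. symbol a = 0}"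
    using symbol_kernel by blast
  then have "short_exact compact_ops \<iota> (serre_algebra s) symbol \<C>"
    unfolding short_exact_def
    using \<iota> cstar_algebra_compact_ops cstar_serre cstar_symbols symbol_star_hom symbol_range by simp
  then show ?thesis by blast
qed

end

theorem theorem7p3:
  fixes s :: int
  assumes "s \<ge> 2"
  shows "\<exists>\<iota> \<pi>. short_exact (compact_ops :: (nat ell2 \<Rightarrow>\<^sub>L nat ell2) set) \<iota> (serre_algebra s) \<pi>
    (cstar_tensor toeplitz_algebra (function_algebra (sadic_ints s)))"
proof -
  interpret serre s by unfold_locales (rule assms)
  show ?thesis by (rule serre_exact)
qed

end
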